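(* Let $p$ be an odd prime and let $P$ be a finite $p$-group of nilpotency class $2$ and exponent $p$. (i) If $\mathcal{H}$ and $\mathcal{K}$ are fully refined central decompositions of $P$, then $|\mathcal{H}|=|\mathcal{K}|$, the multisets $\{|H| : H\in\mathcal{H}\}$ and $\{|K| : K\in\mathcal{K}\}$ coincide, and the multisets $\{|Z(H)| : H\in\mathcal{H}\}$ and $\{|Z(K)| : K\in\mathcal{K}\}$ coincide. (ii) For every positive integer $N$ there exists a finite $p$-group $P$ of class $2$ and exponent $p$ such that the natural action of $\operatorname{Aut} P$ on the set of fully refined central decompositions of $P$ has exactly $N$ orbits.
   Context: A central decomposition of a group $G$ is a set $\mathcal{H}$ of subgroups of $G$ such that distinct members commute elementwise ($[H,K]=1$ for distinct $H,K\in\mathcal{H}$), $G$ is generated by $\mathcal{H}$, and no proper subset of $\mathcal{H}$ generates $G$. A group is centrally indecomposable if its only central decomposition is $\{G\}$. A central decomposition is fully refined if all its members are centrally indecomposable. $\operatorname{Aut} P$ acts on central decompositions by $\mathcal{H}\alpha=\{H\alpha : H\in\mathcal{H}\}$. *)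

theory Defs
  imports "HOL-Algebra.Algebra" "HOL-Library.Multiset"
begin

definition group_center :: "('a, 'b) monoid_scheme \<Rightarrow> 'a set" where
  "group_center G = {z \<in> carrier G. \<forall>x \<in> carrier G. z \<otimes>\<^bsub>G\<^esub> x = x \<otimes>\<^bsub>G\<^esub> z}"

definition central_decomp :: "('a, 'b) monoid_scheme \<Rightarrow> 'a set set \<Rightarrow> bool" where
  "central_decomp G Hs \<longleftrightarrow>
     (\<forall>H \<in> Hs. subgroup H G) \<and>
     (\<forall>H \<in> Hs. \<forall>K \<in> Hs. H \<noteq> K \<longrightarrow>
        (\<forall>x \<in> H. \<forall>y \<in> K. x \<otimes>\<^bsub>G\<^esub> y = y \<otimes>\<^bsub>G\<^esub> x)) \<and>
     generate G (\<Union> Hs) = carrier G \<and>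
     (\<forall>Ks. Ks \<subset> Hs \<longrightarrow> generate G (\<Union> Ks) \<noteq> carrier G)"

definition centrally_indecomposable :: "('a, 'b) monoid_scheme \<Rightarrow> bool" where
  "centrally_indecomposable G \<longleftrightarrow> (\<forall>Hs. central_decomp G Hs \<longleftrightarrow> Hs = {carrier G})"

definition fully_refined :: "('a, 'b) monoid_scheme \<Rightarrow> 'a set set \<Rightarrow> bool" where
  "fully_refined G Hs \<longleftrightarrow> central_decomp G Hs \<and>
     (\<forall>H \<in> Hs. centrally_indecomposable (G\<lparr>carrier := H\<rparr>))"

definition class2_exp_p_group :: "nat \<Rightarrow> ('a, 'b) monoid_scheme \<Rightarrow> bool" where
  "class2_exp_p_group p G \<longleftrightarrow> group G \<and> finite (carrier G) \<and>
     (\<exists>n. order G = p ^ n) \<and>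
     derived G (carrier G) \<subseteq> group_center G \<and>
     derived G (carrier G) \<noteq> {\<one>\<^bsub>G\<^esub>} \<and>
     (\<forall>x \<in> carrier G. x [^]\<^bsub>G\<^esub> p = \<one>\<^bsub>G\<^esub>)"

definition act_decomp :: "('a \<Rightarrow> 'a) \<Rightarrow> 'a set set \<Rightarrow> 'a set set" where
  "act_decomp \<alpha> Hs = (\<lambda>H. \<alpha> ` H) ` Hs"

definition fr_orbits :: "('a, 'b) monoid_scheme \<Rightarrow> 'a set set set set" where
  "fr_orbits G = (\<lambda>Hs. {act_decomp \<alpha> Hs | \<alpha>. \<alpha> \<in> auto G}) ` {Hs. fully_refined G Hs}"

end

(*
  Let V = P/P' and let A be the finite ring of the pairs (f, g) of endomorphisms of V that are adjoint
  with respect to the commutator form, with the involution (f, g) -> (g, f). The projections of a fully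
  refined central decomposition form a frame of A: pairwise orthogonal self-adjoint idempotents with sum
  1, none of which is a proper sum of self-adjoint idempotents. In a corner e A e of such an idempotent
  every self-adjoint element is a unit or lies in the radical. Hence e A f lies in the radical unless e
  and f are equivalent (e = x y, f = y x), so any two frames contain equally many members of each
  equivalence class. A nonabelian member H has Z(H) = H', an abelian one has order p, and in both cases
  |H| and |Z(H)| are determined by |e V| and by the span of the commutators [V, e V], which depend on the
  class of e only.

  For the orbits take n = 2N - 1, X = K^n with the standard form over the field K of p elements, and
  P = X^3 x K^3 with (u, t) (v, s) = (u + v, t + s + u x v), where the cross product multiplies vectors by
  the form. The self-adjoint operators of this bilinear map are those of X acting diagonally, so fully
  refined decompositions correspond to orthogonal bases of X up to rescaling. Two bases are conjugate if
  the same number m of their members has nonsquare norm; m is even by a determinant, and every even m up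
  to n occurs since some nonsquare is a sum of two squares. Conversely an automorphism multiplies all the
  norms by a common square class, thus preserves m or replaces it by n - m, which is odd.
*)
theory Submission
  imports Defs "HOL-Library.Product_Plus" "HOL-Library.Function_Algebras" "Jordan_Normal_Form.Determinant"
begin

section \<open>Nil radicals of finite rings\<close>

text \<open>The equivalence \<open>e = x y\<close>, \<open>f = y x\<close> forgets the involution. A
  finer relation could not serve: two frames need not be conjugate under elements that respect the
  involution, and the second half of the theorem lives on exactly this failure.

  The obstacle in a corner is a self-adjoint nilpotent element outside the radical. It leads to an
  element \<open>n\<close> of square zero inside a copy of the 2 by 2 matrices whose involution
  exchanges the two diagonal units; there \<open>1/2 (1 + n + m)\<close>, with \<open>m\<close> the
  unit opposite to \<open>n\<close>, splits the identity. So 2 has to be invertible. The passage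
  from corners to \<open>e A f\<close> is a polarization: if \<open>e\<close> and \<open>f\<close>
  are inequivalent, \<open>z z*\<close> is radical for every \<open>z\<close> in
  \<open>e A f\<close>, and \<open>z = x + y*\<close> brings \<open>x y + (x y)*\<close> into the
  radical.

  Three copies of \<open>X\<close> are taken because two are too few: on \<open>X^2\<close> the
  analogous map is a single alternating form, all of whose decompositions are conjugate. The third
  axis compels the operators on the axes to coincide and to be self-adjoint, so that only orthogonal
  bases of \<open>X\<close> survive.\<close>

definition nilp :: "('a, 'b) ring_scheme \<Rightarrow> 'a \<Rightarrow> bool" where
  "nilp R x \<longleftrightarrow> (\<exists>k. x [^]\<^bsub>R\<^esub> Suc k = \<zero>\<^bsub>R\<^esub>)"

text \<open>In a finite ring this is the Jacobson radical: the elements that generate a nil right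
  ideal. The one-sided form is the easiest to check; \<open>nilrad_closed\<close> supplies the other
  side.\<close>

definition nilrad :: "('a, 'b) ring_scheme \<Rightarrow> 'a set" where
  "nilrad R = {x \<in> carrier R. \<forall>a \<in> carrier R. nilp R (x \<otimes>\<^bsub>R\<^esub> a)}"

context ring
begin

lemma pow_shift:
  assumes "x \<in> carrier R" "y \<in> carrier R"
  shows "(x \<otimes> y) [^] Suc k = x \<otimes> (y \<otimes> x) [^] k \<otimes> y"
proof (induction k)
  case (Suc k)
  have "(x \<otimes> y) [^] Suc (Suc k) = (x \<otimes> (y \<otimes> x) [^] k \<otimes> y) \<otimes> (x \<otimes> y)"
    using Suc by simp
  then show ?case using assms by (simp add: m_assoc)
qed (use assms in simp)

lemma nilp_swap:
  assumes "x \<in> carrier R" "y \<in> carrier R" "nilp R (x \<otimes> y)"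
  shows "nilp R (y \<otimes> x)"
proof -
  obtain k where "(x \<otimes> y) [^] Suc k = \<zero>" using assms(3) unfolding nilp_def by blast
  then have "(y \<otimes> x) [^] Suc (Suc k) = \<zero>"
    using assms by (simp only: pow_shift m_closed) simp
  then show ?thesis unfolding nilp_def by blast
qed

lemma nilp_pow:
  assumes "x \<in> carrier R" "nilp R (x [^] Suc k)"
  shows "nilp R x"
proof -
  obtain j where "(x [^] Suc k) [^] Suc j = \<zero>" using assms(2) unfolding nilp_def by blast
  then have "x [^] (Suc k * Suc j) = \<zero>" using assms(1) by (simp only: nat_pow_pow)
  then have "x [^] Suc (k * Suc j + j) = \<zero>" by (simp add: algebra_simps)
  then show ?thesis unfolding nilp_def by blast
qed

lemma idem_pow:
  assumes "x \<in> carrier R" "x \<otimes> x = x"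
  shows "x [^] Suc k = x"
  using assms by (induction k) auto

lemma nilp_idem:
  assumes "x \<in> carrier R" "x \<otimes> x = x" "nilp R x"
  shows "x = \<zero>"
  using assms idem_pow unfolding nilp_def by auto

text \<open>The powers of \<open>x\<close> are eventually periodic by the pigeonhole principle, and
  an exponent that is a multiple of the period and lies beyond the preperiod may be doubled. This
  takes the place of Fitting's lemma as the source of idempotents.\<close>

lemma pow_idempotent:
  assumes "finite (carrier R)" "x \<in> carrier R"
  shows "\<exists>k. x [^] Suc k \<otimes> x [^] Suc k = x [^] Suc k"
proof -
  have "\<not> inj (\<lambda>i::nat. x [^] i)"
  proof
    assume "inj (\<lambda>i::nat. x [^] i)"
    then have "infinite (range (\<lambda>i::nat. x [^] i))" by (simp add: range_inj_infinite)
    moreover have "range (\<lambda>i::nat. x [^] i) \<subseteq> carrier R" using assms by auto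
    ultimately show False using assms(1) finite_subset by blast
  qed
  then obtain i j :: nat where ij: "i < j" "x [^] i = x [^] j"
    unfolding inj_def by (metis linorder_neqE_nat)
  define d where "d = j - i"
  have d: "d > 0" "x [^] (i + d) = x [^] i" using ij by (auto simp: d_def)
  have 1: "x [^] (i + m) = x [^] (i + m + d)" for m
    using d(2) assms(2) by (metis add.commute add.left_commute nat_pow_mult)
  have 2: "x [^] (i + m) = x [^] (i + m + l * d)" for m l
  proof (induction l)
    case (Suc l)
    have "x [^] (i + m + l * d) = x [^] (i + m + l * d + d)"
      using 1[of "m + l * d"] by (simp add: add.assoc)
    then show ?case using Suc by (simp add: algebra_simps)
  qed simp
  \<comment> \<open>A positive multiple of the period \<open>d\<close> that is at least the
    preperiod \<open>i\<close>.\<close>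
  define N where "N = Suc i * d"
  have "N \<ge> i" using d(1) unfolding N_def by (cases d) auto
  then have e: "i + (N - i) = N" by simp
  have "x [^] (N + N) = x [^] N" using 2[of "N - i" "Suc i", symmetric] unfolding e N_def[symmetric] .
  then have "x [^] N \<otimes> x [^] N = x [^] N" by (simp only: nat_pow_mult[OF assms(2)])
  moreover have "N = Suc (N - 1)" using d(1) by (simp add: N_def)
  ultimately show ?thesis by metis
qed

text \<open>Nilpotency of a product survives cyclic rotation of its factors, so
  \<open>a x b c\<close> may be compared with \<open>x b c a\<close>.\<close>

lemma nilrad_closed:
  assumes "x \<in> nilrad R" "a \<in> carrier R" "b \<in> carrier R"
  shows "a \<otimes> x \<otimes> b \<in> nilrad R"
proof -
  have x: "x \<in> carrier R" using assms unfolding nilrad_def by auto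
  have "nilp R (a \<otimes> x \<otimes> b \<otimes> c)" if "c \<in> carrier R" for c
  proof -
    have "nilp R (x \<otimes> (b \<otimes> c \<otimes> a))" using assms that unfolding nilrad_def by auto
    then have "nilp R ((x \<otimes> (b \<otimes> c)) \<otimes> a)" using assms x that by (simp add: m_assoc)
    then have "nilp R (a \<otimes> (x \<otimes> (b \<otimes> c)))" using nilp_swap assms x that by simp
    then show ?thesis using assms x that by (simp add: m_assoc)
  qed
  then show ?thesis using assms x unfolding nilrad_def by auto
qed

lemma nilrad_carrier: "x \<in> nilrad R \<Longrightarrow> x \<in> carrier R"
  unfolding nilrad_def by simp

lemma nilrad_l: "x \<in> nilrad R \<Longrightarrow> a \<in> carrier R \<Longrightarrow> a \<otimes> x \<in> nilrad R"
  using nilrad_closed[of x a \<one>] by (simp add: nilrad_carrier)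

lemma nilrad_r: "x \<in> nilrad R \<Longrightarrow> a \<in> carrier R \<Longrightarrow> x \<otimes> a \<in> nilrad R"
  using nilrad_closed[of x \<one> a] by (simp add: nilrad_carrier)

lemma nilrad_nilp: "x \<in> nilrad R \<Longrightarrow> nilp R x"
  unfolding nilrad_def by (metis (mono_tags, lifting) mem_Collect_eq one_closed r_one)

text \<open>A power of \<open>z = (x + y) a\<close> is an idempotent \<open>g\<close>. Inside the
  corner of \<open>g\<close> it is a sum \<open>u + v\<close> of two radical elements, which commute
  because \<open>v\<close> is \<open>g\<close> minus \<open>u\<close>. As \<open>u\<close> is
  nilpotent, \<open>g\<close> is a multiple of \<open>v\<close> and hence nilpotent, which makes
  \<open>z\<close> nilpotent.\<close>

lemma nilrad_add:
  assumes fin: "finite (carrier R)" and x: "x \<in> nilrad R" and y: "y \<in> nilrad R"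
  shows "x \<oplus> y \<in> nilrad R"
proof -
  have xy: "x \<in> carrier R" "y \<in> carrier R" using x y nilrad_carrier by auto
  have "nilp R ((x \<oplus> y) \<otimes> a)" if a: "a \<in> carrier R" for a
  proof -
    define z where "z = (x \<oplus> y) \<otimes> a"
    have z: "z \<in> carrier R" using xy a z_def by simp
    obtain k where k: "z [^] Suc k \<otimes> z [^] Suc k = z [^] Suc k"
      using pow_idempotent[OF fin z] by blast
    define g where "g = z [^] Suc k"
    have g: "g \<in> carrier R" "g \<otimes> g = g" using z k by (auto simp: g_def)
    define b where "b = a \<otimes> z [^] k"
    have b: "b \<in> carrier R" using a z b_def by simp
    have gb: "g = x \<otimes> b \<oplus> y \<otimes> b"
      unfolding g_def nat_pow_Suc2[OF z] using xy a z by (simp add: z_def b_def l_distr m_assoc)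
    define u where "u = g \<otimes> x \<otimes> (b \<otimes> g)"
    define v where "v = g \<otimes> y \<otimes> (b \<otimes> g)"
    have u: "u \<in> nilrad R" and v: "v \<in> nilrad R"
      unfolding u_def v_def using nilrad_closed x y b g by simp_all
    have uc: "u \<in> carrier R" "v \<in> carrier R" using u v nilrad_carrier by auto
    have gu: "g \<otimes> u = u" "u \<otimes> g = u"
      unfolding u_def using g b xy by (simp_all add: m_assoc[symmetric]) (simp add: m_assoc)
    have "g = g \<otimes> (x \<otimes> b \<oplus> y \<otimes> b) \<otimes> g" using gb g by metis
    then have guv: "g = u \<oplus> v" unfolding u_def v_def using g b xy
      by (simp add: m_assoc l_distr r_distr)
    have comm: "u \<otimes> v = v \<otimes> u"
    proof -
      have "u \<otimes> u \<oplus> u \<otimes> v = u \<otimes> u \<oplus> v \<otimes> u"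
        using gu guv uc by (metis l_distr r_distr)
      then show ?thesis using uc by (metis add.l_cancel m_closed)
    qed
    \<comment> \<open>Since \<open>g = u + v\<close> is the identity for \<open>u\<close>,
      multiplying a power of \<open>u\<close> by \<open>u + v\<close> changes nothing and raises the
      exponent up to a multiple of \<open>v\<close>; these multiples are collected in
      \<open>w\<close>.\<close>
    have "\<exists>w \<in> carrier R. g = u [^] Suc j \<oplus> v \<otimes> w" for j
    proof (induction j)
      case 0
      have "v \<otimes> \<one> = v" using uc by simp
      then show ?case using guv uc by (intro bexI[of _ "\<one>"]) auto
    next
      case (Suc j)
      then obtain w where w: "w \<in> carrier R" "g = u [^] Suc j \<oplus> v \<otimes> w" by blast
      have c: "u [^] Suc j \<otimes> v = v \<otimes> u [^] Suc j"
        using comm uc by (simp only: group_commutes_pow)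
      have pg: "u [^] Suc j \<otimes> g = u [^] Suc j" using gu uc g by (simp add: m_assoc)
      have "u [^] Suc j = u [^] Suc j \<otimes> (u \<oplus> v)" using pg guv by simp
      also have "\<dots> = u [^] Suc (Suc j) \<oplus> v \<otimes> u [^] Suc j"
        using uc c by (simp add: r_distr)
      finally have "g = (u [^] Suc (Suc j) \<oplus> v \<otimes> u [^] Suc j) \<oplus> v \<otimes> w" using w by metis
      also have "\<dots> = u [^] Suc (Suc j) \<oplus> v \<otimes> (u [^] Suc j \<oplus> w)"
        using uc w by (simp add: r_distr a_assoc del: nat_pow_Suc)
      finally show ?case using uc w by (intro bexI[of _ "u [^] Suc j \<oplus> w"]) auto
    qed
    moreover obtain j where "u [^] Suc j = \<zero>" using nilrad_nilp[OF u] unfolding nilp_def by blast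
    ultimately obtain w where "w \<in> carrier R" "g = v \<otimes> w"
      using uc by (metis l_zero m_closed)
    then have "nilp R g" using v unfolding nilrad_def by auto
    then have "nilp R z" unfolding g_def by (rule nilp_pow[OF z])
    then show ?thesis unfolding z_def .
  qed
  then show ?thesis using xy unfolding nilrad_def by auto
qed

lemma nilrad_zero: "\<zero> \<in> nilrad R"
  unfolding nilrad_def nilp_def by simp

lemma nilrad_uminus: "x \<in> nilrad R \<Longrightarrow> \<ominus> x \<in> nilrad R"
  using nilrad_r[of x "\<ominus> \<one>"] by (simp add: nilrad_carrier r_minus)

lemma nilrad_ideal:
  assumes "finite (carrier R)"
  shows "ideal (nilrad R) R"
proof (rule idealI)
  show "subgroup (nilrad R) (add_monoid R)"
    using nilrad_carrier nilrad_add[OF assms] nilrad_zero nilrad_uminus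
    by (unfold_locales) (auto simp: a_inv_def)
qed (use ring_axioms nilrad_l nilrad_r in auto)

end

section \<open>Finite rings with involution\<close>

text \<open>The element \<open>half\<close> is where the oddness of \<open>p\<close> enters: it
  gives the self-adjoint part \<open>half (x + star x)\<close> of any element, and the idempotents
  \<open>half (1 + z)\<close> for square roots \<open>z\<close> of 1.\<close>

locale star_ring = ring R for R (structure) +
  fixes star :: "'a \<Rightarrow> 'a" and half :: 'a
  assumes fin: "finite (carrier R)"
    and star_closed [simp]: "x \<in> carrier R \<Longrightarrow> star x \<in> carrier R"
    and star_star [simp]: "x \<in> carrier R \<Longrightarrow> star (star x) = x"
    and star_add: "\<lbrakk>x \<in> carrier R; y \<in> carrier R\<rbrakk> \<Longrightarrow> star (x \<oplus> y) = star x \<oplus> star y"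
    and star_mult: "\<lbrakk>x \<in> carrier R; y \<in> carrier R\<rbrakk> \<Longrightarrow> star (x \<otimes> y) = star y \<otimes> star x"
    and half_closed [simp]: "half \<in> carrier R"
    and half_half: "half \<oplus> half = \<one>"
begin

text \<open>The product \<open>half x half\<close>, doubled on either side, gives both
  \<open>x half\<close> and \<open>half x\<close>.\<close>

lemma half_comm: 
  assumes "x \<in> carrier R" shows "half \<otimes> x = x \<otimes> half"
proof -
  have "x \<otimes> half = (half \<oplus> half) \<otimes> (x \<otimes> half)" using assms half_half by simp
  also have "\<dots> = half \<otimes> x \<otimes> (half \<oplus> half)" using assms by (simp add: l_distr r_distr m_assoc)
  finally show ?thesis using assms half_half by simp
qed

lemma half_unique: 
  assumes "x \<in> carrier R" "x \<oplus> x = \<one>" shows "x = half"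
proof -
  have "x = x \<otimes> (half \<oplus> half)" using assms half_half by simp
  also have "\<dots> = (x \<oplus> x) \<otimes> half" using assms(1) by (simp add: l_distr r_distr)
  finally show ?thesis using assms by simp
qed

lemma star_zero [simp]: "star \<zero> = \<zero>"
proof -
  have "star \<zero> = star \<zero> \<oplus> star \<zero>" using star_add[of \<zero> \<zero>] by simp
  then show ?thesis using add.r_cancel_one' by force
qed

lemma star_one [simp]: "star \<one> = \<one>"
  by (metis one_closed r_one star_closed star_mult star_star)

lemma star_half [simp]: "star half = half"
  by (rule half_unique) (simp_all add: star_add[symmetric] half_half)

lemma star_uminus: 
  assumes "x \<in> carrier R" shows "star (\<ominus> x) = \<ominus> star x"
proof -
  have "star (\<ominus> x) \<oplus> star x = \<zero>" using assms star_add[of "\<ominus> x" x] by (simp add: l_neg)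
  then show ?thesis using minus_equality assms by (metis a_inv_closed star_closed)
qed

lemma star_pow:
  assumes "x \<in> carrier R" shows "star (x [^] (k::nat)) = star x [^] k"
proof (induction k)
  case (Suc k)
  have "star (x [^] Suc k) = star x \<otimes> star x [^] k" using assms Suc by (simp add: star_mult)
  then show ?case by (simp only: nat_pow_Suc2[OF star_closed[OF assms]])
qed simp

lemma half_cancel: 
  assumes "x \<in> carrier R" shows "half \<otimes> (x \<oplus> x) = x" "(half \<otimes> x) \<oplus> (half \<otimes> x) = x"
proof -
  have "half \<otimes> (x \<oplus> x) = (half \<oplus> half) \<otimes> x" using assms by (simp add: r_distr l_distr)
  then show "half \<otimes> (x \<oplus> x) = x" using assms half_half by simp
  then show "(half \<otimes> x) \<oplus> (half \<otimes> x) = x" using assms by (simp add: r_distr)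
qed

lemma nilrad_star: 
  assumes "x \<in> nilrad R" shows "star x \<in> nilrad R"
proof -
  have x: "x \<in> carrier R" using assms nilrad_carrier by auto
  have "nilp R (star x \<otimes> a)" if a: "a \<in> carrier R" for a
  proof -
    have "nilp R (x \<otimes> star a)" using assms a unfolding nilrad_def by auto
    then have "nilp R (star a \<otimes> x)" using nilp_swap x a by simp
    then obtain k where "(star a \<otimes> x) [^] Suc k = \<zero>" unfolding nilp_def by blast
    then have "star ((star a \<otimes> x) [^] Suc k) = \<zero>" by simp
    then have "(star x \<otimes> a) [^] Suc k = \<zero>" using x a by (simp only: star_pow m_closed star_closed star_mult star_star)
    then show ?thesis unfolding nilp_def by blast
  qed
  then show ?thesis using x unfolding nilrad_def by auto
qed

end

text \<open>The self-adjoint elements of such a ring form a finite Jordan algebra whose only idempotents are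
  \<open>0\<close> and \<open>1\<close>, i.e. a local one.\<close>

locale jordan_local = star_ring +
  assumes triv: "\<lbrakk>g \<in> carrier R; g \<otimes> g = g; star g = g\<rbrakk> \<Longrightarrow> g = \<zero> \<or> g = \<one>"
begin

text \<open>Some positive power of \<open>x\<close> is an idempotent; it is self-adjoint like
  \<open>x\<close>, hence 0 or 1.\<close>

lemma sa_cases:
  assumes "x \<in> carrier R" "star x = x"
  shows "nilp R x \<or> (\<exists>k. x [^] Suc k = \<one>)"
proof -
  obtain k where k: "x [^] Suc k \<otimes> x [^] Suc k = x [^] Suc k"
    using pow_idempotent[OF fin assms(1)] by blast
  have "star (x [^] Suc k) = x [^] Suc k" by (simp only: star_pow[OF assms(1)] assms(2))
  then have "x [^] Suc k = \<zero> \<or> x [^] Suc k = \<one>"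
    using triv[of "x [^] Suc k"] k assms(1) by blast
  then show ?thesis unfolding nilp_def by blast
qed

text \<open>If \<open>n r\<close> is not nilpotent, then \<open>n\<close> and \<open>n r\<close> generate a copy of the 2 by 2 matrices in which
  \<open>n\<close> is an off-diagonal unit, and \<open>1/2 (1 + n + m)\<close>, with \<open>m\<close> the opposite unit, is a
  nontrivial self-adjoint idempotent.\<close>

lemma square_zero:
  assumes n: "n \<in> carrier R" "star n = n" "n \<otimes> n = \<zero>" and r: "r \<in> carrier R"
  shows "nilp R (n \<otimes> r)"
proof (rule ccontr)
  assume nn: "\<not> nilp R (n \<otimes> r)"
  \<comment> \<open>A self-adjoint element whose powers act on \<open>n\<close> like those of
    \<open>n r\<close>, because \<open>n n = 0\<close> kills the other summand. So it inherits
    non-nilpotency, and some power of it is 1.\<close>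
  define x where "x = n \<otimes> r \<oplus> star r \<otimes> n"
  have x: "x \<in> carrier R" "star x = x"
    using n r by (auto simp: x_def star_add star_mult a_comm)
  have nnz: "n \<otimes> (n \<otimes> z) = \<zero>" if "z \<in> carrier R" for z
    using n that by (simp add: m_assoc[symmetric])
  have ny: "n \<otimes> ((n \<otimes> r) [^] (k::nat) \<otimes> n) = \<zero>" for k
  proof (cases k)
    case (Suc j)
    have "(n \<otimes> r) [^] Suc j = n \<otimes> (r \<otimes> (n \<otimes> r) [^] j)"
      using n r by (simp only: nat_pow_Suc2 m_closed m_assoc nat_pow_closed)
    then show ?thesis using n r by (simp only: Suc) (simp add: m_assoc nnz)
  qed (use n in simp)
  have xn: "x [^] k \<otimes> n = (n \<otimes> r) [^] k \<otimes> n" for k :: nat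
  proof (induction k)
    case (Suc k)
    have "x [^] Suc k \<otimes> n = x \<otimes> (x [^] k \<otimes> n)"
      using x n by (simp only: nat_pow_Suc2 m_assoc nat_pow_closed)
    also have "\<dots> = (n \<otimes> r \<oplus> star r \<otimes> n) \<otimes> ((n \<otimes> r) [^] k \<otimes> n)"
      using Suc x_def by simp
    also have "\<dots> = n \<otimes> r \<otimes> ((n \<otimes> r) [^] k \<otimes> n)"
      using n r ny[of k] by (simp add: l_distr m_assoc)
    also have "\<dots> = (n \<otimes> r) [^] Suc k \<otimes> n"
      using n r by (simp only: nat_pow_Suc2 m_assoc nat_pow_closed m_closed)
    finally show ?case .
  qed (use n in simp)
  have "\<not> nilp R x"
  proof
    assume "nilp R x"
    then obtain k where "x [^] Suc k = \<zero>" unfolding nilp_def by blast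
    then have "(n \<otimes> r) [^] Suc k \<otimes> n = \<zero>" using xn[of "Suc k"] n by simp
    then have "(n \<otimes> r) [^] Suc (Suc k) = \<zero>"
      using n r by (metis m_assoc m_closed nat_pow_Suc nat_pow_closed l_null)
    then show False using nn unfolding nilp_def by blast
  qed
  then obtain k where "x [^] Suc k = \<one>" using sa_cases[OF x] by blast
  then have nk: "(n \<otimes> r) [^] Suc k \<otimes> n = n" using xn[of "Suc k"] n by simp
  \<comment> \<open>Read off from \<open>(n r)^(k+1) n = n\<close>, so that
    \<open>n q n = n\<close>.\<close>
  define q where "q = r \<otimes> (n \<otimes> r) [^] k"
  have q: "q \<in> carrier R" using n r q_def by simp
  have nqn: "n \<otimes> (q \<otimes> n) = n"
    using nk n r unfolding q_def by (simp only: nat_pow_Suc2 m_assoc nat_pow_closed m_closed)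
  have nqn': "n \<otimes> (star q \<otimes> n) = n"
    using arg_cong[OF nqn, of star] n q by (simp add: star_mult m_assoc)
  have nqnz: "n \<otimes> (q \<otimes> (n \<otimes> z)) = n \<otimes> z" "n \<otimes> (star q \<otimes> (n \<otimes> z)) = n \<otimes> z"
    if "z \<in> carrier R" for z
    using nqn nqn' n q that by (metis m_assoc m_closed star_closed)+
  \<comment> \<open>Symmetrizing \<open>q\<close> in this way gives a self-adjoint \<open>t\<close>
    with \<open>n t n = n\<close> and \<open>t n t = t\<close>, a generalized inverse of
    \<open>n\<close>.\<close>
  define t where "t = q \<otimes> (n \<otimes> star q)"
  have t: "t \<in> carrier R" "star t = t" using n q by (auto simp: t_def star_mult m_assoc)
  have ntn: "n \<otimes> (t \<otimes> n) = n" using n q by (simp add: t_def m_assoc nqn nqn' nqnz)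
  have tnt: "t \<otimes> (n \<otimes> t) = t" using n q by (simp add: t_def m_assoc nqn nqn' nqnz)
  have ntnz: "n \<otimes> (t \<otimes> (n \<otimes> z)) = n \<otimes> z" "t \<otimes> (n \<otimes> (t \<otimes> z)) = t \<otimes> z"
    if "z \<in> carrier R" for z
    using ntn tnt n t that by (metis m_assoc m_closed)+
  note nt = n t ntn tnt ntnz nnz m_assoc
  \<comment> \<open>\<open>g\<close> and \<open>g' = star g\<close> are the candidates for the two
    diagonal matrix units. The product \<open>g' g = t n n t\<close> vanishes, but
    \<open>g g'\<close> need not.\<close>
  define g where "g = n \<otimes> t"
  define g' where "g' = t \<otimes> n"
  have gc: "g \<in> carrier R" "g' \<in> carrier R" using nt by (auto simp: g_def g'_def)
  have sg: "star g = g'" "star g' = g" using nt by (auto simp: g_def g'_def star_mult)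
  have gg: "g \<otimes> g = g" "g' \<otimes> g' = g'" "g' \<otimes> g = \<zero>"
    using nt by (auto simp: g_def g'_def)
  have ggz: "g \<otimes> (g \<otimes> z) = g \<otimes> z" "g' \<otimes> (g' \<otimes> z) = g' \<otimes> z" "g' \<otimes> (g \<otimes> z) = \<zero>"
    if "z \<in> carrier R" for z
    using gg gc that by (metis m_assoc l_null)+
  \<comment> \<open>Half of the defect \<open>g g'\<close>: subtracting it from both idempotents
    makes them orthogonal on both sides and keeps them exchanged by the involution.\<close>
  define c where "c = half \<otimes> (g \<otimes> g')"
  have c: "c \<in> carrier R" using gc by (simp add: c_def)
  have hz: "z \<otimes> (half \<otimes> w) = half \<otimes> (z \<otimes> w)" if "z \<in> carrier R" "w \<in> carrier R" for z w
    using that half_comm by (metis half_closed m_assoc)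
  have "star c = (g \<otimes> g') \<otimes> half" using gc by (simp add: c_def star_mult sg)
  then have sc: "star c = c" using gc half_comm[of "g \<otimes> g'"] by (simp add: c_def)
  have cc: "g \<otimes> c = c" "c \<otimes> g' = c" "c \<otimes> g = \<zero>" "g' \<otimes> c = \<zero>" "c \<otimes> c = \<zero>"
    using gc by (simp_all add: c_def m_assoc hz gg ggz)
  have c2: "c \<oplus> c = g \<otimes> g'" unfolding c_def using half_cancel(2) gc by simp
  define f where "f = g \<oplus> \<ominus> c"
  define f' where "f' = g' \<oplus> \<ominus> c"
  have fc: "f \<in> carrier R" "f' \<in> carrier R" using gc c by (auto simp: f_def f'_def)
  have sf: "star f = f'" "star f' = f" using gc c sc sg
    by (auto simp: f_def f'_def star_add star_uminus)
  have ff1: "f \<otimes> f = f" unfolding f_def using gc c cc gg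
    by (simp add: l_distr r_distr l_minus r_minus)
  have ff2: "f' \<otimes> f = \<zero>" unfolding f_def f'_def using gc c cc gg
    by (simp add: l_distr r_distr l_minus r_minus)
  have "f \<otimes> f' = c \<oplus> c \<oplus> \<ominus> c \<oplus> \<ominus> c" unfolding f_def f'_def c2 using gc c cc gg
    by (simp add: l_distr r_distr l_minus r_minus a_assoc)
  then have ff3: "f \<otimes> f' = \<zero>" using c by (simp add: a_assoc r_neg)
  have ff4: "f' \<otimes> f' = f'" using arg_cong[OF ff1, of star] fc by (simp add: star_mult sf)
  have n0: "n \<noteq> \<zero>"
  proof
    assume "n = \<zero>"
    then have "(n \<otimes> r) [^] Suc 0 = \<zero>" using r by simp
    then show False using nn unfolding nilp_def by blast
  qed
  have "c \<otimes> n = \<zero>" using nt gc by (simp add: c_def g_def g'_def)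
  then have fn: "f \<otimes> n = n" using gc c nt unfolding f_def
    by (simp add: l_distr l_minus) (simp add: g_def m_assoc nt)
  have nf: "n \<otimes> f' = n" using arg_cong[OF fn, of star] fc n by (simp add: star_mult sf)
  have f0: "f \<noteq> \<zero>" using fn n0 n by auto
  have "f \<oplus> f' = \<zero> \<or> f \<oplus> f' = \<one>"
    using triv[of "f \<oplus> f'"] fc ff1 ff2 ff3 ff4 sf
    by (simp add: l_distr r_distr star_add a_comm)
  moreover have "f \<oplus> f' \<noteq> \<zero>"
  proof
    assume "f \<oplus> f' = \<zero>"
    then have "f \<otimes> (f \<oplus> f') = \<zero>" using fc by simp
    then show False using fc ff1 ff3 f0 by (simp add: r_distr)
  qed
  ultimately have f1: "f \<oplus> f' = \<one>" by blast
  \<comment> \<open>The matrix unit opposite to \<open>n\<close>: \<open>n m = f\<close>,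
    \<open>m n = f'\<close> and \<open>m m = 0\<close>, so that \<open>z = n + m\<close> is a square
    root of 1.\<close>
  define m where "m = f' \<otimes> (t \<otimes> f)"
  have m: "m \<in> carrier R" "star m = m" using fc t by (auto simp: m_def star_mult sf m_assoc)
  have gf: "g \<otimes> f = f" using gc c cc gg by (simp add: f_def r_distr r_minus)
  have "n \<otimes> m = (n \<otimes> f') \<otimes> (t \<otimes> f)" using fc n t by (simp add: m_def m_assoc)
  also have "\<dots> = g \<otimes> f" unfolding nf g_def using n t fc by (simp add: m_assoc)
  finally have nm: "n \<otimes> m = f" using gf by simp
  have mn: "m \<otimes> n = f'" using arg_cong[OF nm, of star] m n sf by (simp add: star_mult)
  have "m \<otimes> m = f' \<otimes> (t \<otimes> ((f \<otimes> f') \<otimes> (t \<otimes> f)))" using fc t by (simp add: m_def m_assoc)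
  then have mm: "m \<otimes> m = \<zero>" using ff3 fc t by simp
  define z where "z = n \<oplus> m"
  have z: "z \<in> carrier R" "star z = z" using n m by (auto simp: z_def star_add)
  have zz: "z \<otimes> z = \<one>" using n m nm mn mm f1 fc by (simp add: z_def l_distr r_distr a_comm)
  have "f \<otimes> (n \<otimes> f) = (f \<otimes> n) \<otimes> (f' \<otimes> f)" using fn nf fc n by (metis m_assoc m_closed)
  then have fnf: "f \<otimes> (n \<otimes> f) = \<zero>" using ff2 n fc by simp
  have "f \<otimes> (m \<otimes> f) = (f \<otimes> f') \<otimes> (t \<otimes> f \<otimes> f)" using fc t by (simp add: m_def m_assoc)
  then have fmf: "f \<otimes> (m \<otimes> f) = \<zero>" using ff3 t fc by simp
  \<comment> \<open>With zero diagonal entry at \<open>f\<close>, the element \<open>z\<close> is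
    neither 1 nor -1; this is what excludes both trivial values of \<open>E\<close>.\<close>
  have fzf: "f \<otimes> (z \<otimes> f) = \<zero>" unfolding z_def using fnf fmf fc n m by (simp add: l_distr r_distr)
  define E where "E = half \<otimes> (\<one> \<oplus> z)"
  have E: "E \<in> carrier R" using z by (simp add: E_def)
  have E2: "E \<oplus> E = \<one> \<oplus> z" unfolding E_def using half_cancel(2) z by simp
  have sq: "(\<one> \<oplus> z) \<otimes> (\<one> \<oplus> z) = (\<one> \<oplus> z) \<oplus> (\<one> \<oplus> z)"
    using z zz by (simp add: l_distr r_distr a_comm)
  have "half \<otimes> ((\<one> \<oplus> z) \<otimes> (\<one> \<oplus> z)) = \<one> \<oplus> z"
    unfolding sq by (rule half_cancel(1)) (use z in simp)
  moreover have "(half \<otimes> u) \<otimes> (half \<otimes> u) = half \<otimes> (half \<otimes> (u \<otimes> u))" if "u \<in> carrier R" for u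
    by (metis that hz m_assoc half_closed m_closed)
  ultimately have EE: "E \<otimes> E = E" unfolding E_def using z by simp
  have "star E = (\<one> \<oplus> z) \<otimes> half" unfolding E_def using z by (simp add: star_mult star_add)
  then have "star E = E" unfolding E_def using z half_comm[of "\<one> \<oplus> z"] by simp
  then have "E = \<zero> \<or> E = \<one>" using triv E EE by blast
  then show False
  proof
    assume "E = \<zero>"
    then have "\<one> \<oplus> z = \<zero>" using E2 by simp
    then have "f \<otimes> ((\<one> \<oplus> z) \<otimes> f) = \<zero>" using fc by simp
    then show False using fc z ff1 fzf f0 by (simp add: l_distr r_distr)
  next
    assume "E = \<one>"
    then have "\<one> \<oplus> \<one> = \<one> \<oplus> z" using E2 by simp
    then have "z = \<one>" using z by simp
    then show False using fzf fc ff1 f0 by simp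
  qed
qed

end

lemma ring_hom_pow:
  assumes "h \<in> Ring.ring_hom R S" "ring R" "ring S" "x \<in> carrier R"
  shows "h (x [^]\<^bsub>R\<^esub> (k::nat)) = h x [^]\<^bsub>S\<^esub> k"
proof -
  interpret R: ring R by fact
  interpret S: ring S by fact
  show ?thesis using assms ring_hom_one ring_hom_mult by (induction k) (fastforce simp: Ring.ring_hom_def)+
qed

section \<open>The quotient by the nil radical\<close>

context star_ring
begin

definition "qstar = (\<lambda>C. star ` C)"

lemma
  defines "Q \<equiv> R Quot nilrad R"
  shows quot_star_ring: "star_ring Q qstar (nilrad R +> half)"
    and quot_star: "x \<in> carrier R \<Longrightarrow> qstar (nilrad R +> x) = nilrad R +> star x"
    and quot_zero_iff: "x \<in> carrier R \<Longrightarrow> nilrad R +> x = \<zero>\<^bsub>Q\<^esub> \<longleftrightarrow> x \<in> nilrad R"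
    and quot_hom: "(+>) (nilrad R) \<in> Ring.ring_hom R Q"
    and quot_carrier: "carrier Q = (+>) (nilrad R) ` carrier R"
proof -
  interpret I: ideal "nilrad R" R by (rule nilrad_ideal[OF fin])
  show hom: "(+>) (nilrad R) \<in> Ring.ring_hom R Q" unfolding Q_def by (rule I.rcos_ring_hom)
  interpret Q: ring Q unfolding Q_def by (rule I.quotient_is_ring)
  show car: "carrier Q = (+>) (nilrad R) ` carrier R"
    unfolding Q_def FactRing_def A_RCOSETS_def' by auto
  show st: "qstar (nilrad R +> x) = nilrad R +> star x" if x: "x \<in> carrier R" for x
  proof -
    have "h \<oplus> star x \<in> star ` (\<lambda>h. h \<oplus> x) ` nilrad R" if "h \<in> nilrad R" for h
    proof -
      have "h \<oplus> star x = star (star h \<oplus> x)" using that x nilrad_carrier by (simp add: star_add)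
      then show ?thesis using nilrad_star that by blast
    qed
    moreover have "star (h \<oplus> x) \<in> (\<lambda>h. h \<oplus> star x) ` nilrad R" if "h \<in> nilrad R" for h
      using that x nilrad_carrier nilrad_star by (auto simp add: star_add)
    ultimately show ?thesis unfolding qstar_def a_r_coset_def' UNION_singleton_eq_range by auto
  qed
  show "nilrad R +> x = \<zero>\<^bsub>Q\<^esub> \<longleftrightarrow> x \<in> nilrad R" if "x \<in> carrier R" for x
    unfolding Q_def FactRing_def using that I.a_rcos_const I.a_rcos_self by auto
  show "star_ring Q qstar (nilrad R +> half)"
  proof (unfold_locales)
    show "finite (carrier Q)" using fin car by simp
    show "nilrad R +> half \<in> carrier Q" using car by simp
    show "(nilrad R +> half) \<oplus>\<^bsub>Q\<^esub> (nilrad R +> half) = \<one>\<^bsub>Q\<^esub>"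
      using ring_hom_add[OF hom half_closed half_closed] half_half ring_hom_one[OF hom] by simp
    fix x assume "x \<in> carrier Q"
    then obtain a where a: "a \<in> carrier R" "x = nilrad R +> a" using car by auto
    show "qstar x \<in> carrier Q" "qstar (qstar x) = x" using a st car by auto
    fix y assume "y \<in> carrier Q"
    then obtain b where b: "b \<in> carrier R" "y = nilrad R +> b" using car by auto
    show "qstar (x \<oplus>\<^bsub>Q\<^esub> y) = qstar x \<oplus>\<^bsub>Q\<^esub> qstar y"
      using a b st hom by (simp add: ring_hom_add[symmetric] star_add)
    show "qstar (x \<otimes>\<^bsub>Q\<^esub> y) = qstar y \<otimes>\<^bsub>Q\<^esub> qstar x"
      using a b st hom by (simp add: ring_hom_mult[symmetric] star_mult)
  qed
qed

end

context jordan_local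
begin

text \<open>A self-adjoint idempotent \<open>g\<close> of the quotient has a self-adjoint preimage,
  obtained by averaging a preimage with its adjoint. All positive powers of it are again preimages
  of \<open>g\<close>, and one of them is 0 or 1.\<close>

lemma quot_jordan_local: "jordan_local (R Quot nilrad R) qstar (nilrad R +> half)"
proof -
  let ?Q = "R Quot nilrad R" and ?pi = "(+>) (nilrad R)"
  interpret Q: star_ring ?Q qstar "?pi half" by (rule quot_star_ring)
  show ?thesis
  proof (unfold_locales)
    fix g assume g: "g \<in> carrier ?Q" "g \<otimes>\<^bsub>?Q\<^esub> g = g" "qstar g = g"
    then obtain x where x: "x \<in> carrier R" "g = ?pi x" using quot_carrier by auto
    define y where "y = half \<otimes> (x \<oplus> star x)"
    have "star y = (x \<oplus> star x) \<otimes> half" using x by (simp add: y_def star_mult star_add a_comm)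
    then have y: "y \<in> carrier R" "star y = y" using x half_comm[of "x \<oplus> star x"] by (auto simp: y_def)
    have "?pi y = ?pi half \<otimes>\<^bsub>?Q\<^esub> (g \<oplus>\<^bsub>?Q\<^esub> g)"
      using x g(3) quot_star ring_hom_mult[OF quot_hom half_closed] ring_hom_add[OF quot_hom] by (simp add: y_def)
    also have "\<dots> = g" using Q.half_cancel(1) g(1) by simp
    finally have yg: "?pi y = g" .
    have pw: "?pi (y [^] Suc k) = g" for k
      using ring_hom_pow[OF quot_hom ring_axioms Q.ring_axioms y(1), of "Suc k"] Q.idem_pow[OF g(1,2)] yg
      by (simp del: nat_pow_Suc)
    have z: "?pi \<zero> = \<zero>\<^bsub>?Q\<^esub>" using quot_zero_iff nilrad_zero by simp
    show "g = \<zero>\<^bsub>?Q\<^esub> \<or> g = \<one>\<^bsub>?Q\<^esub>"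
      using sa_cases[OF y] pw z ring_hom_one[OF quot_hom] unfolding nilp_def by metis
  qed
qed

text \<open>Let \<open>m\<close> be the last power of \<open>n\<close> outside the radical. Its
  square lies inside, so in the quotient \<open>square_zero\<close> applies to \<open>m\<close> and
  makes every \<open>m r\<close> nilpotent modulo the radical, hence nilpotent; thus
  \<open>m\<close> would belong to the radical.\<close>

lemma nil_in_nilrad:
  assumes n: "n \<in> carrier R" "star n = n" and nil: "nilp R n"
  shows "n \<in> nilrad R"
proof (rule ccontr)
  assume nin: "n \<notin> nilrad R"
  let ?Q = "R Quot nilrad R" and ?pi = "(+>) (nilrad R)"
  interpret Q: jordan_local ?Q qstar "?pi half" by (rule quot_jordan_local)
  define P where "P j \<longleftrightarrow> n [^] Suc j \<in> nilrad R" for j :: nat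
  have "\<exists>j. P j" using nil nilrad_zero unfolding nilp_def P_def by metis
  then have L: "P (LEAST j. P j)" by (rule LeastI_ex)
  define j where "j = (LEAST j. P j)"
  have "j \<noteq> 0" using L nin n unfolding j_def P_def by (metis nat_pow_0 nat_pow_Suc l_one)
  then obtain i where i: "j = Suc i" using not0_implies_Suc by blast
  have "\<not> P i" using not_less_Least[of i P] i unfolding j_def by simp
  define m where "m = n [^] Suc i"
  have m: "m \<in> carrier R" "m \<notin> nilrad R"
    using n \<open>\<not> P i\<close> by (auto simp: m_def P_def simp del: nat_pow_Suc)
  have ms: "star m = m" unfolding m_def star_pow[OF n(1)] n(2) ..
  have "n [^] Suc (Suc i) \<in> nilrad R" using L i unfolding j_def P_def by simp
  then have "n [^] Suc (Suc i) \<otimes> n [^] i \<in> nilrad R" using nilrad_r n by simp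
  moreover have "Suc (Suc i) + i = Suc i + Suc i" by simp
  ultimately have mm: "m \<otimes> m \<in> nilrad R" unfolding m_def nat_pow_mult[OF n(1)] by metis
  have "nilp ?Q (?pi m \<otimes>\<^bsub>?Q\<^esub> ?pi r)" if r: "r \<in> carrier R" for r
  proof (rule Q.square_zero)
    show "?pi m \<in> carrier ?Q" "?pi r \<in> carrier ?Q" using m r quot_carrier by auto
    show "qstar (?pi m) = ?pi m" using m ms quot_star by simp
    show "?pi m \<otimes>\<^bsub>?Q\<^esub> ?pi m = \<zero>\<^bsub>?Q\<^esub>"
      using m mm quot_zero_iff ring_hom_mult[OF quot_hom] by (metis m_closed)
  qed
  then have "nilp R (m \<otimes> r)" if r: "r \<in> carrier R" for r
  proof -
    obtain k where "(?pi m \<otimes>\<^bsub>?Q\<^esub> ?pi r) [^]\<^bsub>?Q\<^esub> Suc k = \<zero>\<^bsub>?Q\<^esub>"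
      using \<open>\<And>r. r \<in> carrier R \<Longrightarrow> nilp ?Q (?pi m \<otimes>\<^bsub>?Q\<^esub> ?pi r)\<close> r unfolding nilp_def by blast
    then have "?pi ((m \<otimes> r) [^] Suc k) = \<zero>\<^bsub>?Q\<^esub>"
      using ring_hom_pow[OF quot_hom ring_axioms Q.ring_axioms, of "m \<otimes> r" "Suc k"]
        ring_hom_mult[OF quot_hom m(1) r] m r by (simp del: nat_pow_Suc)
    then have "(m \<otimes> r) [^] Suc k \<in> nilrad R" using quot_zero_iff m r by (simp del: nat_pow_Suc)
    then show ?thesis using nilrad_nilp nilp_pow m r m_closed by blast
  qed
  then show False using m unfolding nilrad_def by auto
qed

end

section \<open>Corner rings and equivalence of primitive idempotents\<close>

definition corner :: "('a, 'b) ring_scheme \<Rightarrow> 'a \<Rightarrow> ('a, 'b) ring_scheme" where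
  "corner R e = R\<lparr>carrier := {x \<in> carrier R. e \<otimes>\<^bsub>R\<^esub> x = x \<and> x \<otimes>\<^bsub>R\<^esub> e = x}, one := e\<rparr>"

text \<open>The condition \<open>e g = g\<close> puts \<open>g\<close> into the corner of
  \<open>e\<close>: applying the involution turns it into \<open>g e = g\<close>.\<close>

definition sa_primitive :: "('a, 'b) ring_scheme \<Rightarrow> ('a \<Rightarrow> 'a) \<Rightarrow> 'a \<Rightarrow> bool" where
  "sa_primitive R star e \<longleftrightarrow> e \<in> carrier R \<and> e \<otimes>\<^bsub>R\<^esub> e = e \<and> star e = e \<and> e \<noteq> \<zero>\<^bsub>R\<^esub> \<and>
     (\<forall>g \<in> carrier R. g \<otimes>\<^bsub>R\<^esub> g = g \<longrightarrow> star g = g \<longrightarrow> e \<otimes>\<^bsub>R\<^esub> g = g \<longrightarrow> g = \<zero>\<^bsub>R\<^esub> \<or> g = e)"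

text \<open>Isomorphism of the right ideals \<open>e R\<close> and \<open>f R\<close>; the
  involution is deliberately left out.\<close>

definition idem_equiv :: "('a, 'b) ring_scheme \<Rightarrow> 'a \<Rightarrow> 'a \<Rightarrow> bool" where
  "idem_equiv R e f \<longleftrightarrow> (\<exists>x \<in> carrier R. \<exists>y \<in> carrier R.
     e \<otimes>\<^bsub>R\<^esub> x = x \<and> x \<otimes>\<^bsub>R\<^esub> f = x \<and> f \<otimes>\<^bsub>R\<^esub> y = y \<and> y \<otimes>\<^bsub>R\<^esub> e = y \<and> x \<otimes>\<^bsub>R\<^esub> y = e \<and> y \<otimes>\<^bsub>R\<^esub> x = f)"

lemma idem_equiv_sym: "idem_equiv R e f \<Longrightarrow> idem_equiv R f e"
  unfolding idem_equiv_def by blast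

lemma (in ring) idem_equiv_refl: "e \<in> carrier R \<Longrightarrow> e \<otimes> e = e \<Longrightarrow> idem_equiv R e e"
  unfolding idem_equiv_def by blast

lemma (in ring) idem_equiv_trans:
  assumes "idem_equiv R e f" "idem_equiv R f g" "e \<in> carrier R" "f \<in> carrier R" "g \<in> carrier R"
  shows "idem_equiv R e g"
proof -
  obtain x y where 1: "x \<in> carrier R" "y \<in> carrier R" "e \<otimes> x = x" "x \<otimes> f = x" "f \<otimes> y = y"
    "y \<otimes> e = y" "x \<otimes> y = e" "y \<otimes> x = f" using assms(1) unfolding idem_equiv_def by blast
  obtain x' y' where 2: "x' \<in> carrier R" "y' \<in> carrier R" "f \<otimes> x' = x'" "x' \<otimes> g = x'"
    "g \<otimes> y' = y'" "y' \<otimes> f = y'" "x' \<otimes> y' = f" "y' \<otimes> x' = g"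
    using assms(2) unfolding idem_equiv_def by blast
  have "(x \<otimes> x') \<otimes> (y' \<otimes> y) = x \<otimes> ((x' \<otimes> y') \<otimes> y)" using 1(1,2) 2(1,2) by (simp add: m_assoc)
  then have a: "(x \<otimes> x') \<otimes> (y' \<otimes> y) = e" using 1 2 by simp
  have "(y' \<otimes> y) \<otimes> (x \<otimes> x') = y' \<otimes> ((y \<otimes> x) \<otimes> x')" using 1(1,2) 2(1,2) by (simp add: m_assoc)
  then have b: "(y' \<otimes> y) \<otimes> (x \<otimes> x') = g" using 1 2 by simp
  have "e \<otimes> (x \<otimes> x') = x \<otimes> x'" "(x \<otimes> x') \<otimes> g = x \<otimes> x'" "g \<otimes> (y' \<otimes> y) = y' \<otimes> y"
    "(y' \<otimes> y) \<otimes> e = y' \<otimes> y"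
    using 1 2 assms(3-5) by (metis m_assoc)+
  moreover have "x \<otimes> x' \<in> carrier R" "y' \<otimes> y \<in> carrier R" using 1 2 by auto
  ultimately show ?thesis unfolding idem_equiv_def using a b by blast
qed

context star_ring
begin

text \<open>The corner has \<open>e\<close> as its identity, so powers agree with those of the ring
  only from exponent 1 on. The \<open>Suc k\<close> in \<open>nilp\<close> provides for
  this.\<close>

lemma corner_pow:
  assumes "x \<in> carrier (corner R e)"
  shows "x [^]\<^bsub>corner R e\<^esub> Suc k = x [^] Suc k"
proof (induction k)
  case 0
  show ?case using assms unfolding nat_pow_def by (simp add: corner_def)
next
  case (Suc k)
  then show ?case using assms unfolding nat_pow_def by (simp add: corner_def)
qed

lemma corner_nilp: "x \<in> carrier (corner R e) \<Longrightarrow> nilp (corner R e) x \<longleftrightarrow> nilp R x"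
  unfolding nilp_def by (simp only: corner_pow) (simp add: corner_def)

lemma corner_simps:
  "carrier (corner R e) = {x \<in> carrier R. e \<otimes> x = x \<and> x \<otimes> e = x}"
  "(\<otimes>\<^bsub>corner R e\<^esub>) = (\<otimes>)" "(\<oplus>\<^bsub>corner R e\<^esub>) = (\<oplus>)" "\<zero>\<^bsub>corner R e\<^esub> = \<zero>"
  "\<one>\<^bsub>corner R e\<^esub> = e"
  by (simp_all add: corner_def)

lemma corner_star_ring:
  assumes e: "e \<in> carrier R" "e \<otimes> e = e" "star e = e"
  shows "star_ring (corner R e) star (half \<otimes> e)"
proof -
  have "ring (corner R e)"
  proof (rule ringI)
    show "abelian_group (corner R e)"
    proof (rule abelian_groupI; (unfold corner_simps)?)
      fix x assume x: "x \<in> {x \<in> carrier R. e \<otimes> x = x \<and> x \<otimes> e = x}"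
      then show "\<exists>y \<in> {x \<in> carrier R. e \<otimes> x = x \<and> x \<otimes> e = x}. y \<oplus> x = \<zero>"
        using e by (intro bexI[of _ "\<ominus> x"]) (auto simp: l_neg l_minus r_minus)
    qed (use e in \<open>auto simp: r_distr l_distr a_ac\<close>)
    show "monoid (corner R e)"
    proof (rule monoidI; unfold corner_simps)
      fix x y assume "x \<in> {x \<in> carrier R. e \<otimes> x = x \<and> x \<otimes> e = x}"
        "y \<in> {x \<in> carrier R. e \<otimes> x = x \<and> x \<otimes> e = x}"
      then show "x \<otimes> y \<in> {x \<in> carrier R. e \<otimes> x = x \<and> x \<otimes> e = x}"
        using e by (metis (mono_tags, lifting) m_assoc m_closed mem_Collect_eq)
    qed (use e in \<open>auto simp: m_assoc\<close>)
  qed (unfold corner_simps, auto simp: r_distr l_distr)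
  then interpret C: ring "corner R e" .
  show ?thesis
  proof (unfold_locales; (unfold corner_simps)?)
    show "half \<otimes> e \<in> {x \<in> carrier R. e \<otimes> x = x \<and> x \<otimes> e = x}"
      using e half_comm[OF e(1)] by (auto simp: m_assoc) (metis e(1) half_closed m_assoc)
    show "half \<otimes> e \<oplus> half \<otimes> e = e" using half_cancel(2) e by simp
    fix x assume "x \<in> {x \<in> carrier R. e \<otimes> x = x \<and> x \<otimes> e = x}"
    then show "star x \<in> {x \<in> carrier R. e \<otimes> x = x \<and> x \<otimes> e = x}"
      using e star_mult by (metis (mono_tags, lifting) mem_Collect_eq star_closed)
  qed (use fin star_add star_mult in auto)
qed

lemma corner_local:
  assumes "sa_primitive R star e"
  shows "jordan_local (corner R e) star (half \<otimes> e)"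
proof -
  interpret C: star_ring "corner R e" star "half \<otimes> e"
    by (rule corner_star_ring) (use assms in \<open>auto simp: sa_primitive_def\<close>)
  show ?thesis
    by unfold_locales (use assms in \<open>auto simp: sa_primitive_def corner_simps\<close>)
qed

lemma sa_primitiveD:
  assumes "sa_primitive R star e"
  shows "e \<in> carrier R" "e \<otimes> e = e" "star e = e" "e \<noteq> \<zero>"
  using assms by (auto simp: sa_primitive_def)

text \<open>The element \<open>z star z\<close> is self-adjoint in the local corner of
  \<open>e\<close>; not being nilpotent, it has a power equal to \<open>e\<close> and thus an
  inverse \<open>b\<close> there. With \<open>y = star z b\<close> one gets \<open>z y = e\<close>,
  and \<open>y z\<close> is a nonzero self-adjoint idempotent below the primitive \<open>f\<close>,
  hence \<open>f\<close>.\<close>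

lemma equiv_if_not_nilp:
  assumes pe: "sa_primitive R star e" and pf: "sa_primitive R star f"
    and z: "z \<in> carrier R" "e \<otimes> z = z" "z \<otimes> f = z" and nn: "\<not> nilp R (z \<otimes> star z)"
  shows "idem_equiv R e f"
proof -
  note e = sa_primitiveD[OF pe] and f = sa_primitiveD[OF pf]
  interpret C: jordan_local "corner R e" star "half \<otimes> e" by (rule corner_local[OF pe])
  define a where "a = z \<otimes> star z"
  have sz: "star z \<otimes> e = star z" "f \<otimes> star z = star z"
    using star_mult[of e z] star_mult[of z f] z e f by auto
  have a: "a \<in> carrier (corner R e)" "star a = a"
    using z e sz by (auto simp: a_def corner_simps star_mult m_assoc[symmetric]) (simp add: m_assoc)
  then have ac: "a \<in> carrier R" "e \<otimes> a = a" "a \<otimes> e = a" by (auto simp: corner_simps)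
  have "\<not> nilp (corner R e) a" using nn corner_nilp[OF a(1)] a_def by simp
  then obtain k where k: "a [^]\<^bsub>corner R e\<^esub> Suc k = e"
    using C.sa_cases[OF a] unfolding corner_simps by blast
  define b where "b = a [^]\<^bsub>corner R e\<^esub> k"
  have b: "b \<in> carrier (corner R e)" "star b = b" unfolding b_def using a C.star_pow by auto
  then have bc: "b \<in> carrier R" "e \<otimes> b = b" "b \<otimes> e = b" by (auto simp: corner_simps)
  have ab: "b \<otimes> a = e" "a \<otimes> b = e"
    using k C.nat_pow_Suc2[OF a(1)] by (auto simp: b_def corner_simps)
  define y where "y = star z \<otimes> b"
  have y: "y \<in> carrier R" using z bc by (simp add: y_def)
  have zy: "z \<otimes> y = e" using ab z bc by (simp add: y_def a_def m_assoc)
  have fy: "f \<otimes> y = y" "y \<otimes> e = y"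
    using sz z bc f e by (simp_all add: y_def m_assoc[symmetric]) (simp add: m_assoc)
  define g where "g = y \<otimes> z"
  have g: "g \<in> carrier R" using y z by (simp add: g_def)
  have "g \<otimes> g = y \<otimes> ((z \<otimes> y) \<otimes> z)" using y z by (simp add: g_def m_assoc)
  then have gg: "g \<otimes> g = g" using zy z by (simp add: g_def)
  have sg: "star g = g" using z bc b(2) by (simp add: g_def y_def star_mult m_assoc)
  have fg: "f \<otimes> g = g" using fy y z f by (simp add: g_def m_assoc[symmetric])
  have "g \<noteq> \<zero>"
  proof
    assume "g = \<zero>"
    then have "z \<otimes> g \<otimes> y = \<zero>" using z y by simp
    moreover have "z \<otimes> g \<otimes> y = (z \<otimes> y) \<otimes> (z \<otimes> y)" using z y by (simp add: g_def m_assoc)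
    ultimately show False using zy e by simp
  qed
  then have "g = f" using pf g gg sg fg unfolding sa_primitive_def by blast
  then show ?thesis unfolding idem_equiv_def using z y fy zy g_def by blast
qed

text \<open>Suppose \<open>x a\<close> is not nilpotent. A power of its compression \<open>c\<close>
  to the corner of \<open>e\<close> is an idempotent \<open>g = x y\<close> with \<open>y\<close> in
  \<open>f R e\<close>. Inequivalence puts \<open>z star z\<close> into the radical of the corner
  for every \<open>z\<close> in \<open>e R f\<close>; by polarization \<open>g + star g\<close> is
  radical. So is \<open>g star g\<close>, whence \<open>g = g (g + star g) - g star g\<close> is
  radical, which no nonzero idempotent is.\<close>

lemma not_equiv_nilrad:
  assumes pe: "sa_primitive R star e" and pf: "sa_primitive R star f"
    and ne: "\<not> idem_equiv R e f"
    and x: "x \<in> carrier R" "e \<otimes> x = x" "x \<otimes> f = x"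
  shows "x \<in> nilrad R"
proof (rule ccontr)
  assume "x \<notin> nilrad R"
  then obtain a where a: "a \<in> carrier R" "\<not> nilp R (x \<otimes> a)" using x unfolding nilrad_def by blast
  note e = sa_primitiveD[OF pe] and f = sa_primitiveD[OF pf]
  interpret C: jordan_local "corner R e" star "half \<otimes> e" by (rule corner_local[OF pe])
  define c where "c = x \<otimes> f \<otimes> a \<otimes> e"
  have c: "c \<in> carrier R" "e \<otimes> c = c" "c \<otimes> e = c"
    using x e f a by (simp_all add: c_def m_assoc[symmetric]) (simp add: m_assoc)
  have "\<not> nilp R c"
  proof
    assume "nilp R c"
    then have "nilp R (e \<otimes> (x \<otimes> f \<otimes> a))"
      using nilp_swap[of "x \<otimes> f \<otimes> a" e] x e f a by (simp add: c_def)
    then show False using a x e f by (simp add: m_assoc[symmetric])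
  qed
  obtain k where k: "c [^] Suc k \<otimes> c [^] Suc k = c [^] Suc k"
    using pow_idempotent[OF fin c(1)] by blast
  define g where "g = c [^] Suc k"
  have g: "g \<in> carrier R" "g \<otimes> g = g" using c k by (auto simp: g_def)
  have "\<not> nilp R g" unfolding g_def using nilp_pow[OF c(1)] \<open>\<not> nilp R c\<close> by blast
  then have g0: "g \<noteq> \<zero>" unfolding nilp_def by auto
  have ge: "g \<otimes> e = g" "e \<otimes> g = g"
    unfolding g_def using c e by (simp add: m_assoc)
      (simp only: nat_pow_Suc2[OF c(1)] m_assoc[symmetric] c(2) e nat_pow_closed c(1))
  \<comment> \<open>The power \<open>c^(k+1)\<close> with its leading \<open>x\<close> removed,
    framed by \<open>f\<close> and \<open>e\<close>.\<close>
  define y where "y = f \<otimes> a \<otimes> e \<otimes> c [^] k \<otimes> e"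
  have y: "y \<in> carrier R" "f \<otimes> y = y" "y \<otimes> e = y"
    using x e f a c by (simp_all add: y_def m_assoc[symmetric]) (simp add: m_assoc)
  have xy: "x \<otimes> y = g"
  proof -
    have "x \<otimes> y = x \<otimes> f \<otimes> a \<otimes> e \<otimes> c [^] k \<otimes> e"
      using x(1) e(1) f(1) a(1) c(1) by (simp add: y_def m_assoc)
    also have "\<dots> = (c \<otimes> c [^] k) \<otimes> e" by (simp add: c_def)
    also have "\<dots> = g \<otimes> e" unfolding g_def nat_pow_Suc2[OF c(1)] by simp
    finally show ?thesis using ge by simp
  qed
  have sx: "star x \<in> carrier R" "star x \<otimes> e = star x" "f \<otimes> star x = star x"
    using star_mult[of e x] star_mult[of x f] x e f by auto
  have sy: "star y \<in> carrier R" "star y \<otimes> f = star y" "e \<otimes> star y = star y"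
    using star_mult[of f y] star_mult[of y e] y e f by auto
  have zz: "z \<otimes> star z \<in> nilrad (corner R e)" if z: "z \<in> carrier R" "e \<otimes> z = z" "z \<otimes> f = z" for z
  proof -
    have "nilp R (z \<otimes> star z)" using equiv_if_not_nilp[OF pe pf z] ne by blast
    moreover have "star z \<otimes> e = star z" using star_mult[of e z] z e by simp
    then have "z \<otimes> star z \<in> carrier (corner R e)"
      using z e by (auto simp: corner_simps m_assoc[symmetric]) (simp add: m_assoc)
    ultimately show ?thesis using C.nil_in_nilrad corner_nilp z by (simp add: star_mult)
  qed
  have nadd: "u \<oplus> v \<in> nilrad (corner R e)"
    if "u \<in> nilrad (corner R e)" "v \<in> nilrad (corner R e)" for u v
    using C.nilrad_add[OF C.fin that] by (simp add: corner_simps)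
  have nmul: "u \<otimes> v \<in> nilrad (corner R e)"
    if "u \<in> nilrad (corner R e)" "v \<in> carrier (corner R e)" for u v
    using C.nilrad_r[OF that] by (simp add: corner_simps)
  have nmul': "v \<otimes> u \<in> nilrad (corner R e)"
    if "u \<in> nilrad (corner R e)" "v \<in> carrier (corner R e)" for u v
    using C.nilrad_l[OF that] by (simp add: corner_simps)
  have ec: "e \<in> carrier (corner R e)" using e by (simp add: corner_simps)
  have nneg: "\<ominus> u \<in> nilrad (corner R e)" if u: "u \<in> nilrad (corner R e)" for u
  proof -
    have "\<ominus> e \<in> carrier (corner R e)" using e by (simp add: corner_simps l_minus r_minus)
    then have "u \<otimes> \<ominus> e \<in> nilrad (corner R e)" using nmul u by blast
    moreover have "u \<in> carrier R" "u \<otimes> e = u" using C.nilrad_carrier[OF u] by (auto simp: corner_simps)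
    ultimately show ?thesis using e by (simp add: r_minus)
  qed
  \<comment> \<open>Polarization: the mixed terms of \<open>z star z\<close> for this
    \<open>z\<close> are \<open>x y = g\<close> and its adjoint.\<close>
  define z where "z = x \<oplus> star y"
  have sg: "star g = star y \<otimes> star x" using xy x y star_mult by metis
  have "z \<otimes> star z = x \<otimes> star x \<oplus> star y \<otimes> y \<oplus> (g \<oplus> star g)"
    using x y sx sy xy sg g by (simp add: z_def star_add l_distr r_distr a_ac)
  moreover have "z \<otimes> star z \<in> nilrad (corner R e)"
    by (rule zz) (use x sy e f in \<open>auto simp: z_def r_distr l_distr\<close>)
  ultimately have 1: "x \<otimes> star x \<oplus> star y \<otimes> y \<oplus> (g \<oplus> star g) \<in> nilrad (corner R e)" by simp
  have 2: "x \<otimes> star x \<oplus> star y \<otimes> y \<in> nilrad (corner R e)"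
    using nadd[OF zz[OF x] zz[of "star y"]] sy y by simp
  have canc: "(u \<oplus> v) \<oplus> \<ominus> u = v" if "u \<in> carrier R" "v \<in> carrier R" for u v
    using that by (metis a_assoc a_comm a_inv_closed r_neg r_zero)
  have "(x \<otimes> star x \<oplus> star y \<otimes> y \<oplus> (g \<oplus> star g)) \<oplus> \<ominus> (x \<otimes> star x \<oplus> star y \<otimes> y) = g \<oplus> star g"
    by (rule canc) (use x y sx sy g in auto)
  then have gs: "g \<oplus> star g \<in> nilrad (corner R e)" using nadd[OF 1 nneg[OF 2]] by simp
  have gcc: "g \<in> carrier (corner R e)" using g ge by (simp add: corner_simps)
  \<comment> \<open>If \<open>g star g\<close> were invertible in the corner, \<open>g\<close> would
    be the identity \<open>e\<close>, and the radical would contain \<open>e + e\<close>, hence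
    \<open>e\<close>.\<close>
  define w where "w = g \<otimes> star g"
  have w: "w \<in> carrier (corner R e)" "star w = w"
    using gcc C.star_closed[OF gcc] C.m_closed by (auto simp: w_def corner_simps star_mult)
  have "nilp (corner R e) w"
  proof (rule ccontr)
    assume "\<not> nilp (corner R e) w"
    then obtain j where "w [^]\<^bsub>corner R e\<^esub> Suc j = e" using C.sa_cases[OF w] by (auto simp: corner_simps)
    moreover define v where "v = w [^]\<^bsub>corner R e\<^esub> j"
    ultimately have v: "w \<otimes> v = e" "v \<in> carrier R"
      using C.nat_pow_Suc2[OF w(1)] C.nat_pow_closed[OF w(1), of j] by (auto simp: corner_simps)
    have "g \<otimes> w = w" using g by (simp add: w_def m_assoc[symmetric])
    moreover have "w \<in> carrier R" using g by (simp add: w_def)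
    ultimately have "g \<otimes> e = e" using v g by (metis m_assoc)
    then have "g = e" using ge by simp
    then have "e \<oplus> e \<in> nilrad (corner R e)" using gs e by simp
    then have "(half \<otimes> e) \<otimes> (e \<oplus> e) \<in> nilrad (corner R e)" using nmul' C.half_closed by blast
    moreover have "(half \<otimes> e) \<otimes> (e \<oplus> e) = e"
      using C.half_cancel(1)[OF ec] by (simp add: corner_simps)
    ultimately have "nilp (corner R e) e" using C.nilrad_nilp by simp
    then have "nilp R e" using corner_nilp ec by blast
    then show False using nilp_idem e by blast
  qed
  then have "w \<in> nilrad (corner R e)" using C.nil_in_nilrad w by blast
  moreover have "g \<otimes> (g \<oplus> star g) \<in> nilrad (corner R e)" using nmul' gs gcc by blast
  ultimately have "g \<otimes> (g \<oplus> star g) \<oplus> \<ominus> w \<in> nilrad (corner R e)" using nneg nadd by blast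
  moreover have "g \<otimes> (g \<oplus> star g) \<oplus> \<ominus> w = g"
    using g by (simp add: w_def r_distr a_assoc r_neg)
  ultimately have "nilp (corner R e) g" using C.nilrad_nilp by simp
  then show False using corner_nilp[OF gcc] \<open>\<not> nilp R g\<close> by blast
qed

end

section \<open>Frames of self-adjoint idempotents\<close>

definition sa_frame :: "('a, 'b) ring_scheme \<Rightarrow> ('a \<Rightarrow> 'a) \<Rightarrow> 'a set \<Rightarrow> bool" where
  "sa_frame R star E \<longleftrightarrow> finite E \<and> (\<forall>e \<in> E. sa_primitive R star e) \<and>
     (\<forall>e \<in> E. \<forall>f \<in> E. e \<noteq> f \<longrightarrow> e \<otimes>\<^bsub>R\<^esub> f = \<zero>\<^bsub>R\<^esub>) \<and> finsum R (\<lambda>e. e) E = \<one>\<^bsub>R\<^esub>"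

context ring
begin

lemma finsum_nilrad:
  assumes fin: "finite (carrier R)" and "finite S" "\<And>x. x \<in> S \<Longrightarrow> h x \<in> nilrad R"
  shows "finsum R h S \<in> nilrad R"
  using assms(2,3)
proof (induction S)
  case (insert x S)
  then have "finsum R h (insert x S) = h x \<oplus> finsum R h S"
    using nilrad_carrier by (intro finsum_insert) auto
  then show ?case using insert nilrad_add[OF fin] by simp
qed (simp add: nilrad_zero)

text \<open>For an idempotent \<open>e\<close> this is the right ideal \<open>e R\<close>, described
  by fixed points of left multiplication.\<close>

definition "rng e = {x \<in> carrier R. e \<otimes> x = x}"

lemma card_rng_equiv:
  assumes "idem_equiv R e f" "e \<in> carrier R" "f \<in> carrier R"
  shows "card (rng e) = card (rng f)"
proof -
  obtain x y where 1: "x \<in> carrier R" "y \<in> carrier R" "e \<otimes> x = x" "x \<otimes> f = x" "f \<otimes> y = y"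
    "y \<otimes> e = y" "x \<otimes> y = e" "y \<otimes> x = f" using assms(1) unfolding idem_equiv_def by blast
  have a: "x \<otimes> (y \<otimes> z) = e \<otimes> z" "y \<otimes> (x \<otimes> z) = f \<otimes> z" "f \<otimes> (y \<otimes> z) = y \<otimes> z" 
    "e \<otimes> (x \<otimes> z) = x \<otimes> z" if "z \<in> carrier R" for z
    using 1 that assms by (metis m_assoc)+
  have "bij_betw (\<lambda>z. y \<otimes> z) (rng e) (rng f)"
    by (rule bij_betwI[of _ _ _ "\<lambda>z. x \<otimes> z"]) (use 1 a in \<open>auto simp: rng_def\<close>)
  then show ?thesis by (rule bij_betw_same_card)
qed

text \<open>The right ideal of a sum of orthogonal idempotents is the direct sum of their right
  ideals, by \<open>x -> (e x, s x)\<close>; sizes therefore multiply.\<close>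

lemma orth_sum:
  assumes "finite S" "S \<subseteq> carrier R" "\<And>e. e \<in> S \<Longrightarrow> e \<otimes> e = e"
    "\<And>e f. e \<in> S \<Longrightarrow> f \<in> S \<Longrightarrow> e \<noteq> f \<Longrightarrow> e \<otimes> f = \<zero>"
  defines "s \<equiv> finsum R (\<lambda>e. e) S"
  shows "s \<in> carrier R" "s \<otimes> s = s" "card (rng s) = (\<Prod>e\<in>S. card (rng e))"
proof -
  have "s \<in> carrier R \<and> s \<otimes> s = s \<and> card (rng s) = (\<Prod>e\<in>S. card (rng e))"
    unfolding s_def using assms(1-4)
  proof (induction S)
    case empty
    have "rng \<zero> = {\<zero>}" unfolding rng_def by auto
    then show ?case by simp
  next
    case (insert e S)
    define s where "s = finsum R (\<lambda>e. e) S"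
    have ec: "e \<in> carrier R" "e \<otimes> e = e" using insert by auto
    have sc: "s \<in> carrier R" "s \<otimes> s = s" "card (rng s) = (\<Prod>e\<in>S. card (rng e))"
      unfolding s_def using insert by auto
    have t: "finsum R (\<lambda>e. e) (insert e S) = e \<oplus> s"
      unfolding s_def using insert by (intro finsum_insert) auto
    have "e \<otimes> s = (\<Oplus>i\<in>S. e \<otimes> i)" unfolding s_def
      using insert by (intro finsum_rdistr) auto
    also have "\<dots> = (\<Oplus>i\<in>S. \<zero>)" using insert by (intro finsum_cong') auto
    finally have es: "e \<otimes> s = \<zero>" by simp
    have "s \<otimes> e = (\<Oplus>i\<in>S. i \<otimes> e)" unfolding s_def
      using insert by (intro finsum_ldistr) auto
    also have "\<dots> = (\<Oplus>i\<in>S. \<zero>)" using insert by (intro finsum_cong') auto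
    finally have se: "s \<otimes> e = \<zero>" by simp
    have z: "e \<otimes> (s \<otimes> x) = \<zero>" "s \<otimes> (e \<otimes> x) = \<zero>" "e \<otimes> (e \<otimes> x) = e \<otimes> x" "s \<otimes> (s \<otimes> x) = s \<otimes> x"
      if "x \<in> carrier R" for x
      using that es se ec sc by (metis m_assoc l_null)+
    have z': "e \<otimes> x = \<zero>" if "x \<in> rng s" for x using that z(1)[of x] by (auto simp: rng_def)
    have z'': "s \<otimes> x = \<zero>" if "x \<in> rng e" for x using that z(2)[of x] by (auto simp: rng_def)
    have "bij_betw (\<lambda>x. (e \<otimes> x, s \<otimes> x)) (rng (e \<oplus> s)) (rng e \<times> rng s)"
    proof (rule bij_betwI[of _ _ _ "\<lambda>(u, v). u \<oplus> v"])
      show "(\<lambda>x. (e \<otimes> x, s \<otimes> x)) \<in> rng (e \<oplus> s) \<rightarrow> rng e \<times> rng s"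
        using ec sc z(3,4) by (auto simp: rng_def)
      have uv: "e \<otimes> (u \<oplus> v) = u" "s \<otimes> (u \<oplus> v) = v" if "u \<in> rng e" "v \<in> rng s" for u v
        using that z'[OF that(2)] z''[OF that(1)] ec(1) sc(1) by (auto simp: r_distr rng_def)
      then show "(\<lambda>(u, v). u \<oplus> v) \<in> rng e \<times> rng s \<rightarrow> rng (e \<oplus> s)"
        using ec(1) sc(1) by (auto simp: rng_def l_distr)
      show "(case (e \<otimes> x, s \<otimes> x) of (u, v) \<Rightarrow> u \<oplus> v) = x" if "x \<in> rng (e \<oplus> s)" for x
        using that ec(1) sc(1) by (auto simp: rng_def l_distr)
      show "(e \<otimes> (case y of (u, v) \<Rightarrow> u \<oplus> v), s \<otimes> (case y of (u, v) \<Rightarrow> u \<oplus> v)) = y"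
        if "y \<in> rng e \<times> rng s" for y
        using that uv by auto
    qed
    then have "card (rng (e \<oplus> s)) = card (rng e) * card (rng s)"
      using bij_betw_same_card by (fastforce simp: card_cartesian_product)
    then show ?case using t insert sc ec es se by (simp add: l_distr r_distr)
  qed
  then show "s \<in> carrier R" "s \<otimes> s = s" "card (rng s) = (\<Prod>e\<in>S. card (rng e))" by auto
qed

end

context star_ring
begin

text \<open>If \<open>x\<close> in \<open>e R\<close> is killed by the sum of the members of the second frame equivalent to \<open>e0\<close>, then
  \<open>x = j x\<close> with \<open>j\<close> in the radical; so left multiplication by that sum is injective.\<close>

lemma frame_count_le:
  assumes E: "sa_frame R star E" and F: "sa_frame R star F" and p0: "sa_primitive R star e0"
  shows "card {e \<in> E. idem_equiv R e e0} \<le> card {f \<in> F. idem_equiv R f e0}"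
proof -
  define Et where "Et = {e \<in> E. idem_equiv R e e0}"
  define Ft where "Ft = {f \<in> F. idem_equiv R f e0}"
  note E' = E[unfolded sa_frame_def] and F' = F[unfolded sa_frame_def]
  have Ec: "E \<subseteq> carrier R" and Fc: "F \<subseteq> carrier R"
    using E' F' sa_primitiveD(1) by auto
  have e0: "e0 \<in> carrier R" "e0 \<noteq> \<zero>" "e0 \<otimes> e0 = e0" using sa_primitiveD[OF p0] by auto
  define eT where "eT = finsum R (\<lambda>e. e) Et"
  define fT where "fT = finsum R (\<lambda>e. e) Ft"
  define fN where "fN = finsum R (\<lambda>e. e) (F - Ft)"
  have sub: "Et \<subseteq> E" "Ft \<subseteq> F" unfolding Et_def Ft_def by auto
  have fins: "finite Et" "finite Ft" "finite (F - Ft)"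
    using E' F' sub finite_subset by auto
  have eT: "eT \<in> carrier R" "eT \<otimes> eT = eT" "card (rng eT) = (\<Prod>e\<in>Et. card (rng e))"
    unfolding eT_def using orth_sum[OF fins(1)] sub E' Ec sa_primitiveD(2) by (auto simp: subset_iff)
  have fT: "fT \<in> carrier R" "fT \<otimes> fT = fT" "card (rng fT) = (\<Prod>e\<in>Ft. card (rng e))"
    unfolding fT_def using orth_sum[OF fins(2)] sub F' Fc sa_primitiveD(2) by (auto simp: subset_iff)
  have fN: "fN \<in> carrier R" unfolding fN_def using Fc by (intro finsum_closed) auto
  have "finsum R (\<lambda>e. e) (Ft \<union> (F - Ft)) = fT \<oplus> fN"
    unfolding fT_def fN_def using fins sub Fc by (intro finsum_Un_disjoint) auto
  moreover have "Ft \<union> (F - Ft) = F" using sub by auto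
  ultimately have one: "fT \<oplus> fN = \<one>" using F' by simp
  define j where "j = eT \<otimes> fN"
  have "e \<otimes> f \<in> nilrad R" if "e \<in> Et" "f \<in> F - Ft" for e f
  proof (rule not_equiv_nilrad)
    show pe: "sa_primitive R star e" and pf: "sa_primitive R star f" using that sub E' F' by auto
    note e = sa_primitiveD[OF pe] and f = sa_primitiveD[OF pf]
    show "\<not> idem_equiv R e f"
    proof
      assume ef: "idem_equiv R e f"
      have "idem_equiv R e e0" using that by (simp add: Et_def)
      then have "idem_equiv R f e0"
        using idem_equiv_trans[OF idem_equiv_sym[OF ef]] e(1) f(1) e0(1) by blast
      then show False using that unfolding Ft_def by auto
    qed
    show "e \<otimes> f \<in> carrier R" "e \<otimes> (e \<otimes> f) = e \<otimes> f" "e \<otimes> f \<otimes> f = e \<otimes> f"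
      using e f by (simp_all add: m_assoc) (simp add: m_assoc[symmetric])
  qed
  then have "(\<Oplus>f\<in>F - Ft. e \<otimes> f) \<in> nilrad R" if "e \<in> Et" for e
    using finsum_nilrad[OF fin fins(3)] that by blast
  moreover have "e \<otimes> fN = (\<Oplus>f\<in>F - Ft. e \<otimes> f)" if "e \<in> Et" for e
    unfolding fN_def using that sub Ec Fc fins by (intro finsum_rdistr) auto
  ultimately have "(\<Oplus>e\<in>Et. e \<otimes> fN) \<in> nilrad R"
    using finsum_nilrad[OF fin fins(1)] by simp
  moreover have "j = (\<Oplus>e\<in>Et. e \<otimes> fN)"
    unfolding j_def eT_def using fN sub Ec fins by (intro finsum_ldistr) auto
  ultimately have j: "j \<in> nilrad R" by simp
  then have jc: "j \<in> carrier R" using nilrad_carrier by blast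
  have kill: "d = \<zero>" if d: "d \<in> rng eT" "fT \<otimes> d = \<zero>" for d
  proof -
    have dc: "d \<in> carrier R" "eT \<otimes> d = d" using d by (auto simp: rng_def)
    have "d = eT \<otimes> ((fT \<oplus> fN) \<otimes> d)" using dc one by simp
    also have "\<dots> = j \<otimes> d" using dc d(2) eT fT fN by (simp add: l_distr j_def m_assoc)
    finally have jd: "j \<otimes> d = d" by simp
    have "j [^] Suc k \<otimes> d = d" for k
      by (induction k) (use jd jc dc in \<open>auto simp: m_assoc\<close>)
    moreover obtain k where "j [^] Suc k = \<zero>" using nilrad_nilp[OF j] unfolding nilp_def by blast
    ultimately show ?thesis using dc by (metis l_null)
  qed
  have "inj_on (\<lambda>x. fT \<otimes> x) (rng eT)"
  proof (rule inj_onI)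
    fix x y assume xy: "x \<in> rng eT" "y \<in> rng eT" "fT \<otimes> x = fT \<otimes> y"
    then have c: "x \<in> carrier R" "y \<in> carrier R" by (auto simp: rng_def)
    have "x \<oplus> \<ominus> y = \<zero>"
      by (rule kill) (use xy c eT fT in \<open>auto simp: rng_def r_distr r_minus r_neg\<close>)
    then show "x = y" using c by (metis minus_equality minus_minus a_inv_closed a_comm)
  qed
  moreover have "(\<lambda>x. fT \<otimes> x) ` rng eT \<subseteq> rng fT"
    using fT by (auto simp: rng_def m_assoc[symmetric])
  moreover have "finite (rng fT)" using fin by (simp add: rng_def)
  ultimately have le: "card (rng eT) \<le> card (rng fT)" by (rule card_inj_on_le)
  \<comment> \<open>All members counted are equivalent to \<open>e0\<close>, so each of their right
    ideals has \<open>a\<close> elements, and the two sizes are \<open>a\<close> to the numbers to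
    be compared.\<close>
  define a where "a = card (rng e0)"
  have "card (rng e) = a" if "e \<in> Et \<union> Ft" for e
    using that card_rng_equiv[of e e0] e0 Ec Fc sub unfolding a_def Et_def Ft_def by auto
  then have "card (rng eT) = a ^ card Et" "card (rng fT) = a ^ card Ft" using eT fT by auto
  moreover have "a > 1"
  proof -
    have "{\<zero>, e0} \<subseteq> rng e0" using e0 by (auto simp: rng_def)
    moreover have "finite (rng e0)" using fin by (simp add: rng_def)
    ultimately have "card {\<zero>, e0} \<le> a" unfolding a_def by (rule card_mono[rotated])
    then show ?thesis using e0 by simp
  qed
  ultimately show ?thesis using le by (simp add: Et_def Ft_def)
qed

text \<open>The inequality of \<open>frame_count_le\<close>, used both ways, equates the numbers of
  members in each class. A function constant on classes is a function \<open>h'\<close> of the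
  class, so its multisets agree.\<close>

lemma frame_mset_eq:
  assumes "sa_frame R star E" "sa_frame R star F"
    and inv: "\<And>e f. e \<in> E \<union> F \<Longrightarrow> f \<in> E \<union> F \<Longrightarrow> idem_equiv R e f \<Longrightarrow> h e = h f"
  shows "image_mset h (mset_set E) = image_mset h (mset_set F)"
proof -
  define cl where "cl e = {f \<in> E \<union> F. idem_equiv R f e}" for e
  have fins: "finite E" "finite F" using assms unfolding sa_frame_def by auto
  have prim: "sa_primitive R star e" if "e \<in> E \<union> F" for e using assms that unfolding sa_frame_def by auto
  have cl_iff: "cl e = cl e0 \<longleftrightarrow> idem_equiv R e e0" if e: "e \<in> E \<union> F" and e0: "e0 \<in> E \<union> F" for e e0
  proof
    assume "cl e = cl e0"
    moreover have "e \<in> cl e" using e idem_equiv_refl sa_primitiveD(1,2)[OF prim[OF e]] unfolding cl_def by simp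
    ultimately show "idem_equiv R e e0" unfolding cl_def by auto
  next
    assume a: "idem_equiv R e e0"
    have c: "x \<in> carrier R" if "x \<in> E \<union> F" for x using sa_primitiveD(1)[OF prim[OF that]] .
    have "idem_equiv R f e \<longleftrightarrow> idem_equiv R f e0" if f: "f \<in> E \<union> F" for f
      using e e0 idem_equiv_trans[OF _ a, of f] idem_equiv_trans[OF _ idem_equiv_sym[OF a], of f]
        c[OF f] c[OF e] c[OF e0] by blast
    then show "cl e = cl e0" unfolding cl_def by blast
  qed
  have cnt: "count (image_mset cl (mset_set S)) c = card {e \<in> S. cl e = c}" if "finite S" for S c
    using that by (simp add: count_image_mset Int_def vimage_def conj_commute)
  have "image_mset cl (mset_set E) = image_mset cl (mset_set F)"
  proof (rule multiset_eqI)
    fix c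
    show "count (image_mset cl (mset_set E)) c = count (image_mset cl (mset_set F)) c"
    proof (cases "\<exists>e0 \<in> E \<union> F. cl e0 = c")
      case True
      then obtain e0 where e0: "e0 \<in> E \<union> F" "cl e0 = c" by blast
      have "{e \<in> E. cl e = c} = {e \<in> E. idem_equiv R e e0}" "{e \<in> F. cl e = c} = {e \<in> F. idem_equiv R e e0}"
        using cl_iff e0 by auto
      moreover have "card {e \<in> E. idem_equiv R e e0} = card {e \<in> F. idem_equiv R e e0}"
        using frame_count_le assms prim[OF e0(1)] by (meson le_antisym)
      ultimately show ?thesis using cnt fins by simp
    next
      case False
      then have "{e \<in> E. cl e = c} = {}" "{e \<in> F. cl e = c} = {}" by auto
      then show ?thesis unfolding cnt[OF fins(1)] cnt[OF fins(2)] by (simp only: card.empty)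
    qed
  qed
  moreover define h' where "h' c = h (SOME e. e \<in> E \<union> F \<and> cl e = c)" for c
  have "h e = h' (cl e)" if e: "e \<in> E \<union> F" for e
  proof -
    have "(SOME x. x \<in> E \<union> F \<and> cl x = cl e) \<in> E \<union> F \<and> cl (SOME x. x \<in> E \<union> F \<and> cl x = cl e) = cl e"
      by (rule someI[of _ e]) (use e in simp)
    then show ?thesis unfolding h'_def using inv cl_iff e by metis
  qed
  then have "image_mset h (mset_set S) = image_mset h' (image_mset cl (mset_set S))"
    if "S \<subseteq> E \<union> F" "finite S" for S
    using that by (auto simp: image_mset.compositionality intro!: image_mset_cong)
  ultimately show ?thesis using fins by (metis Un_upper1 Un_upper2)
qed

end

section \<open>Central decompositions\<close>

context group
begin

lemma commutes_generate:
  assumes "S \<subseteq> carrier G" "x \<in> carrier G" "\<And>s. s \<in> S \<Longrightarrow> x \<otimes> s = s \<otimes> x" "c \<in> generate G S"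
  shows "x \<otimes> c = c \<otimes> x"
  using assms(4)
proof (induction rule: generate.induct)
  case (inv h)
  then have h: "h \<in> carrier G" "x \<otimes> h = h \<otimes> x" using assms by auto
  have "x \<otimes> inv h = inv h \<otimes> (h \<otimes> x) \<otimes> inv h" using h assms(2) by (simp add: m_assoc[symmetric])
  also have "\<dots> = inv h \<otimes> (x \<otimes> h) \<otimes> inv h" using h by simp
  also have "\<dots> = inv h \<otimes> x" using h(1) assms(2) by (simp add: m_assoc)
  finally show ?case .
next
  case (eng a b)
  then have "a \<in> carrier G" "b \<in> carrier G" using generate_in_carrier assms(1) by auto
  then show ?case using eng.IH assms(2) by (metis m_assoc)
qed (use assms in auto)

definition cofactor :: "'a set set \<Rightarrow> 'a set \<Rightarrow> 'a set" where
  "cofactor Hs H = generate G (\<Union> (Hs - {H}))"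

text \<open>Collapses a decomposition to two commuting factors, a member and the subgroup generated
  by the others. The last claim is what minimality of the generating family becomes.\<close>

lemma central_decomp_cofactor:
  assumes cd: "central_decomp G Hs" and H: "H \<in> Hs"
  shows "subgroup H G" "subgroup (cofactor Hs H) G"
    "\<And>x y. x \<in> H \<Longrightarrow> y \<in> cofactor Hs H \<Longrightarrow> x \<otimes> y = y \<otimes> x"
    "\<And>x. x \<in> carrier G \<Longrightarrow> \<exists>h \<in> H. \<exists>c \<in> cofactor Hs H. x = h \<otimes> c"
    "\<not> H \<subseteq> cofactor Hs H"
proof -
  note cd' = cd[unfolded central_decomp_def]
  have sub: "\<And>K. K \<in> Hs \<Longrightarrow> subgroup K G" using cd' by simp
  have comm': "x \<otimes> y = y \<otimes> x" if "K \<in> Hs" "L \<in> Hs" "K \<noteq> L" "x \<in> K" "y \<in> L" for K L x y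
    using cd' that by simp
  have subc: "\<Union> (Hs - {H}) \<subseteq> carrier G" using sub subgroup.subset by blast
  show Hs: "subgroup H G" using sub H by blast
  show Cs: "subgroup (cofactor Hs H) G" unfolding cofactor_def using generate_is_subgroup[OF subc] .
  interpret HS: subgroup H G by fact
  interpret CS: subgroup "cofactor Hs H" G by fact
  show comm: "x \<otimes> y = y \<otimes> x" if "x \<in> H" "y \<in> cofactor Hs H" for x y
  proof (rule commutes_generate[OF subc])
    show "x \<in> carrier G" using that by auto
    show "x \<otimes> s = s \<otimes> x" if "s \<in> \<Union> (Hs - {H})" for s
      using that \<open>x \<in> H\<close> H comm'[of H _ x s] by auto
    show "y \<in> generate G (\<Union> (Hs - {H}))" using that by (simp add: cofactor_def)
  qed
  have incl: "K \<subseteq> cofactor Hs H" if "K \<in> Hs" "K \<noteq> H" for K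
    unfolding cofactor_def using that by (intro subsetI generate.incl) blast
  have dec: "\<exists>h \<in> H. \<exists>c \<in> cofactor Hs H. x = h \<otimes> c" if "K \<in> Hs" "x \<in> K" for K x
  proof (cases "K = H")
    case True
    then have "x = x \<otimes> \<one>" using that HS.mem_carrier by simp
    then show ?thesis using True that CS.one_closed by blast
  next
    case False
    then have x: "x \<in> cofactor Hs H" using that incl by blast
    then have "x = \<one> \<otimes> x" using CS.mem_carrier by simp
    with x show ?thesis using HS.one_closed by blast
  qed
  have "generate G (\<Union> Hs) \<subseteq> {h \<otimes> c | h c. h \<in> H \<and> c \<in> cofactor Hs H}"
  proof
    fix x assume "x \<in> generate G (\<Union> Hs)"
    then have "\<exists>h \<in> H. \<exists>c \<in> cofactor Hs H. x = h \<otimes> c"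
    proof (induction rule: generate.induct)
      case one
      then show ?case using HS.one_closed CS.one_closed by (metis l_one one_closed)
    next
      case (incl h)
      then obtain K where "K \<in> Hs" "h \<in> K" by blast
      then show ?case
        using dec by blast
    next
      case (inv h)
      then obtain K where K: "K \<in> Hs" "h \<in> K" by blast
      have "inv h \<in> K" using subgroup.m_inv_closed[OF sub[OF K(1)] K(2)] .
      then show ?case using K dec by blast
    next
      case (eng a b)
      then obtain h c h' c' where hc: "h \<in> H" "c \<in> cofactor Hs H" "a = h \<otimes> c"
        "h' \<in> H" "c' \<in> cofactor Hs H" "b = h' \<otimes> c'" by blast
      have "a \<otimes> b = h \<otimes> (c \<otimes> h') \<otimes> c'" using hc by (simp add: m_assoc)
      also have "\<dots> = h \<otimes> (h' \<otimes> c) \<otimes> c'" using comm hc by simp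
      also have "\<dots> = (h \<otimes> h') \<otimes> (c \<otimes> c')" using hc by (simp add: m_assoc)
      finally show ?case using hc by blast
    qed
    then show "x \<in> {h \<otimes> c | h c. h \<in> H \<and> c \<in> cofactor Hs H}" by blast
  qed
  moreover have "generate G (\<Union> Hs) = carrier G" using cd' by simp
  ultimately show "\<exists>h \<in> H. \<exists>c \<in> cofactor Hs H. x = h \<otimes> c" if "x \<in> carrier G" for x
    using that by blast
  show "\<not> H \<subseteq> cofactor Hs H"
  proof
    assume "H \<subseteq> cofactor Hs H"
    then have "\<Union> Hs \<subseteq> cofactor Hs H" using incl by blast
    then have "carrier G \<subseteq> cofactor Hs H"
      using generate_subgroup_incl[OF _ Cs] \<open>generate G (\<Union> Hs) = carrier G\<close> by blast
    then have "generate G (\<Union> (Hs - {H})) = carrier G"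
      using subgroup.subset[OF Cs] unfolding cofactor_def by blast
    moreover have "Hs - {H} \<subset> Hs" using H by blast
    ultimately show False using cd' by simp
  qed
qed

text \<open>Two proper factors would form the central decomposition \<open>{A, B}\<close>: the union
  of a proper subset lies in \<open>A\<close> or in \<open>B\<close> and cannot generate.\<close>

lemma indecomposable_two_factors:
  assumes ind: "centrally_indecomposable G" and A: "subgroup A G" and B: "subgroup B G"
    and comm: "\<And>x y. x \<in> A \<Longrightarrow> y \<in> B \<Longrightarrow> x \<otimes> y = y \<otimes> x"
    and gen: "\<And>x. x \<in> carrier G \<Longrightarrow> \<exists>a \<in> A. \<exists>b \<in> B. x = a \<otimes> b"
  shows "A = carrier G \<or> B = carrier G"
proof (rule ccontr)
  assume ne: "\<not> (A = carrier G \<or> B = carrier G)"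
  have AB: "A \<subseteq> carrier G" "B \<subseteq> carrier G" using A B subgroup.subset by auto
  have "central_decomp G {A, B}"
    unfolding central_decomp_def
  proof (intro conjI)
    show "\<forall>H \<in> {A, B}. subgroup H G" using A B by blast
    show "\<forall>H\<in>{A, B}. \<forall>K\<in>{A, B}. H \<noteq> K \<longrightarrow> (\<forall>x\<in>H. \<forall>y\<in>K. x \<otimes> y = y \<otimes> x)"
      using comm by (metis insertE singletonD)
    show "generate G (\<Union> {A, B}) = carrier G"
    proof
      show "carrier G \<subseteq> generate G (\<Union> {A, B})"
      proof
        fix x assume "x \<in> carrier G"
        then obtain a b where "a \<in> A" "b \<in> B" "x = a \<otimes> b" using gen by blast
        then show "x \<in> generate G (\<Union> {A, B})" using generate.incl generate.eng
          by (metis UnCI Union_insert Union_empty Un_empty_right)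
      qed
    qed (use AB in \<open>intro generate_incl; auto\<close>)
    show "\<forall>Ks. Ks \<subset> {A, B} \<longrightarrow> generate G (\<Union> Ks) \<noteq> carrier G"
    proof (intro allI impI)
      fix Ks assume "Ks \<subset> {A, B}"
      then have "\<Union> Ks \<subseteq> A \<or> \<Union> Ks \<subseteq> B" by blast
      then have "generate G (\<Union> Ks) \<subseteq> A \<or> generate G (\<Union> Ks) \<subseteq> B"
        using generate_subgroup_incl A B by blast
      then show "generate G (\<Union> Ks) \<noteq> carrier G" using ne AB by blast
    qed
  qed
  then have "{A, B} = {carrier G}" using ind by (simp add: centrally_indecomposable_def)
  then show False using ne by blast
qed

text \<open>A nontrivial \<open>y = x^k\<close> has \<open>k\<close> prime to \<open>p\<close>, and
  Bezout inverts \<open>k\<close> modulo \<open>p\<close>.\<close>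

lemma exponent_generate:
  assumes p: "Factorial_Ring.prime (p::nat)" and x: "x \<in> carrier G" "x [^] p = \<one>"
    and y: "y \<in> generate G {x}" "y \<noteq> \<one>"
  shows "\<exists>j::int. x = y [^] j"
proof -
  obtain k :: int where k: "y = x [^] k" using y(1) generate_pow[OF x(1)] by blast
  have xp: "x [^] (int p * i) = \<one>" for i :: int
    using int_pow_pow[OF x(1), of "int p" i] x(2) by (simp add: int_pow_int)
  have "\<not> int p dvd k" using xp y(2) k by (metis dvdE)
  then have "coprime k (int p)"
    using p prime_imp_coprime_int[of "int p" k] by (simp add: coprime_commute)
  then obtain u v where uv: "k * u + int p * v = 1" using bezout_int[of k "int p"] 
    by (metis coprime_iff_gcd_eq_1 mult.commute)
  have "x = x [^] (k * u + int p * v)" using uv x by simp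
  also have "\<dots> = (x [^] k) [^] u" using x xp by (simp add: int_pow_mult int_pow_pow)
  finally show ?thesis using k by blast
qed

text \<open>A subgroup maximal among those containing the derived subgroup and avoiding \<open>z\<close> is a
  complement of \<open>\<langle>z\<rangle>\<close>.\<close>

lemma indecomposable_center:
  assumes ind: "centrally_indecomposable G" and p: "Factorial_Ring.prime (p::nat)"
    and fin: "finite (carrier G)" and exp: "\<And>x. x \<in> carrier G \<Longrightarrow> x [^] p = \<one>"
    and z: "z \<in> group_center G" "z \<notin> derived G (carrier G)"
  shows "generate G {z} = carrier G"
proof -
  have zc: "z \<in> carrier G" "\<And>x. x \<in> carrier G \<Longrightarrow> z \<otimes> x = x \<otimes> z"
    using z unfolding group_center_def by auto
  define D where "D = derived G (carrier G)"
  have D: "subgroup D G" unfolding D_def by (rule derived_is_subgroup) simp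
  define \<M> where "\<M> = {M. subgroup M G \<and> D \<subseteq> M \<and> z \<notin> M}"
  have "\<M> \<subseteq> Pow (carrier G)" unfolding \<M>_def using subgroup.subset by blast
  then have "finite \<M>" using fin finite_subset by auto
  moreover have "D \<in> \<M>" using D z unfolding \<M>_def D_def by blast
  ultimately obtain M where M: "M \<in> \<M>" "\<And>B. B \<in> \<M> \<Longrightarrow> M \<subseteq> B \<Longrightarrow> M = B"
    using finite_has_maximal[of \<M>] by blast
  then have Ms: "subgroup M G" "D \<subseteq> M" "z \<notin> M" unfolding \<M>_def by auto
  interpret M: subgroup M G by fact
  have MN: "M \<lhd> G"
    unfolding normal_inv_iff
  proof (intro conjI ballI)
    fix x h assume xh: "x \<in> carrier G" "h \<in> M"
    then have "x \<otimes> h \<otimes> inv x \<otimes> inv h \<in> D"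
      unfolding D_def derived_def using M.mem_carrier by (intro generate.incl) blast
    then have "(x \<otimes> h \<otimes> inv x \<otimes> inv h) \<otimes> h \<in> M" using Ms xh M.m_closed by blast
    then show "x \<otimes> h \<otimes> inv x \<in> M" using xh by (simp add: m_assoc)
  qed fact
  have "\<exists>a \<in> M. \<exists>b \<in> generate G {z}. x = a \<otimes> b" if x: "x \<in> carrier G" for x
  proof (cases "x \<in> M")
    case True
    then show ?thesis using generate.one[of G "{z}"] by (metis M.mem_carrier r_one)
  next
    case False
    \<comment> \<open>Maximality of \<open>M\<close> puts \<open>z\<close> into the larger subgroup
      \<open>M <x>\<close>. Solving \<open>z = m y\<close> for \<open>y\<close> and writing
      \<open>x\<close> as a power of \<open>y\<close> brings \<open>x\<close> into
      \<open>M <z>\<close>.\<close>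
    define B where "B = M <#> generate G {x}"
    have gx: "subgroup (generate G {x}) G" using x by (intro generate_is_subgroup) simp
    have B: "subgroup B G" unfolding B_def by (rule mult_norm_subgroup[OF MN gx])
    have MB: "M \<subseteq> B"
    proof
      fix m assume m: "m \<in> M"
      then have "m = m \<otimes> \<one>" using M.mem_carrier by simp
      then show "m \<in> B" unfolding B_def set_mult_def using m generate.one[of G "{x}"] by blast
    qed
    have "x = \<one> \<otimes> x" using x by simp
    then have "x \<in> B" unfolding B_def set_mult_def
      using M.one_closed generate.incl[of x "{x}" G] by blast
    then have "z \<in> B" using M(2)[of B] B MB Ms False unfolding \<M>_def by blast
    then obtain m y where my: "m \<in> M" "y \<in> generate G {x}" "z = m \<otimes> y"
      unfolding B_def set_mult_def by blast
    have "y \<noteq> \<one>" using my Ms by (metis M.mem_carrier r_one)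
    then obtain j :: int where j: "x = y [^] j"
      using exponent_generate[OF p x exp[OF x] my(2)] by blast
    have yc: "y \<in> carrier G" using my(2) subgroup.mem_carrier[OF gx] by blast
    have "y = inv m \<otimes> z" using my yc by (simp add: m_assoc[symmetric])
    then have "x = (inv m \<otimes> z) [^] j" using j by simp
    moreover have "(inv m \<otimes> z) [^] j = inv m [^] j \<otimes> z [^] j"
      by (rule int_pow_mult_distrib) (use my zc in auto)
    ultimately have "x = inv m [^] j \<otimes> z [^] j" by simp
    moreover have "inv m [^] j \<in> M" using my Ms by (simp add: subgroup_int_pow_closed)
    moreover have "z [^] j \<in> generate G {z}" using generate_pow[OF zc(1)] by blast
    ultimately show ?thesis by blast
  qed
  moreover have "subgroup (generate G {z}) G" using zc by (intro generate_is_subgroup) simp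
  moreover have "x \<otimes> y = y \<otimes> x" if "x \<in> M" "y \<in> generate G {z}" for x y
    using commutes_generate[of "{z}" x y] zc that by auto
  ultimately have "M = carrier G \<or> generate G {z} = carrier G"
    using indecomposable_two_factors[OF ind Ms(1)] by blast
  then show ?thesis using Ms zc by blast
qed

end

section \<open>The ring of adjoint pairs of the commutator form\<close>

text \<open>The pair of \<open>V\<close> and \<open>q\<close> models \<open>P/P'\<close> by an
  epimorphism with kernel \<open>P'\<close>. Keeping it abstract avoids coset arithmetic; the factor
  group is inserted only when the locale is interpreted.\<close>

locale class2_group = group P + V: comm_group V
  for P :: "('a, 'b) monoid_scheme" (structure) and V :: "('v, 'w) monoid_scheme" +
  fixes q :: "'a \<Rightarrow> 'v" and p :: nat
  assumes p: "Factorial_Ring.prime p" "odd p"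
    and finP: "finite (carrier P)"
    and derived_central: "derived P (carrier P) \<subseteq> group_center P"
    and exponent: "x \<in> carrier P \<Longrightarrow> x [^] p = \<one>"
    and q_hom: "q \<in> hom P V"
    and q_surj: "q ` carrier P = carrier V"
    and q_ker: "x \<in> carrier P \<Longrightarrow> q x = \<one>\<^bsub>V\<^esub> \<longleftrightarrow> x \<in> derived P (carrier P)"
begin

abbreviation D where "D \<equiv> derived P (carrier P)"

interpretation Q: group_hom P V q
  by unfold_locales (rule q_hom)

lemma q_closed [simp]: "x \<in> carrier P \<Longrightarrow> q x \<in> carrier V" by (rule Q.hom_closed)
lemma q_mult: "x \<in> carrier P \<Longrightarrow> y \<in> carrier P \<Longrightarrow> q (x \<otimes> y) = q x \<otimes>\<^bsub>V\<^esub> q y" by (rule Q.hom_mult)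
lemma q_inv: "x \<in> carrier P \<Longrightarrow> q (inv x) = inv\<^bsub>V\<^esub> q x" by (rule Q.hom_inv)
lemma q_one: "q \<one> = \<one>\<^bsub>V\<^esub>" by (rule Q.hom_one)

lemma q_lift: "v \<in> carrier V \<Longrightarrow> \<exists>x \<in> carrier P. q x = v"
  unfolding q_surj[symmetric] by blast

lemma D_subgroup: "subgroup D P" by (rule derived_is_subgroup) simp

lemma D_carrier: "d \<in> D \<Longrightarrow> d \<in> carrier P"
  using subgroup.mem_carrier[OF D_subgroup] by blast

lemma D_central: "d \<in> D \<Longrightarrow> x \<in> carrier P \<Longrightarrow> d \<otimes> x = x \<otimes> d"
  using derived_central unfolding group_center_def by blast

lemma q_eqD:
  assumes "x \<in> carrier P" "y \<in> carrier P" "q x = q y"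
  shows "\<exists>d \<in> D. y = x \<otimes> d"
proof -
  have "q (inv x \<otimes> y) = \<one>\<^bsub>V\<^esub>" using assms by (simp add: q_mult q_inv)
  then have "inv x \<otimes> y \<in> D" using q_ker[of "inv x \<otimes> y"] assms by blast
  moreover have "y = x \<otimes> (inv x \<otimes> y)" using assms by (simp add: m_assoc[symmetric])
  ultimately show ?thesis by blast
qed

lemma q_D: "d \<in> D \<Longrightarrow> q d = \<one>\<^bsub>V\<^esub>"
  using q_ker D_carrier by simp

definition comm :: "'a \<Rightarrow> 'a \<Rightarrow> 'a" where
  "comm x y = x \<otimes> y \<otimes> inv x \<otimes> inv y"

lemma comm_D: 
  assumes "x \<in> carrier P" "y \<in> carrier P" shows "comm x y \<in> D"
  unfolding derived_def comm_def by (rule generate.incl) (use assms in blast)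

lemma comm_closed [simp]: "x \<in> carrier P \<Longrightarrow> y \<in> carrier P \<Longrightarrow> comm x y \<in> carrier P"
  by (simp add: comm_def)

lemma inv_cancel: 
  assumes "x \<in> carrier P" "y \<in> carrier P"
  shows "x \<otimes> (inv x \<otimes> y) = y" "inv x \<otimes> (x \<otimes> y) = y"
  using assms by (simp_all add: m_assoc[symmetric])

lemma comm_mult_l:
  assumes "x \<in> carrier P" "y \<in> carrier P" "z \<in> carrier P"
  shows "comm (x \<otimes> y) z = comm x z \<otimes> comm y z"
proof -
  have "comm (x \<otimes> y) z = x \<otimes> comm y z \<otimes> (z \<otimes> inv x \<otimes> inv z)"
    using assms by (simp add: comm_def inv_mult_group m_assoc inv_cancel)
  also have "\<dots> = comm y z \<otimes> x \<otimes> (z \<otimes> inv x \<otimes> inv z)"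
    using D_central[OF comm_D, of y z x] assms by simp
  also have "\<dots> = comm y z \<otimes> comm x z"
    using assms by (simp add: comm_def m_assoc)
  finally show ?thesis using D_central[OF comm_D, of y z "comm x z"] assms by simp
qed

lemma comm_inv: "x \<in> carrier P \<Longrightarrow> y \<in> carrier P \<Longrightarrow> comm y x = inv (comm x y)"
  by (simp add: comm_def inv_mult_group m_assoc)

lemma comm_mult_r:
  assumes "x \<in> carrier P" "y \<in> carrier P" "z \<in> carrier P"
  shows "comm z (x \<otimes> y) = comm z x \<otimes> comm z y"
proof -
  have "comm z (x \<otimes> y) = inv (comm x z \<otimes> comm y z)"
    using comm_inv[of "x \<otimes> y" z] comm_mult_l[of x y z] assms by simp
  also have "\<dots> = comm z y \<otimes> comm z x" using assms by (simp add: inv_mult_group comm_inv[of x z] comm_inv[of y z])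
  also have "\<dots> = comm z x \<otimes> comm z y" using D_central[OF comm_D, of z y "comm z x"] assms by simp
  finally show ?thesis .
qed

lemma comm_one_iff:
  assumes "x \<in> carrier P" "y \<in> carrier P"
  shows "comm x y = \<one> \<longleftrightarrow> x \<otimes> y = y \<otimes> x"
proof -
  have "comm x y = (x \<otimes> y) \<otimes> inv (y \<otimes> x)" using assms by (simp add: comm_def inv_mult_group m_assoc)
  then show ?thesis using assms by (metis inv_closed inv_equality inv_inv m_closed r_inv)
qed

lemma comm_D_one: "d \<in> D \<Longrightarrow> x \<in> carrier P \<Longrightarrow> comm d x = \<one>" "d \<in> D \<Longrightarrow> x \<in> carrier P \<Longrightarrow> comm x d = \<one>"
  using comm_one_iff D_central D_carrier by metis+

text \<open>Multiplying either argument by an element of \<open>D\<close> changes nothing, so the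
  commutator is a bilinear map on \<open>V\<close>.\<close>

lemma comm_cong:
  assumes "x \<in> carrier P" "y \<in> carrier P" "x' \<in> carrier P" "y' \<in> carrier P" "q x = q x'" "q y = q y'"
  shows "comm x y = comm x' y'"
proof -
  obtain d where d: "d \<in> D" "x' = x \<otimes> d" using q_eqD assms by blast
  obtain d' where d': "d' \<in> D" "y' = y \<otimes> d'" using q_eqD assms by blast
  show ?thesis using assms(1,2) d d' D_carrier by (simp add: comm_mult_l comm_mult_r comm_D_one)
qed

text \<open>Extensionality makes an operator the same as its values on \<open>V\<close>, so there
  are finitely many and equality can be checked pointwise.\<close>

definition Hm :: "('v \<Rightarrow> 'v) set" where
  "Hm = {f \<in> extensional (carrier V). f \<in> hom V V}"

text \<open>The commutator form is never defined on \<open>V\<close> itself: adjointness is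
  expressed through lifts to \<open>P\<close>. By \<open>comm_cong\<close> the choice of lifts does
  not matter, which is why \<open>adjI\<close> asks for one pair of lifts only.\<close>

definition adj :: "('v \<Rightarrow> 'v) \<Rightarrow> ('v \<Rightarrow> 'v) \<Rightarrow> bool" where
  "adj f g \<longleftrightarrow> (\<forall>x \<in> carrier P. \<forall>y \<in> carrier P. \<forall>x' \<in> carrier P. \<forall>y' \<in> carrier P.
     q x' = f (q x) \<longrightarrow> q y' = g (q y) \<longrightarrow> comm x' y = comm x y')"

definition addf :: "('v \<Rightarrow> 'v) \<Rightarrow> ('v \<Rightarrow> 'v) \<Rightarrow> 'v \<Rightarrow> 'v" where
  "addf f g = (\<lambda>x \<in> carrier V. f x \<otimes>\<^bsub>V\<^esub> g x)"

definition idf :: "'v \<Rightarrow> 'v" where "idf = (\<lambda>x \<in> carrier V. x)"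
definition zerof :: "'v \<Rightarrow> 'v" where "zerof = (\<lambda>x \<in> carrier V. \<one>\<^bsub>V\<^esub>)"
definition powf :: "nat \<Rightarrow> 'v \<Rightarrow> 'v" where "powf k = (\<lambda>x \<in> carrier V. x [^]\<^bsub>V\<^esub> k)"

text \<open>Keeping both components of an adjoint pair makes the involution well defined even if the commutator
  form has a radical.\<close>

definition adj_ring :: "(('v \<Rightarrow> 'v) \<times> ('v \<Rightarrow> 'v)) ring" where
  "adj_ring = \<lparr>carrier = {(f, g). f \<in> Hm \<and> g \<in> Hm \<and> adj f g},
     monoid.mult = (\<lambda>(f, g) (f', g'). (compose (carrier V) f f', compose (carrier V) g' g)),
     one = (idf, idf), ring.zero = (zerof, zerof),
     ring.add = (\<lambda>(f, g) (f', g'). (addf f f', addf g g'))\<rparr>"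

lemma HmD:
  assumes "f \<in> Hm"
  shows "f \<in> extensional (carrier V)" "\<And>x. x \<in> carrier V \<Longrightarrow> f x \<in> carrier V"
    "\<And>x y. x \<in> carrier V \<Longrightarrow> y \<in> carrier V \<Longrightarrow> f (x \<otimes>\<^bsub>V\<^esub> y) = f x \<otimes>\<^bsub>V\<^esub> f y"
    "f \<one>\<^bsub>V\<^esub> = \<one>\<^bsub>V\<^esub>"
proof -
  have f: "f \<in> extensional (carrier V)" "f \<in> hom V V" using assms unfolding Hm_def by auto
  show "f \<in> extensional (carrier V)" by fact
  show "\<And>x. x \<in> carrier V \<Longrightarrow> f x \<in> carrier V" using f(2) by (rule hom_in_carrier)
  show "\<And>x y. x \<in> carrier V \<Longrightarrow> y \<in> carrier V \<Longrightarrow> f (x \<otimes>\<^bsub>V\<^esub> y) = f x \<otimes>\<^bsub>V\<^esub> f y"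
    using f(2) by (rule hom_mult)
  show "f \<one>\<^bsub>V\<^esub> = \<one>\<^bsub>V\<^esub>" using f(2) V.group_axioms V.group_axioms by (rule hom_one)
qed

lemma Hm_eqI: "f \<in> Hm \<Longrightarrow> g \<in> Hm \<Longrightarrow> (\<And>x. x \<in> carrier V \<Longrightarrow> f x = g x) \<Longrightarrow> f = g"
  using extensionalityI HmD(1) by blast

lemma HmI: "f \<in> extensional (carrier V) \<Longrightarrow> (\<And>x. x \<in> carrier V \<Longrightarrow> f x \<in> carrier V) \<Longrightarrow>
    (\<And>x y. x \<in> carrier V \<Longrightarrow> y \<in> carrier V \<Longrightarrow> f (x \<otimes>\<^bsub>V\<^esub> y) = f x \<otimes>\<^bsub>V\<^esub> f y) \<Longrightarrow> f \<in> Hm"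
  unfolding Hm_def hom_def by auto

lemma fn_app:
  "x \<in> carrier V \<Longrightarrow> addf f g x = f x \<otimes>\<^bsub>V\<^esub> g x" "x \<in> carrier V \<Longrightarrow> idf x = x"
  "x \<in> carrier V \<Longrightarrow> zerof x = \<one>\<^bsub>V\<^esub>" "x \<in> carrier V \<Longrightarrow> powf k x = x [^]\<^bsub>V\<^esub> k"
  "x \<in> carrier V \<Longrightarrow> compose (carrier V) f g x = f (g x)"
  by (simp_all add: addf_def idf_def zerof_def powf_def compose_def)

lemma addf_Hm: "f \<in> Hm \<Longrightarrow> g \<in> Hm \<Longrightarrow> addf f g \<in> Hm"
  by (rule HmI) (simp_all add: addf_def HmD V.m_ac)

lemma idf_Hm: "idf \<in> Hm" by (rule HmI) (auto simp: idf_def)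
lemma zerof_Hm: "zerof \<in> Hm" by (rule HmI) (auto simp: zerof_def)
lemma powf_Hm: "powf k \<in> Hm" by (rule HmI) (auto simp: powf_def V.pow_mult_distrib V.m_comm)
lemma compose_Hm: "f \<in> Hm \<Longrightarrow> g \<in> Hm \<Longrightarrow> compose (carrier V) f g \<in> Hm"
  by (rule HmI) (auto simp: compose_def HmD)

lemmas Hm_intros = addf_Hm idf_Hm zerof_Hm powf_Hm compose_Hm

lemma adjI:
  assumes "\<And>x y. x \<in> carrier P \<Longrightarrow> y \<in> carrier P \<Longrightarrow>
    \<exists>x' \<in> carrier P. \<exists>y' \<in> carrier P. q x' = f (q x) \<and> q y' = g (q y) \<and> comm x' y = comm x y'"
  shows "adj f g"
  unfolding adj_def
proof (intro ballI impI)
  fix x y x' y' assume h: "x \<in> carrier P" "y \<in> carrier P" "x' \<in> carrier P" "y' \<in> carrier P"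
    "q x' = f (q x)" "q y' = g (q y)"
  then obtain u w where u: "u \<in> carrier P" "w \<in> carrier P" "q u = f (q x)" "q w = g (q y)"
    "comm u y = comm x w" using assms by blast
  have "comm x' y = comm u y" by (rule comm_cong) (use h u in auto)
  also have "\<dots> = comm x y'" unfolding u(5) by (rule comm_cong) (use h u in auto)
  finally show "comm x' y = comm x y'" .
qed

lemma adjD:
  assumes "adj f g" "x \<in> carrier P" "y \<in> carrier P" "x' \<in> carrier P" "y' \<in> carrier P"
    "q x' = f (q x)" "q y' = g (q y)"
  shows "comm x' y = comm x y'"
  using assms unfolding adj_def by blast

lemma adj_sym:
  assumes "adj f g" shows "adj g f"
  unfolding adj_def
proof (intro ballI impI)
  fix x y x' y' assume h: "x \<in> carrier P" "y \<in> carrier P" "x' \<in> carrier P" "y' \<in> carrier P"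
    "q x' = g (q x)" "q y' = f (q y)"
  then have "comm y' x = comm y x'" using adjD[OF assms] by blast
  then show "comm x' y = comm x y'" using comm_inv h by metis
qed

lemma adj_add:
  assumes "f \<in> Hm" "g \<in> Hm" "f' \<in> Hm" "g' \<in> Hm" "adj f g" "adj f' g'"
  shows "adj (addf f f') (addf g g')"
proof (rule adjI)
  fix x y assume xy: "x \<in> carrier P" "y \<in> carrier P"
  obtain a where a: "a \<in> carrier P" "q a = f (q x)" using q_lift[OF HmD(2)[OF assms(1) q_closed[OF xy(1)]]] by blast
  obtain a' where a': "a' \<in> carrier P" "q a' = f' (q x)" using q_lift[OF HmD(2)[OF assms(3) q_closed[OF xy(1)]]] by blast
  obtain b where b: "b \<in> carrier P" "q b = g (q y)" using q_lift[OF HmD(2)[OF assms(2) q_closed[OF xy(2)]]] by blast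
  obtain b' where b': "b' \<in> carrier P" "q b' = g' (q y)" using q_lift[OF HmD(2)[OF assms(4) q_closed[OF xy(2)]]] by blast
  have "comm (a \<otimes> a') y = comm x (b \<otimes> b')"
    using adjD[OF assms(5) xy a(1) b(1) a(2) b(2)] adjD[OF assms(6) xy a'(1) b'(1) a'(2) b'(2)]
      a b a' b' xy by (simp add: comm_mult_l comm_mult_r)
  then show "\<exists>x' \<in> carrier P. \<exists>y' \<in> carrier P.
      q x' = addf f f' (q x) \<and> q y' = addf g g' (q y) \<and> comm x' y = comm x y'"
    using a b a' b' xy by (intro bexI[of _ "a \<otimes> a'"] bexI[of _ "b \<otimes> b'"]) (auto simp: fn_app q_mult)
qed

lemma adj_compose:
  assumes "f \<in> Hm" "g \<in> Hm" "f' \<in> Hm" "g' \<in> Hm" "adj f g" "adj f' g'"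
  shows "adj (compose (carrier V) f f') (compose (carrier V) g' g)"
proof (rule adjI)
  fix x y assume xy: "x \<in> carrier P" "y \<in> carrier P"
  obtain u where u: "u \<in> carrier P" "q u = f' (q x)" using q_lift[OF HmD(2)[OF assms(3) q_closed[OF xy(1)]]] by blast
  obtain a where a: "a \<in> carrier P" "q a = f (q u)" using q_lift[OF HmD(2)[OF assms(1) q_closed[OF u(1)]]] by blast
  obtain w where w: "w \<in> carrier P" "q w = g (q y)" using q_lift[OF HmD(2)[OF assms(2) q_closed[OF xy(2)]]] by blast
  obtain b where b: "b \<in> carrier P" "q b = g' (q w)" using q_lift[OF HmD(2)[OF assms(4) q_closed[OF w(1)]]] by blast
  have "comm a y = comm u w" using adjD[OF assms(5) u(1) xy(2) a(1) w(1) a(2) w(2)] .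
  also have "\<dots> = comm x b" using adjD[OF assms(6) xy(1) w(1) u(1) b(1) u(2) b(2)] .
  finally show "\<exists>x' \<in> carrier P. \<exists>y' \<in> carrier P. q x' = compose (carrier V) f f' (q x) \<and>
      q y' = compose (carrier V) g' g (q y) \<and> comm x' y = comm x y'"
    using a b u w xy by (intro bexI[of _ a] bexI[of _ b]) (auto simp: fn_app)
qed

lemma adj_id: "adj idf idf"
  by (rule adjI) (auto simp: fn_app)

lemma adj_zero: "adj zerof zerof"
proof (rule adjI)
  fix x y assume xy: "x \<in> carrier P" "y \<in> carrier P"
  have 1: "\<one> \<in> D" using subgroup.one_closed[OF D_subgroup] .
  have "comm \<one> y = comm x \<one>" using comm_D_one[OF 1] xy by simp
  then show "\<exists>x' \<in> carrier P. \<exists>y' \<in> carrier P.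
      q x' = zerof (q x) \<and> q y' = zerof (q y) \<and> comm x' y = comm x y'"
    using xy q_one by (intro bexI[of _ \<one>]) (auto simp: fn_app)
qed

lemma adj_pow: "adj (powf k) (powf k)"
proof (induction k)
  case 0
  have "powf 0 = zerof" by (simp add: powf_def zerof_def)
  then show ?case using adj_zero by simp
next
  case (Suc k)
  have "powf (Suc k) = addf (powf k) idf" unfolding powf_def addf_def idf_def by auto
  then show ?case using adj_add[OF powf_Hm powf_Hm idf_Hm idf_Hm Suc adj_id] by simp
qed

lemma V_pow: 
  assumes "v \<in> carrier V" shows "v [^]\<^bsub>V\<^esub> p = \<one>\<^bsub>V\<^esub>"
proof -
  obtain x where x: "x \<in> carrier P" "q x = v" using q_lift assms by blast
  have "q (x [^] k) = v [^]\<^bsub>V\<^esub> k" for k :: nat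
    by (induction k) (use x q_one q_mult in auto)
  then show ?thesis using exponent x q_one by metis
qed

lemma finV: "finite (carrier V)" using finP q_surj by (metis finite_imageI)

lemma finite_Hm: "finite Hm"
proof -
  have "Hm \<subseteq> (\<Pi>\<^sub>E x \<in> carrier V. carrier V)"
    using HmD(1,2) by (auto simp: PiE_def)
  then show ?thesis using finV finite_PiE finite_subset by metis
qed

text \<open>Exponent \<open>p\<close> turns power maps into scalars: \<open>p - 1\<close> acts as
  negation, and \<open>(p + 1) div 2\<close> as one half because its double \<open>p + 1\<close>
  acts as 1. A power map is its own adjoint, so these scalars lie in the ring.\<close>

lemma adj_ring_star_ring: "star_ring adj_ring prod.swap (powf ((p + 1) div 2), powf ((p + 1) div 2))"
proof -
  note comps = adj_ring_def partial_object.simps monoid.simps ring.simps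
  have "ring adj_ring"
  proof (rule ringI)
    show "abelian_group adj_ring"
    proof (rule abelian_groupI)
      fix x assume "x \<in> carrier adj_ring"
      then obtain f g where x: "x = (f, g)" "f \<in> Hm" "g \<in> Hm" "adj f g" by (auto simp: comps)
      define n where "n = p - 1"
      have cancel: "addf (compose (carrier V) (powf n) h) h = zerof" if "h \<in> Hm" for h
      proof (rule Hm_eqI)
        fix v assume v: "v \<in> carrier V"
        have "h v [^]\<^bsub>V\<^esub> n \<otimes>\<^bsub>V\<^esub> h v = h v [^]\<^bsub>V\<^esub> Suc n" by simp
        moreover have "Suc n = p" using p prime_gt_0_nat[of p] by (simp add: n_def)
        ultimately have "h v [^]\<^bsub>V\<^esub> n \<otimes>\<^bsub>V\<^esub> h v = \<one>\<^bsub>V\<^esub>"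
          using V_pow HmD(2)[OF that v] by metis
        then show "addf (compose (carrier V) (powf n) h) h v = zerof v"
          using v HmD(2)[OF that v] by (simp add: fn_app)
      qed (use that in \<open>auto intro: Hm_intros\<close>)
      have comm: "compose (carrier V) h (powf n) = compose (carrier V) (powf n) h" if h: "h \<in> Hm" for h
      proof (rule Hm_eqI)
        fix v assume v: "v \<in> carrier V"
        have "h (v [^]\<^bsub>V\<^esub> k) = h v [^]\<^bsub>V\<^esub> k" for k :: nat
          by (induction k) (use v HmD(2-4)[OF h] in auto)
        then show "compose (carrier V) h (powf n) v = compose (carrier V) (powf n) h v"
          using v HmD(2)[OF h v] by (simp add: fn_app)
      qed (use h in \<open>auto intro: Hm_intros\<close>)
      have "(compose (carrier V) (powf n) f, compose (carrier V) g (powf n)) \<in> carrier adj_ring"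
        using x adj_compose[OF powf_Hm powf_Hm x(2,3) adj_pow x(4)] by (auto simp: comps Hm_intros)
      then show "\<exists>y \<in> carrier adj_ring. y \<oplus>\<^bsub>adj_ring\<^esub> x = \<zero>\<^bsub>adj_ring\<^esub>"
        using x cancel[OF x(2)] cancel[OF x(3)] comm[OF x(3)]
        by (intro bexI[of _ "(compose (carrier V) (powf n) f, compose (carrier V) g (powf n))"]) (auto simp: comps)
    qed (auto simp: comps Hm_intros adj_add adj_zero intro!: Hm_eqI, (simp_all add: fn_app HmD V.m_ac Hm_intros))
    show "monoid adj_ring"
      by (rule monoidI)
        (auto simp: comps Hm_intros adj_compose adj_id intro!: Hm_eqI, (simp_all add: fn_app HmD Hm_intros))
  qed (auto simp: comps intro!: Hm_eqI Hm_intros, (simp_all add: fn_app HmD Hm_intros))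
  then interpret R: ring adj_ring .
  show ?thesis
  proof
    have "carrier adj_ring \<subseteq> Hm \<times> Hm" by (auto simp: comps)
    then show "finite (carrier adj_ring)" using finite_Hm finite_subset by blast
    have "addf (powf ((p + 1) div 2)) (powf ((p + 1) div 2)) = idf"
    proof (rule Hm_eqI)
      fix v assume v: "v \<in> carrier V"
      have "(p + 1) div 2 + (p + 1) div 2 = p + 1" using p(2) by presburger
      then have "v [^]\<^bsub>V\<^esub> ((p + 1) div 2) \<otimes>\<^bsub>V\<^esub> v [^]\<^bsub>V\<^esub> ((p + 1) div 2) = v"
        using V_pow[OF v] v by (simp only: V.nat_pow_mult) simp
      then show "addf (powf ((p + 1) div 2)) (powf ((p + 1) div 2)) v = idf v"
        using v by (simp add: fn_app)
    qed (auto intro: Hm_intros)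
    then show "(powf ((p + 1) div 2), powf ((p + 1) div 2)) \<oplus>\<^bsub>adj_ring\<^esub>
        (powf ((p + 1) div 2), powf ((p + 1) div 2)) = \<one>\<^bsub>adj_ring\<^esub>" by (simp add: comps)
  qed (auto simp: comps adj_sym adj_pow powf_Hm)
qed

end

section \<open>The frame of a fully refined decomposition\<close>

context class2_group
begin

abbreviation sub :: "'a set \<Rightarrow> ('a, 'b) monoid_scheme" where "sub H \<equiv> P\<lparr>carrier := H\<rparr>"

lemma derived_comm: "derived P H = generate P {comm x y | x y. x \<in> H \<and> y \<in> H}"
proof -
  have "derived_set P H = {comm x y | x y. x \<in> H \<and> y \<in> H}" unfolding comm_def by blast
  then show ?thesis unfolding derived_def by simp
qed

lemma derived_le_D: "H \<subseteq> carrier P \<Longrightarrow> derived P H \<subseteq> D"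
  by (rule mono_derived)

lemma derived_abelian:
  assumes "H \<subseteq> carrier P" "\<And>x y. x \<in> H \<Longrightarrow> y \<in> H \<Longrightarrow> x \<otimes> y = y \<otimes> x"
  shows "derived P H = {\<one>}"
proof -
  have "{comm x y | x y. x \<in> H \<and> y \<in> H} \<subseteq> {\<one>}"
    using assms comm_one_iff by (auto simp: subset_iff)
  then have "derived P H \<subseteq> {\<one>}" unfolding derived_comm
    using generate_subgroup_incl triv_subgroup by blast
  moreover have "\<one> \<in> derived P H" unfolding derived_comm by (rule generate.one)
  ultimately show ?thesis by blast
qed

end

locale class2_decomp = class2_group P V q p
  for P :: "('a, 'b) monoid_scheme" (structure) and V :: "('v, 'w) monoid_scheme"
    and q :: "'a \<Rightarrow> 'v" and p :: nat +
  fixes Hs :: "'a set set"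
  assumes fr: "fully_refined P Hs"
begin

lemma cd: "central_decomp P Hs" using fr by (simp add: fully_refined_def)

abbreviation "C \<equiv> cofactor Hs"

lemma H_sub: "H \<in> Hs \<Longrightarrow> subgroup H P" using central_decomp_cofactor(1)[OF cd] .
lemma H_car: "H \<in> Hs \<Longrightarrow> x \<in> H \<Longrightarrow> x \<in> carrier P" using subgroup.mem_carrier[OF H_sub] .
lemma C_sub: "H \<in> Hs \<Longrightarrow> subgroup (C H) P" using central_decomp_cofactor(2)[OF cd] .
lemma C_car: "H \<in> Hs \<Longrightarrow> x \<in> C H \<Longrightarrow> x \<in> carrier P" using subgroup.mem_carrier[OF C_sub] .
lemma HC_comm: "H \<in> Hs \<Longrightarrow> x \<in> H \<Longrightarrow> y \<in> C H \<Longrightarrow> x \<otimes> y = y \<otimes> x"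
  using central_decomp_cofactor(3)[OF cd] .
lemma HC_dec: "H \<in> Hs \<Longrightarrow> x \<in> carrier P \<Longrightarrow> \<exists>h \<in> H. \<exists>c \<in> C H. x = h \<otimes> c"
  using central_decomp_cofactor(4)[OF cd] .
lemma H_not_le: "H \<in> Hs \<Longrightarrow> \<not> H \<subseteq> C H" using central_decomp_cofactor(5)[OF cd] .

lemma member_cofactor: "K \<in> Hs \<Longrightarrow> K \<noteq> H \<Longrightarrow> K \<subseteq> C H"
  unfolding cofactor_def by (intro subsetI generate.incl) blast

lemma H_ind: "H \<in> Hs \<Longrightarrow> centrally_indecomposable (sub H)"
  using fr by (simp add: fully_refined_def)

text \<open>A central element of \<open>H\<close> outside \<open>H'\<close> generates
  \<open>H\<close> by \<open>indecomposable_center\<close>; then \<open>H\<close> is abelian and,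
  the exponent being prime, generated by each of its nontrivial elements.\<close>

lemma member_cases:
  assumes H: "H \<in> Hs"
  shows "group_center (sub H) \<subseteq> derived P H \<or>
    (\<forall>x \<in> H. \<forall>y \<in> H. x \<otimes> y = y \<otimes> x) \<and> (\<forall>x \<in> H. x \<noteq> \<one> \<longrightarrow> H \<subseteq> generate P {x})"
proof (rule disjCI)
  assume neg: "\<not> ((\<forall>x \<in> H. \<forall>y \<in> H. x \<otimes> y = y \<otimes> x) \<and> (\<forall>x \<in> H. x \<noteq> \<one> \<longrightarrow> H \<subseteq> generate P {x}))"
  show "group_center (sub H) \<subseteq> derived P H"
  proof (rule ccontr)
    assume "\<not> group_center (sub H) \<subseteq> derived P H"
    then obtain z where z: "z \<in> group_center (sub H)" "z \<notin> derived P H" by blast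
    interpret HS: subgroup H P by (rule H_sub[OF H])
    interpret S: group "sub H" using subgroup_imp_group[OF H_sub[OF H]] .
    have zH: "z \<in> H" "\<And>x. x \<in> H \<Longrightarrow> z \<otimes> x = x \<otimes> z" using z(1) by (auto simp: group_center_def)
    have "generate (sub H) {z} = carrier (sub H)"
    proof (rule S.indecomposable_center[OF H_ind[OF H] p(1)])
      show "finite (carrier (sub H))" using finP HS.subset finite_subset by auto
      show "x [^]\<^bsub>sub H\<^esub> p = \<one>\<^bsub>sub H\<^esub>" if "x \<in> carrier (sub H)" for x
        using that exponent HS.mem_carrier nat_pow_consistent[of x p H] by simp
      show "z \<in> group_center (sub H)" by fact
      show "z \<notin> derived (sub H) (carrier (sub H))"
        using z(2) derived_consistent[of H H] H_sub[OF H] by simp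
    qed
    then have gz: "generate P {z} = H" using generate_consistent[of "{z}" H] zH H_sub[OF H] by simp
    have zc: "z \<in> carrier P" using zH by simp
    have ab: "x \<otimes> y = y \<otimes> x" if "x \<in> H" "y \<in> H" for x y
      using commutes_generate[of "{z}" x y] zc zH(2)[OF that(1)] that gz by auto
    have "H \<subseteq> generate P {x}" if x: "x \<in> H" "x \<noteq> \<one>" for x
    proof -
      obtain j :: int where "z = x [^] j"
        using exponent_generate[OF p(1) zc exponent[OF zc], of x] x gz by blast
      then have "z \<in> generate P {x}" using generate_pow[of x] x HS.mem_carrier by blast
      moreover have "subgroup (generate P {x}) P" using x by (intro generate_is_subgroup) simp
      ultimately show ?thesis using generate_subgroup_incl[of "{z}" "generate P {x}"] gz by auto
    qed
    then show False using neg ab by blast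
  qed
qed

text \<open>When both arguments of a commutator are written as products over \<open>H\<close> and
  its cofactor, bilinearity removes the mixed terms and leaves one commutator in each
  factor.\<close>

lemma D_factor:
  assumes H: "H \<in> Hs" and d: "d \<in> D"
  shows "\<exists>a \<in> derived P H. \<exists>b \<in> derived P (C H). d = a \<otimes> b"
proof -
  interpret HS: subgroup H P by (rule H_sub[OF H])
  interpret CS: subgroup "C H" P by (rule C_sub[OF H])
  have sH: "subgroup (derived P H) P" and sC: "subgroup (derived P (C H)) P"
    using derived_is_subgroup HS.subset CS.subset by auto
  have lH: "derived P H \<subseteq> D" and lC: "derived P (C H) \<subseteq> D"
    using derived_le_D HS.subset CS.subset by auto
  have "d \<in> generate P {comm x y | x y. x \<in> carrier P \<and> y \<in> carrier P}"
    using d derived_comm[of "carrier P"] by simp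
  then show ?thesis
  proof (induction rule: generate.induct)
    case one
    then show ?case using subgroup.one_closed[OF sH] subgroup.one_closed[OF sC] by (metis l_one one_closed)
  next
    case (incl d)
    then obtain x y where xy: "x \<in> carrier P" "y \<in> carrier P" "d = comm x y" by blast
    obtain h c where hc: "h \<in> H" "c \<in> C H" "x = h \<otimes> c" using HC_dec[OF H xy(1)] by blast
    obtain h' c' where hc': "h' \<in> H" "c' \<in> C H" "y = h' \<otimes> c'" using HC_dec[OF H xy(2)] by blast
    have z: "comm h c' = \<one>" "comm c h' = \<one>"
      using HC_comm[OF H] hc hc' comm_one_iff by (auto simp: HC_comm[OF H hc'(1) hc(2)])
    have "d = comm h h' \<otimes> comm c c'" unfolding xy(3) hc(3) hc'(3)
      using hc hc' z by (simp add: comm_mult_l comm_mult_r)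
    moreover have "comm h h' \<in> derived P H" "comm c c' \<in> derived P (C H)"
      unfolding derived_comm using hc hc' by (auto intro!: generate.incl)
    ultimately show ?case by blast
  next
    case (inv d)
    then obtain x y where xy: "x \<in> carrier P" "y \<in> carrier P" "d = comm x y" by blast
    obtain h c where hc: "h \<in> H" "c \<in> C H" "x = h \<otimes> c" using HC_dec[OF H xy(1)] by blast
    obtain h' c' where hc': "h' \<in> H" "c' \<in> C H" "y = h' \<otimes> c'" using HC_dec[OF H xy(2)] by blast
    have z: "comm h' c = \<one>" "comm c' h = \<one>"
      using HC_comm[OF H] hc hc' comm_one_iff by (auto simp: HC_comm[OF H hc(1) hc'(2)])
    have "inv d = comm y x" using xy comm_inv[of x y] by simp
    also have "\<dots> = comm h' h \<otimes> comm c' c" unfolding hc(3) hc'(3)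
      using hc hc' z by (simp add: comm_mult_l comm_mult_r)
    finally have "inv d = comm h' h \<otimes> comm c' c" .
    moreover have "comm h' h \<in> derived P H" "comm c' c \<in> derived P (C H)"
      unfolding derived_comm using hc hc' by (auto intro!: generate.incl)
    ultimately show ?case by blast
  next
    case (eng d e)
    then obtain a b a' b' where ab: "a \<in> derived P H" "b \<in> derived P (C H)" "d = a \<otimes> b"
      "a' \<in> derived P H" "b' \<in> derived P (C H)" "e = a' \<otimes> b'" by blast
    then have c: "a \<in> carrier P" "b \<in> carrier P" "a' \<in> carrier P" "b' \<in> carrier P"
      using D_carrier lH lC by blast+
    have "b \<otimes> a' = a' \<otimes> b" using D_central ab(2) lC c(3) by blast
    then have "d \<otimes> e = (a \<otimes> a') \<otimes> (b \<otimes> b')" unfolding ab(3,6)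
      using c by (metis m_assoc m_closed)
    then show ?case using ab subgroup.m_closed[OF sH] subgroup.m_closed[OF sC] by blast
  qed
qed

text \<open>If \<open>h\<close> and \<open>c\<close> agree modulo \<open>D\<close>, shifting the
  \<open>H'\<close>-part of their difference to \<open>h\<close> yields an element \<open>w\<close>
  of both factors with the same image as \<open>h\<close>. It is central in \<open>H\<close>, so it
  lies in \<open>H'\<close> or, being a generator of \<open>H\<close> unless trivial, it would put
  \<open>H\<close> inside the cofactor.\<close>

lemma direct:
  assumes H: "H \<in> Hs" and h: "h \<in> H" and c: "c \<in> C H" and hc: "q h = q c"
  shows "q h = \<one>\<^bsub>V\<^esub>"
proof -
  interpret HS: subgroup H P by (rule H_sub[OF H])
  interpret CS: subgroup "C H" P by (rule C_sub[OF H])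
  have lH: "derived P H \<subseteq> D" and lC: "derived P (C H) \<subseteq> D"
    using derived_le_D HS.subset CS.subset by auto
  have iH: "derived P H \<subseteq> H" and iC: "derived P (C H) \<subseteq> C H"
    using derived_incl[OF _ H_sub[OF H]] derived_incl[OF _ C_sub[OF H]] by auto
  obtain d where d: "d \<in> D" "h = c \<otimes> d" using q_eqD[of c h] h c hc by auto
  obtain a b where ab: "a \<in> derived P H" "b \<in> derived P (C H)" "d = a \<otimes> b"
    using D_factor[OF H d(1)] by blast
  have ac: "a \<in> carrier P" "b \<in> carrier P" "a \<in> D" "b \<in> D" using ab lH lC D_carrier by blast+
  define w where "w = h \<otimes> inv a"
  have wH: "w \<in> H" unfolding w_def using h ab iH by blast
  have "w = c \<otimes> (a \<otimes> b) \<otimes> inv a" unfolding w_def d(2) ab(3) ..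
  also have "\<dots> = c \<otimes> (b \<otimes> a) \<otimes> inv a" using D_central[OF ac(3,2)] by simp
  also have "\<dots> = c \<otimes> b" using c ac by (simp add: m_assoc)
  finally have wC: "w \<in> C H" using c ab iC by blast
  have "h = w \<otimes> a" unfolding w_def using h ac by (simp add: m_assoc)
  then have qh: "q h = q w" using q_mult[of w a] q_D[OF ac(3)] wH ac by simp
  have wz: "w \<in> group_center (sub H)" unfolding group_center_def
    using wH HC_comm[OF H _ wC] by auto
  show ?thesis
  proof (rule disjE[OF member_cases[OF H]])
    assume "group_center (sub H) \<subseteq> derived P H"
    then show ?thesis using wz lH q_D qh by auto
  next
    assume a: "(\<forall>x \<in> H. \<forall>y \<in> H. x \<otimes> y = y \<otimes> x) \<and> (\<forall>x \<in> H. x \<noteq> \<one> \<longrightarrow> H \<subseteq> generate P {x})"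
    have "w = \<one>"
    proof (rule ccontr)
      assume "w \<noteq> \<one>"
      then have "H \<subseteq> generate P {w}" using a wH by blast
      also have "\<dots> \<subseteq> C H" using generate_subgroup_incl[OF _ C_sub[OF H]] wC by blast
      finally show False using H_not_le[OF H] by blast
    qed
    then show ?thesis using qh q_one by simp
  qed
qed

text \<open>A member inside \<open>D\<close> is abelian, so all of \<open>D\<close> is already the
  derived subgroup of the cofactor, and the cofactor would contain \<open>H\<close>.\<close>

lemma nontriv:
  assumes H: "H \<in> Hs" shows "\<exists>h \<in> H. q h \<noteq> \<one>\<^bsub>V\<^esub>"
proof (rule ccontr)
  assume "\<not> ?thesis"
  then have HD: "H \<subseteq> D" using q_ker H_car[OF H] by auto
  have "derived P H = {\<one>}" 
    by (rule derived_abelian) (use HD D_central H_car[OF H] in blast)+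
  have "D \<subseteq> derived P (C H)"
  proof
    fix d assume "d \<in> D"
    then obtain a b where ab: "a \<in> derived P H" "b \<in> derived P (C H)" "d = a \<otimes> b"
      using D_factor[OF H] by blast
    then have "b \<in> carrier P"
      using derived_le_D[OF subgroup.subset[OF C_sub[OF H]]] D_carrier by blast
    then show "d \<in> derived P (C H)" using ab \<open>derived P H = {\<one>}\<close> by simp
  qed
  also have "\<dots> \<subseteq> C H" using derived_incl[OF _ C_sub[OF H]] by auto
  finally show False using HD H_not_le[OF H] by blast
qed

text \<open>The projection of \<open>V\<close> onto the image of \<open>H\<close> along the image of
  the cofactor; \<open>direct\<close> makes the description unambiguous.\<close>

definition pr :: "'a set \<Rightarrow> 'v \<Rightarrow> 'v" where
  "pr H = (\<lambda>v \<in> carrier V. THE w. \<exists>h \<in> H. \<exists>c \<in> C H. v = q (h \<otimes> c) \<and> w = q h)"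

lemma pr_eq:
  assumes H: "H \<in> Hs" and h: "h \<in> H" and c: "c \<in> C H"
  shows "pr H (q (h \<otimes> c)) = q h"
proof -
  interpret HS: subgroup H P by (rule H_sub[OF H])
  interpret CS: subgroup "C H" P by (rule C_sub[OF H])
  have "(THE w. \<exists>h' \<in> H. \<exists>c' \<in> C H. q (h \<otimes> c) = q (h' \<otimes> c') \<and> w = q h') = q h"
  proof (rule the_equality)
    fix w assume "\<exists>h' \<in> H. \<exists>c' \<in> C H. q (h \<otimes> c) = q (h' \<otimes> c') \<and> w = q h'"
    then obtain h' c' where h': "h' \<in> H" "c' \<in> C H" "q (h \<otimes> c) = q (h' \<otimes> c')" "w = q h'" by blast
    have "q h \<otimes>\<^bsub>V\<^esub> q c = q h' \<otimes>\<^bsub>V\<^esub> q c'" using h' h c q_mult by simp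
    then have "inv\<^bsub>V\<^esub> q h' \<otimes>\<^bsub>V\<^esub> q h = q c' \<otimes>\<^bsub>V\<^esub> inv\<^bsub>V\<^esub> q c"
      using h' h c by (metis CS.mem_carrier HS.mem_carrier V.inv_closed V.inv_solve_left V.inv_solve_right
          V.m_assoc V.m_closed q_closed)
    then have "q (inv h' \<otimes> h) = q (c' \<otimes> inv c)" using h' h c by (simp add: q_mult q_inv)
    then have "q (inv h' \<otimes> h) = \<one>\<^bsub>V\<^esub>" using direct[OF H, of "inv h' \<otimes> h" "c' \<otimes> inv c"] h' h c by blast
    then have "inv\<^bsub>V\<^esub> q h' \<otimes>\<^bsub>V\<^esub> q h = \<one>\<^bsub>V\<^esub>" using h' h by (simp add: q_mult q_inv)
    then show "w = q h" using h'(1,4) h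
      by (metis HS.mem_carrier V.inv_closed V.inv_equality V.inv_inv q_closed)
  qed (use h c in blast)
  then show ?thesis unfolding pr_def using h c by simp
qed

lemma pr_H: "H \<in> Hs \<Longrightarrow> h \<in> H \<Longrightarrow> pr H (q h) = q h"
  using pr_eq[of H h \<one>] subgroup.one_closed[OF C_sub] H_car by simp

lemma pr_C: "H \<in> Hs \<Longrightarrow> c \<in> C H \<Longrightarrow> pr H (q c) = \<one>\<^bsub>V\<^esub>"
  using pr_eq[of H \<one> c] subgroup.one_closed[OF H_sub] C_car q_one by simp

lemma V_dec:
  assumes H: "H \<in> Hs" and v: "v \<in> carrier V"
  shows "\<exists>h \<in> H. \<exists>c \<in> C H. v = q (h \<otimes> c)"
proof -
  obtain x where "x \<in> carrier P" "q x = v" using q_lift v by blast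
  then show ?thesis using HC_dec[OF H, of x] by metis
qed

lemma pr_in: "H \<in> Hs \<Longrightarrow> v \<in> carrier V \<Longrightarrow> \<exists>h \<in> H. pr H v = q h"
  using V_dec pr_eq by metis

lemma pr_Hm:
  assumes H: "H \<in> Hs" shows "pr H \<in> Hm"
proof (rule HmI)
  interpret HS: subgroup H P by (rule H_sub[OF H])
  interpret CS: subgroup "C H" P by (rule C_sub[OF H])
  show "pr H \<in> extensional (carrier V)" unfolding pr_def by simp
  show "pr H v \<in> carrier V" if "v \<in> carrier V" for v using pr_in[OF H that] by auto
  fix v w assume vw: "v \<in> carrier V" "w \<in> carrier V"
  obtain h c where v: "h \<in> H" "c \<in> C H" "v = q (h \<otimes> c)" using V_dec[OF H vw(1)] by blast
  obtain h' c' where w: "h' \<in> H" "c' \<in> C H" "w = q (h' \<otimes> c')" using V_dec[OF H vw(2)] by blast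
  have "(h \<otimes> c) \<otimes> (h' \<otimes> c') = h \<otimes> (c \<otimes> h') \<otimes> c'" using v w by (simp add: m_assoc)
  also have "\<dots> = h \<otimes> (h' \<otimes> c) \<otimes> c'" using HC_comm[OF H w(1) v(2)] by simp
  also have "\<dots> = (h \<otimes> h') \<otimes> (c \<otimes> c')" using v w by (simp add: m_assoc)
  finally have "q ((h \<otimes> h') \<otimes> (c \<otimes> c')) = q ((h \<otimes> c) \<otimes> (h' \<otimes> c'))" by simp
  also have "\<dots> = v \<otimes>\<^bsub>V\<^esub> w" unfolding v(3) w(3) by (rule q_mult) (use v w in auto)
  finally have vw': "v \<otimes>\<^bsub>V\<^esub> w = q ((h \<otimes> h') \<otimes> (c \<otimes> c'))" ..
  have "pr H (v \<otimes>\<^bsub>V\<^esub> w) = q (h \<otimes> h')" unfolding vw' by (rule pr_eq[OF H]) (use v w in auto)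
  also have "\<dots> = q h \<otimes>\<^bsub>V\<^esub> q h'" using v w by (intro q_mult) auto
  also have "q h = pr H v" unfolding v(3) using pr_eq[OF H v(1,2)] ..
  also have "q h' = pr H w" unfolding w(3) using pr_eq[OF H w(1,2)] ..
  finally show "pr H (v \<otimes>\<^bsub>V\<^esub> w) = pr H v \<otimes>\<^bsub>V\<^esub> pr H w" .
qed

lemma pr_adj:
  assumes H: "H \<in> Hs" shows "adj (pr H) (pr H)"
proof (rule adjI)
  interpret HS: subgroup H P by (rule H_sub[OF H])
  interpret CS: subgroup "C H" P by (rule C_sub[OF H])
  fix x y assume xy: "x \<in> carrier P" "y \<in> carrier P"
  obtain h c where hc: "h \<in> H" "c \<in> C H" "x = h \<otimes> c" using HC_dec[OF H xy(1)] by blast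
  obtain h' c' where hc': "h' \<in> H" "c' \<in> C H" "y = h' \<otimes> c'" using HC_dec[OF H xy(2)] by blast
  have z: "comm h c' = \<one>" "comm c h' = \<one>"
    using hc hc' comm_one_iff HC_comm[OF H hc(1) hc'(2)] HC_comm[OF H hc'(1) hc(2)] by auto
  have "comm h y = comm h h'" "comm x h' = comm h h'" unfolding hc hc'
    using hc hc' z by (simp_all add: comm_mult_l comm_mult_r)
  then show "\<exists>x' \<in> carrier P. \<exists>y' \<in> carrier P.
      q x' = pr H (q x) \<and> q y' = pr H (q y) \<and> comm x' y = comm x y'"
    using hc hc' pr_eq[OF H] by (intro bexI[of _ h] bexI[of _ h']) auto
qed

definition proj :: "'a set \<Rightarrow> ('v \<Rightarrow> 'v) \<times> ('v \<Rightarrow> 'v)" where "proj H = (pr H, pr H)"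

lemmas comps = adj_ring_def partial_object.simps monoid.simps ring.simps

lemma proj_carrier: "H \<in> Hs \<Longrightarrow> proj H \<in> carrier adj_ring"
  using pr_Hm pr_adj by (simp add: proj_def comps)

lemma proj_idem: 
  assumes H: "H \<in> Hs" shows "proj H \<otimes>\<^bsub>adj_ring\<^esub> proj H = proj H"
proof -
  have "compose (carrier V) (pr H) (pr H) = pr H"
  proof (rule Hm_eqI)
    fix v assume v: "v \<in> carrier V"
    then obtain h where "h \<in> H" "pr H v = q h" using pr_in[OF H] by blast
    then show "compose (carrier V) (pr H) (pr H) v = pr H v" using v pr_H[OF H] by (simp add: fn_app)
  qed (use pr_Hm[OF H] compose_Hm in auto)
  then show ?thesis by (simp add: proj_def comps)
qed

lemma proj_orth: 
  assumes H: "H \<in> Hs" and K: "K \<in> Hs" and ne: "H \<noteq> K"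
  shows "proj H \<otimes>\<^bsub>adj_ring\<^esub> proj K = \<zero>\<^bsub>adj_ring\<^esub>"
proof -
  have *: "compose (carrier V) (pr H) (pr K) = zerof"
    if HK: "H \<in> Hs" "K \<in> Hs" "H \<noteq> K" for H K
  proof (rule Hm_eqI)
    fix v assume v: "v \<in> carrier V"
    then obtain k where "k \<in> K" "pr K v = q k" using pr_in[OF HK(2)] by blast
    then show "compose (carrier V) (pr H) (pr K) v = zerof v"
      using v pr_C[OF HK(1)] member_cofactor[OF HK(2)] HK(3) by (auto simp: fn_app)
  qed (use pr_Hm HK compose_Hm zerof_Hm in auto)
  show ?thesis using *[OF H K ne] *[OF K H] ne by (simp add: proj_def comps)
qed

lemma finHs: "finite Hs"
proof -
  have "Hs \<subseteq> Pow (carrier P)" using H_car by blast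
  then show ?thesis using finP finite_subset by auto
qed

end

sublocale class2_group \<subseteq> A: star_ring adj_ring prod.swap "(powf ((p + 1) div 2), powf ((p + 1) div 2))"
  by (rule adj_ring_star_ring)

context class2_decomp
begin

text \<open>The partial sum over \<open>S\<close> is tracked by its values on the images of the
  members: the identity on those in \<open>S\<close>, trivial on the rest. The full sum is thus the
  identity on generators.\<close>

lemma proj_sum: "finsum adj_ring proj Hs = \<one>\<^bsub>adj_ring\<^esub>"
proof -
  have "S \<subseteq> Hs \<Longrightarrow> \<exists>f \<in> Hm. finsum adj_ring proj S = (f, f) \<and>
      (\<forall>H \<in> Hs. \<forall>h \<in> H. f (q h) = (if H \<in> S then q h else \<one>\<^bsub>V\<^esub>))" if "finite S" for S
    using that
  proof (induction S)
    case empty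
    have "finsum adj_ring proj {} = \<zero>\<^bsub>adj_ring\<^esub>" by simp
    then have "finsum adj_ring proj {} = (zerof, zerof)" by (simp add: comps)
    then show ?case using zerof_Hm H_car by (auto simp: fn_app)
  next
    case (insert K S)
    then obtain f where f: "f \<in> Hm" "finsum adj_ring proj S = (f, f)"
      "\<forall>H \<in> Hs. \<forall>h \<in> H. f (q h) = (if H \<in> S then q h else \<one>\<^bsub>V\<^esub>)" by auto
    have K: "K \<in> Hs" using insert by simp
    have "finsum adj_ring proj (insert K S) = proj K \<oplus>\<^bsub>adj_ring\<^esub> finsum adj_ring proj S"
      using insert proj_carrier by (intro A.finsum_insert) auto
    then have 1: "finsum adj_ring proj (insert K S) = (addf (pr K) f, addf (pr K) f)"
      using f(2) by (simp add: proj_def comps)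
    have "addf (pr K) f (q h) = (if H \<in> insert K S then q h else \<one>\<^bsub>V\<^esub>)" if H: "H \<in> Hs" "h \<in> H" for H h
    proof (cases "H = K")
      case True
      then show ?thesis using pr_H[OF K] f(3) H insert H_car[OF H] by (auto simp: fn_app)
    next
      case False
      then have "pr K (q h) = \<one>\<^bsub>V\<^esub>" using pr_C[OF K] member_cofactor[OF H(1)] H by blast
      then show ?thesis using False f(3) H H_car[OF H] by (auto simp: fn_app)
    qed
    then show ?case using 1 addf_Hm[OF pr_Hm[OF K] f(1)] by (intro bexI[of _ "addf (pr K) f"]) auto
  qed
  from this[OF finHs] obtain f where f: "f \<in> Hm" "finsum adj_ring proj Hs = (f, f)"
    "\<forall>H \<in> Hs. \<forall>h \<in> H. f (q h) = q h" by auto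
  have sc: "\<Union> Hs \<subseteq> carrier P" using H_car by blast
  have f_inv: "f (inv\<^bsub>V\<^esub> v) = inv\<^bsub>V\<^esub> f v" if "v \<in> carrier V" for v
    using that HmD[OF f(1)] by (metis V.inv_closed V.inv_equality V.l_inv)
  have "f (q x) = q x" if "x \<in> generate P (\<Union> Hs)" for x
    using that
  proof (induction rule: generate.induct)
    case (inv h)
    then have "h \<in> carrier P" "f (q h) = q h" using f(3) sc by auto
    then show ?case using f_inv by (simp add: q_inv)
  next
    case (eng a b)
    then have "a \<in> carrier P" "b \<in> carrier P" using generate_in_carrier[OF sc] by auto
    then show ?case using eng.IH HmD(3)[OF f(1)] by (simp add: q_mult)
  qed (use f HmD(4)[OF f(1)] q_one in auto)
  then have "f (q x) = q x" if "x \<in> carrier P" for x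
    using that cd by (simp add: central_decomp_def)
  then have "f = idf" using q_lift
    by (intro Hm_eqI[OF f(1) idf_Hm]) (metis fn_app(2))
  then show ?thesis using f(2) by (simp add: comps)
qed

text \<open>A self-adjoint idempotent \<open>f\<close> below the projection cuts \<open>H\<close>
  into the preimages of its fixed space and of its kernel. For \<open>x\<close> fixed and
  \<open>y\<close> killed, \<open>[x, y] = [f x, y] = [x, f y] = 1\<close>, so the two parts commute
  and indecomposability makes one of them all of \<open>H\<close>.\<close>

lemma proj_primitive:
  assumes H: "H \<in> Hs" shows "sa_primitive adj_ring prod.swap (proj H)"
  unfolding sa_primitive_def
proof (intro conjI ballI impI)
  interpret HS: subgroup H P by (rule H_sub[OF H])
  show "proj H \<in> carrier adj_ring" by (rule proj_carrier[OF H])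
  show "proj H \<otimes>\<^bsub>adj_ring\<^esub> proj H = proj H" by (rule proj_idem[OF H])
  show "prod.swap (proj H) = proj H" by (simp add: proj_def)
  show "proj H \<noteq> \<zero>\<^bsub>adj_ring\<^esub>"
  proof
    assume "proj H = \<zero>\<^bsub>adj_ring\<^esub>"
    then have "pr H = zerof" by (simp add: proj_def comps)
    moreover obtain h where "h \<in> H" "q h \<noteq> \<one>\<^bsub>V\<^esub>" using nontriv[OF H] by blast
    ultimately show False using pr_H[OF H, of h] by (simp add: fn_app)
  qed
  fix g assume g: "g \<in> carrier adj_ring" "g \<otimes>\<^bsub>adj_ring\<^esub> g = g" "prod.swap g = g" "proj H \<otimes>\<^bsub>adj_ring\<^esub> g = g"
  define f where "f = fst g"
  have "snd g = fst g" using g(3) by (metis fst_swap)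
  then have gf: "g = (f, f)" by (simp add: f_def prod_eq_iff)
  have f: "f \<in> Hm" "adj f f" "compose (carrier V) f f = f" "compose (carrier V) (pr H) f = f"
    "compose (carrier V) f (pr H) = f"
    using g(1,2,4)[unfolded gf] by (simp_all add: proj_def comps)
  have app: "f (f v) = f v" "pr H (f v) = f v" "f (pr H v) = f v" if "v \<in> carrier V" for v
    using that f(3-5) fn_app(5)[OF that] by metis+
  have f_inv: "f (inv\<^bsub>V\<^esub> v) = inv\<^bsub>V\<^esub> f v" if "v \<in> carrier V" for v
    using that HmD[OF f(1)] by (metis V.inv_closed V.inv_equality V.l_inv)
  define A where "A = {x \<in> H. f (q x) = q x}"
  define B where "B = {x \<in> H. f (q x) = \<one>\<^bsub>V\<^esub>}"
  have f1: "f \<one>\<^bsub>V\<^esub> = \<one>\<^bsub>V\<^esub>" using HmD(4)[OF f(1)] .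
  have "\<exists>x. x \<in> H \<and> f (q x) = q x" using f1 HS.one_closed q_one by metis
  then have sA: "subgroup A P"
    by (intro subgroupI) (use f1 f_inv HmD(3)[OF f(1)] HS.one_closed in \<open>auto simp: A_def q_one q_inv q_mult\<close>)
  have "\<exists>x. x \<in> H \<and> f (q x) = \<one>\<^bsub>V\<^esub>" using f1 HS.one_closed q_one by metis
  then have sB: "subgroup B P"
    by (intro subgroupI) (use f1 f_inv HmD(3)[OF f(1)] HS.one_closed in \<open>auto simp: B_def q_one q_inv q_mult\<close>)
  interpret S: group "sub H" using subgroup_imp_group[OF H_sub[OF H]] .
  have "A = carrier (sub H) \<or> B = carrier (sub H)"
  proof (rule S.indecomposable_two_factors[OF H_ind[OF H]])
    show "subgroup A (sub H)" "subgroup B (sub H)"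
      using subgroup_incl sA sB H_sub[OF H] by (auto simp: A_def B_def)
    show "x \<otimes>\<^bsub>sub H\<^esub> y = y \<otimes>\<^bsub>sub H\<^esub> x" if xy: "x \<in> A" "y \<in> B" for x y
    proof -
      have c: "x \<in> carrier P" "y \<in> carrier P" using xy by (auto simp: A_def B_def)
      have "comm x y = comm x \<one>"
        by (rule adjD[OF f(2) c c(1) one_closed]) (use xy in \<open>auto simp: A_def B_def q_one\<close>)
      then have "comm x y = \<one>" using comm_D_one(2)[OF subgroup.one_closed[OF D_subgroup] c(1)] by simp
      then show ?thesis using comm_one_iff c by simp
    qed
    show "\<exists>a \<in> A. \<exists>b \<in> B. x = a \<otimes>\<^bsub>sub H\<^esub> b" if "x \<in> carrier (sub H)" for x
    proof -
      have x: "x \<in> H" "x \<in> carrier P" using that by auto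
      have "f (q x) \<in> carrier V" using HmD(2)[OF f(1)] x by simp
      then obtain a where a: "a \<in> H" "f (q x) = q a"
        using pr_in[OF H, of "f (q x)"] app(2)[of "q x"] x by auto
      have aA: "a \<in> A" using a app(1)[of "q x"] x by (simp add: A_def)
      have "f (q (inv a \<otimes> x)) = inv\<^bsub>V\<^esub> (q a) \<otimes>\<^bsub>V\<^esub> q a"
        using a x f_inv HmD(3)[OF f(1)] aA by (simp add: q_mult q_inv A_def)
      then have "inv a \<otimes> x \<in> B" using a x by (simp add: B_def)
      moreover have "x = a \<otimes> (inv a \<otimes> x)" using a x inv_cancel by simp
      ultimately show ?thesis using aA by auto
    qed
  qed
  then show "g = \<zero>\<^bsub>adj_ring\<^esub> \<or> g = proj H"
  proof
    assume "A = carrier (sub H)"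
    then have fq: "f (q h) = q h" if "h \<in> H" for h using that by (auto simp: A_def)
    have "f = pr H"
    proof (rule Hm_eqI[OF f(1) pr_Hm[OF H]])
      fix v assume v: "v \<in> carrier V"
      then obtain h where "h \<in> H" "pr H v = q h" using pr_in[OF H] by blast
      then show "f v = pr H v" using app(3)[OF v] fq by simp
    qed
    then show ?thesis using gf by (simp add: proj_def)
  next
    assume "B = carrier (sub H)"
    then have fq: "f (q h) = \<one>\<^bsub>V\<^esub>" if "h \<in> H" for h using that by (auto simp: B_def)
    have "f = zerof"
    proof (rule Hm_eqI[OF f(1) zerof_Hm])
      fix v assume v: "v \<in> carrier V"
      then obtain h where "h \<in> H" "pr H v = q h" using pr_in[OF H] by blast
      then show "f v = zerof v" using app(3)[OF v] fq v by (simp add: fn_app)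
    qed
    then show ?thesis using gf by (simp add: comps)
  qed
qed

lemma proj_inj: "inj_on proj Hs"
proof (rule inj_onI, rule ccontr)
  fix H K assume HK: "H \<in> Hs" "K \<in> Hs" "proj H = proj K" "H \<noteq> K"
  then have "proj H = \<zero>\<^bsub>adj_ring\<^esub>" using proj_orth proj_idem by metis
  then show False using A.sa_primitiveD(4)[OF proj_primitive[OF HK(1)]] by blast
qed

lemma proj_frame: "sa_frame adj_ring prod.swap (proj ` Hs)"
  unfolding sa_frame_def
proof (intro conjI ballI impI)
  show "finite (proj ` Hs)" using finHs by simp
  show "finsum adj_ring (\<lambda>e. e) (proj ` Hs) = \<one>\<^bsub>adj_ring\<^esub>"
    using A.finsum_reindex[of "\<lambda>e. e" proj Hs] proj_inj proj_sum proj_carrier by auto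
qed (use proj_primitive proj_orth in blast)+

end

section \<open>Orders of members from the class of their idempotent\<close>

context class2_group
begin

text \<open>The subgroup \<open>[V, e V]\<close>, formed in \<open>P\<close>; for the projection of
  a member \<open>H\<close> it turns out to be \<open>H'\<close>.\<close>

definition dspan :: "('v \<Rightarrow> 'v) \<times> ('v \<Rightarrow> 'v) \<Rightarrow> 'a set" where
  "dspan e = generate P {comm x y | x y. x \<in> carrier P \<and> y \<in> carrier P \<and> q y \<in> fst e ` carrier V}"

text \<open>Since \<open>e = x y\<close>, a commutator \<open>[u, x y v]\<close> equals
  \<open>[x* u, y v]\<close> with \<open>x*\<close> the adjoint of \<open>x\<close>, and
  \<open>y v\<close> lies in \<open>f V\<close>.\<close>

lemma dspan_mono:
  assumes "x \<in> carrier adj_ring" "y \<in> carrier adj_ring" "f \<in> carrier adj_ring"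
    "x \<otimes>\<^bsub>adj_ring\<^esub> y = e" "f \<otimes>\<^bsub>adj_ring\<^esub> y = y"
  shows "dspan e \<subseteq> dspan f"
proof -
  obtain x1 x2 y1 y2 f1 f2 where xy: "x = (x1, x2)" "y = (y1, y2)" "f = (f1, f2)" by (metis surj_pair)
  have h: "x1 \<in> Hm" "x2 \<in> Hm" "adj x1 x2" "y1 \<in> Hm" "f1 \<in> Hm"
    using assms(1-3) unfolding xy by (auto simp: adj_ring_def)
  have e: "fst e = compose (carrier V) x1 y1" and fy: "compose (carrier V) f1 y1 = y1"
    using assms(4,5) unfolding xy by (auto simp: adj_ring_def)
  have "comm u w \<in> {comm x y | x y. x \<in> carrier P \<and> y \<in> carrier P \<and> q y \<in> fst f ` carrier V}"
    if uw: "u \<in> carrier P" "w \<in> carrier P" "q w \<in> fst e ` carrier V" for u w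
  proof -
    obtain v where v: "v \<in> carrier V" "q w = x1 (y1 v)" using uw(3) e by (auto simp: fn_app)
    have yv: "y1 v \<in> carrier V" using HmD(2)[OF h(4) v(1)] .
    obtain z where z: "z \<in> carrier P" "q z = y1 v" using q_lift[OF yv] by blast
    obtain u' where u': "u' \<in> carrier P" "q u' = x2 (q u)"
      using q_lift[OF HmD(2)[OF h(2) q_closed[OF uw(1)]]] by blast
    have "comm w u = comm z u'"
      by (rule adjD[OF h(3) z(1) uw(1) uw(2) u'(1)]) (use v z u' in auto)
    then have "comm u w = comm u' z" using comm_inv[of w u] comm_inv[of z u'] uw z u' by simp
    moreover have "q z \<in> fst f ` carrier V"
      using z(2) fy v(1) yv fn_app(5)[OF v(1), of f1 y1] xy by (metis fst_conv imageI)
    ultimately show ?thesis using u'(1) z(1) by blast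
  qed
  then show ?thesis unfolding dspan_def by (intro mono_generate) blast
qed

text \<open>The map \<open>y\<close> sends \<open>e V\<close> into \<open>f V\<close> and has
  \<open>x\<close> as a left inverse there.\<close>

lemma image_card:
  assumes "x \<in> carrier adj_ring" "y \<in> carrier adj_ring" "e \<in> carrier adj_ring" "f \<in> carrier adj_ring"
    "x \<otimes>\<^bsub>adj_ring\<^esub> y = e" "f \<otimes>\<^bsub>adj_ring\<^esub> y = y" "e \<otimes>\<^bsub>adj_ring\<^esub> e = e"
  shows "card (fst e ` carrier V) \<le> card (fst f ` carrier V)"
proof -
  obtain x1 x2 y1 y2 e1 e2 f1 f2 where xy: "x = (x1, x2)" "y = (y1, y2)" "e = (e1, e2)" "f = (f1, f2)"
    by (metis surj_pair)
  have h: "x1 \<in> Hm" "y1 \<in> Hm" "e1 \<in> Hm" "f1 \<in> Hm"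
    using assms(1-4) unfolding xy by (auto simp: adj_ring_def)
  have c: "compose (carrier V) x1 y1 = e1" "compose (carrier V) f1 y1 = y1" "compose (carrier V) e1 e1 = e1"
    using assms(5-7) unfolding xy by (auto simp: adj_ring_def)
  have a: "x1 (y1 v) = e1 v" "f1 (y1 v) = y1 v" "e1 (e1 v) = e1 v" if "v \<in> carrier V" for v
    using c fn_app(5)[OF that] by metis+
  have ev: "e1 v \<in> carrier V" if "v \<in> carrier V" for v using HmD(2)[OF h(3) that] .
  have "inj_on y1 (e1 ` carrier V)"
    by (rule inj_on_inverseI[of _ x1]) (use a ev in auto)
  moreover have "y1 ` e1 ` carrier V \<subseteq> f1 ` carrier V"
  proof
    fix w assume "w \<in> y1 ` e1 ` carrier V"
    then obtain v where v: "v \<in> carrier V" "w = y1 (e1 v)" by blast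
    then have "w = f1 (y1 (e1 v))" using a(2)[OF ev[OF v(1)]] by simp
    then show "w \<in> f1 ` carrier V" using HmD(2)[OF h(2) ev[OF v(1)]] by blast
  qed
  ultimately show ?thesis unfolding xy using finV by (simp add: card_inj_on_le)
qed

definition "decomp_data e = (card (fst e ` carrier V), card (dspan e))"

lemma decomp_data_equiv:
  assumes "idem_equiv adj_ring e f" "e \<in> carrier adj_ring" "f \<in> carrier adj_ring"
    "e \<otimes>\<^bsub>adj_ring\<^esub> e = e" "f \<otimes>\<^bsub>adj_ring\<^esub> f = f"
  shows "decomp_data e = decomp_data f"
proof -
  obtain x y where 1: "x \<in> carrier adj_ring" "y \<in> carrier adj_ring"
    "e \<otimes>\<^bsub>adj_ring\<^esub> x = x" "f \<otimes>\<^bsub>adj_ring\<^esub> y = y" "x \<otimes>\<^bsub>adj_ring\<^esub> y = e" "y \<otimes>\<^bsub>adj_ring\<^esub> x = f"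
    using assms(1) unfolding idem_equiv_def by blast
  have "dspan e = dspan f"
    using dspan_mono[OF 1(1,2) assms(3) 1(5,4)] dspan_mono[OF 1(2,1) assms(2) 1(6,3)] by blast
  moreover have "card (fst e ` carrier V) = card (fst f ` carrier V)"
    using image_card[OF 1(1,2) assms(2,3) 1(5,4) assms(4)]
      image_card[OF 1(2,1) assms(3,2) 1(6,3) assms(5)] by simp
  ultimately show ?thesis by (simp add: decomp_data_def)
qed

end

context class2_decomp
begin

lemma pr_image: 
  assumes H: "H \<in> Hs" shows "pr H ` carrier V = q ` H"
proof
  show "pr H ` carrier V \<subseteq> q ` H" using pr_in[OF H] by blast
  show "q ` H \<subseteq> pr H ` carrier V"
  proof
    fix v assume "v \<in> q ` H"
    then obtain h where h: "h \<in> H" "v = q h" by blast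
    then have "v = pr H (q h)" using pr_H[OF H] by simp
    then show "v \<in> pr H ` carrier V" using H_car[OF H h(1)] by simp
  qed
qed

lemma dspan_proj:
  assumes H: "H \<in> Hs" shows "dspan (proj H) = derived P H"
proof -
  interpret HS: subgroup H P by (rule H_sub[OF H])
  interpret CS: subgroup "C H" P by (rule C_sub[OF H])
  have "comm x y \<in> {comm x y | x y. x \<in> H \<and> y \<in> H}"
    if xy: "x \<in> carrier P" "y \<in> carrier P" "q y \<in> q ` H" for x y
  proof -
    obtain h where h: "h \<in> H" "q y = q h" using xy by blast
    obtain h' c where c: "h' \<in> H" "c \<in> C H" "x = h' \<otimes> c" using HC_dec[OF H xy(1)] by blast
    have "comm c h = \<one>" using comm_one_iff[of c h] HC_comm[OF H h(1) c(2)] h c by simp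
    have "comm x y = comm x h" by (rule comm_cong) (use xy h in auto)
    also have "\<dots> = comm h' h" unfolding c(3) using c h \<open>comm c h = \<one>\<close> by (simp add: comm_mult_l)
    finally show ?thesis using c h by blast
  qed
  then have "{comm x y | x y. x \<in> carrier P \<and> y \<in> carrier P \<and> q y \<in> q ` H} =
      {comm x y | x y. x \<in> H \<and> y \<in> H}" using H_car[OF H] by blast
  then show ?thesis unfolding dspan_def derived_comm using pr_image[OF H] by (simp add: proj_def)
qed

lemma member_cards:
  assumes H: "H \<in> Hs"
  defines "d \<equiv> decomp_data (proj H)"
  shows "card H = fst d * snd d"
    "card (group_center (sub H)) = (if snd d = 1 then fst d else snd d)"
proof -
  interpret HS: subgroup H P by (rule H_sub[OF H])
  have d: "fst d = card (q ` H)" "snd d = card (derived P H)"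
    unfolding d_def decomp_data_def using pr_image[OF H] dspan_proj[OF H] by (simp_all add: proj_def)
  have finH: "finite H" using HS.subset finP finite_subset by blast
  have inc: "derived P H \<subseteq> H" using derived_incl[OF _ H_sub[OF H]] by blast
  have leD: "derived P H \<subseteq> D" using derived_le_D[OF HS.subset] .
  have Zc: "H \<inter> D \<subseteq> group_center (sub H)"
  proof
    fix x assume "x \<in> H \<inter> D"
    then show "x \<in> group_center (sub H)"
      using D_central[of x] HS.subset unfolding group_center_def by auto
  qed
  \<comment> \<open>In the abelian case a nontrivial element of \<open>H\<close> in \<open>D\<close>
    would generate \<open>H\<close> and place it inside \<open>D\<close>, against
    \<open>nontriv\<close>.\<close>
  have HD: "H \<inter> D = derived P H"
  proof (rule disjE[OF member_cases[OF H]])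
    assume "group_center (sub H) \<subseteq> derived P H"
    then show ?thesis using Zc inc leD by blast
  next
    assume a: "(\<forall>x \<in> H. \<forall>y \<in> H. x \<otimes> y = y \<otimes> x) \<and> (\<forall>x \<in> H. x \<noteq> \<one> \<longrightarrow> H \<subseteq> generate P {x})"
    have one: "derived P H = {\<one>}" by (rule derived_abelian[OF HS.subset]) (use a in blast)
    have "x = \<one>" if x: "x \<in> H" "x \<in> D" for x
    proof (rule ccontr)
      assume "x \<noteq> \<one>"
      then have "H \<subseteq> generate P {x}" using a x by blast
      also have "\<dots> \<subseteq> D" using generate_subgroup_incl[OF _ D_subgroup] x by blast
      finally show False using nontriv[OF H] q_D by blast
    qed
    then show ?thesis using one inc leD by blast
  qed
  \<comment> \<open>The fibres of \<open>q\<close> on \<open>H\<close> are the cosets of the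
    intersection of \<open>H\<close> with \<open>D\<close>, which has just been identified as
    \<open>H'\<close>.\<close>
  have fib: "card {x \<in> H. q x = v} = card (derived P H)" if v: "v \<in> q ` H" for v
  proof -
    obtain h where h: "h \<in> H" "v = q h" using v by blast
    have "bij_betw (\<lambda>x. h \<otimes> x) (derived P H) {x \<in> H. q x = v}"
    proof (rule bij_betwI[of _ _ _ "\<lambda>x. inv h \<otimes> x"])
      show "(\<lambda>x. h \<otimes> x) \<in> derived P H \<rightarrow> {x \<in> H. q x = v}"
      proof
        fix x assume "x \<in> derived P H"
        then have x: "x \<in> H" "x \<in> D" using inc leD by auto
        then show "h \<otimes> x \<in> {x \<in> H. q x = v}" using h q_D[of x] by (simp add: q_mult)
      qed
      show "(\<lambda>x. inv h \<otimes> x) \<in> {x \<in> H. q x = v} \<rightarrow> derived P H"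
      proof
        fix x assume "x \<in> {x \<in> H. q x = v}"
        then have x: "x \<in> H" "q x = q h" using h by auto
        then have "q (inv h \<otimes> x) = \<one>\<^bsub>V\<^esub>" using h by (simp add: q_mult q_inv)
        then have "inv h \<otimes> x \<in> H \<inter> D" using q_ker[of "inv h \<otimes> x"] x h by simp
        then show "inv h \<otimes> x \<in> derived P H" using HD by blast
      qed
    qed (use h inc in \<open>auto simp: inv_cancel\<close>)
    then show ?thesis using bij_betw_same_card by fastforce
  qed
  have "card H = (\<Sum>x\<in>H. 1)" by simp
  also have "\<dots> = (\<Sum>v\<in>q ` H. \<Sum>x\<in>{x. x \<in> H \<and> q x = v}. 1)" by (rule sum.image_gen[OF finH])
  also have "\<dots> = (\<Sum>v\<in>q ` H. card (derived P H))"
    by (rule sum.cong) (use fib in auto)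
  finally show card: "card H = fst d * snd d" using d by simp
  show "card (group_center (sub H)) = (if snd d = 1 then fst d else snd d)"
  \<comment> \<open>\<open>snd d\<close> is the order of \<open>H'\<close>, so the value 1 marks the
    abelian members.\<close>
  proof (cases "snd d = 1")
    case True
    then have "card (derived P H) = 1" using d by simp
    moreover have "\<one> \<in> derived P H" unfolding derived_comm by (rule generate.one)
    ultimately have one: "derived P H = {\<one>}" by (metis card_1_singletonE singletonD)
    have "x \<otimes> y = y \<otimes> x" if "x \<in> H" "y \<in> H" for x y
    proof -
      have "comm x y \<in> derived P H" unfolding derived_comm by (rule generate.incl) (use that in blast)
      then show ?thesis using one comm_one_iff that by simp
    qed
    then have "group_center (sub H) = H" by (auto simp: group_center_def)
    then show ?thesis using True card by simp
  next
    case False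
    have "group_center (sub H) \<subseteq> derived P H"
    proof (rule disjE[OF member_cases[OF H]])
      assume a: "(\<forall>x \<in> H. \<forall>y \<in> H. x \<otimes> y = y \<otimes> x) \<and> (\<forall>x \<in> H. x \<noteq> \<one> \<longrightarrow> H \<subseteq> generate P {x})"
      have "derived P H = {\<one>}" by (rule derived_abelian[OF HS.subset]) (use a in blast)
      then show ?thesis using False d by simp
    qed
    then have "group_center (sub H) = derived P H" using Zc HD by blast
    then show ?thesis using False d by simp
  qed
qed

end

text \<open>Quantifying over the data functions hides \<open>V\<close> and the adjoint ring, so that
  the result can be used outside the locale.\<close>

lemma (in class2_group) fully_refined_data:
  assumes "fully_refined P Hs" "fully_refined P Ks"
  shows "\<exists>f g. image_mset f (mset_set Hs) = image_mset g (mset_set Ks) \<and>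
    (\<forall>H \<in> Hs. card H = fst (f H) * snd (f H) \<and>
       card (group_center (sub H)) = (if snd (f H) = (1::nat) then fst (f H) else snd (f H))) \<and>
    (\<forall>K \<in> Ks. card K = fst (g K) * snd (g K) \<and>
       card (group_center (sub K)) = (if snd (g K) = (1::nat) then fst (g K) else snd (g K)))"
proof -
  interpret H: class2_decomp P V q p Hs by unfold_locales fact
  interpret K: class2_decomp P V q p Ks by unfold_locales fact
  have e: "x \<in> carrier adj_ring" "x \<otimes>\<^bsub>adj_ring\<^esub> x = x" if "x \<in> H.proj ` Hs \<union> K.proj ` Ks" for x
    using that H.proj_carrier K.proj_carrier H.proj_idem K.proj_idem by auto
  have "image_mset decomp_data (mset_set (H.proj ` Hs)) = image_mset decomp_data (mset_set (K.proj ` Ks))"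
    by (rule A.frame_mset_eq[OF H.proj_frame K.proj_frame]) (use decomp_data_equiv e in blast)
  then have "image_mset (decomp_data \<circ> H.proj) (mset_set Hs) = image_mset (decomp_data \<circ> K.proj) (mset_set Ks)"
    using H.proj_inj K.proj_inj by (simp add: image_mset_mset_set[symmetric] multiset.map_comp)
  then show ?thesis
    using H.member_cards K.member_cards by (intro exI[of _ "decomp_data \<circ> H.proj"] exI[of _ "decomp_data \<circ> K.proj"]) auto
qed

theorem fully_refined_same_cards:
  fixes P :: "('a, 'b) monoid_scheme"
  assumes "Factorial_Ring.prime p" "odd p" "class2_exp_p_group p P" "fully_refined P Hs" "fully_refined P Ks"
  shows "card Hs = card Ks"
    "image_mset card (mset_set Hs) = image_mset card (mset_set Ks)"
    "image_mset (\<lambda>H. card (group_center (P\<lparr>carrier := H\<rparr>))) (mset_set Hs) =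
     image_mset (\<lambda>K. card (group_center (P\<lparr>carrier := K\<rparr>))) (mset_set Ks)"
proof -
  note P = assms(3)[unfolded class2_exp_p_group_def]
  interpret G: group P using P by simp
  let ?D = "derived P (carrier P)"
  interpret N: normal ?D P by (rule G.derived_self_is_normal)
  interpret V: comm_group "P Mod ?D" by (rule G.derived_quot_is_comm_group)
  interpret C: class2_group P "P Mod ?D" "\<lambda>x. ?D #>\<^bsub>P\<^esub> x" p
  proof
    show "(\<lambda>x. ?D #>\<^bsub>P\<^esub> x) \<in> hom P (P Mod ?D)" by (rule N.r_coset_hom_Mod)
    show "(\<lambda>x. ?D #>\<^bsub>P\<^esub> x) ` carrier P = carrier (P Mod ?D)" by (auto simp: FactGroup_def RCOSETS_def)
    show "?D #>\<^bsub>P\<^esub> x = \<one>\<^bsub>P Mod ?D\<^esub> \<longleftrightarrow> x \<in> ?D" if "x \<in> carrier P" for x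
    proof
      assume "?D #>\<^bsub>P\<^esub> x = \<one>\<^bsub>P Mod ?D\<^esub>"
      then have "?D #>\<^bsub>P\<^esub> x = ?D" by (simp add: FactGroup_def)
      then show "x \<in> ?D" using G.rcos_self[OF that N.subgroup_axioms] by simp
    next
      assume "x \<in> ?D"
      then show "?D #>\<^bsub>P\<^esub> x = \<one>\<^bsub>P Mod ?D\<^esub>"
        using G.coset_join2[OF that N.subgroup_axioms] by (simp add: FactGroup_def)
    qed
  qed (use assms P in auto)
  obtain f g where fg: "image_mset f (mset_set Hs) = image_mset g (mset_set Ks)"
    "\<forall>H \<in> Hs. card H = fst (f H) * snd (f H) \<and>
       card (group_center (P\<lparr>carrier := H\<rparr>)) = (if snd (f H) = (1::nat) then fst (f H) else snd (f H))"
    "\<forall>K \<in> Ks. card K = fst (g K) * snd (g K) \<and>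
       card (group_center (P\<lparr>carrier := K\<rparr>)) = (if snd (g K) = (1::nat) then fst (g K) else snd (g K))"
    using C.fully_refined_data[OF assms(4,5)] by blast
  have fin: "finite Hs" "finite Ks"
  proof -
    interpret H: class2_decomp P "P Mod ?D" "\<lambda>x. ?D #>\<^bsub>P\<^esub> x" p Hs by unfold_locales fact
    interpret K: class2_decomp P "P Mod ?D" "\<lambda>x. ?D #>\<^bsub>P\<^esub> x" p Ks by unfold_locales fact
    show "finite Hs" "finite Ks" using H.finHs K.finHs by auto
  qed
  have "size (image_mset f (mset_set Hs)) = size (image_mset g (mset_set Ks))" using fg(1) by simp
  then show "card Hs = card Ks" by simp
  have t: "image_mset \<phi> (mset_set Hs) = image_mset \<phi> (mset_set Ks)"
    if "\<And>H. H \<in> Hs \<Longrightarrow> \<phi> H = F (f H)" "\<And>K. K \<in> Ks \<Longrightarrow> \<phi> K = F (g K)" for \<phi> :: "'a set \<Rightarrow> nat" and F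
  proof -
    have "image_mset \<phi> (mset_set Hs) = image_mset F (image_mset f (mset_set Hs))"
      using that(1) fin by (auto simp: multiset.map_comp intro!: image_mset_cong)
    also have "\<dots> = image_mset \<phi> (mset_set Ks)" unfolding fg(1)
      using that(2) fin by (auto simp: multiset.map_comp intro!: image_mset_cong)
    finally show ?thesis .
  qed
  show "image_mset card (mset_set Hs) = image_mset card (mset_set Ks)"
    by (rule t[of _ "\<lambda>d. fst d * snd d"]) (use fg in auto)
  show "image_mset (\<lambda>H. card (group_center (P\<lparr>carrier := H\<rparr>))) (mset_set Hs) =
     image_mset (\<lambda>K. card (group_center (P\<lparr>carrier := K\<rparr>))) (mset_set Ks)"
    by (rule t[of _ "\<lambda>d. if snd d = 1 then fst d else snd d"]) (use fg in auto)
qed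

section \<open>Prime fields inside one ring type\<close>

text \<open>The ring of all integer residues, one modulo each \<open>m\<close>: a single type that contains every prime
  field, as the ideal generated by an idempotent.\<close>

typedef residues = "{f :: nat \<Rightarrow> int. \<forall>m. f m mod int m = f m}"
  by (rule exI[of _ "\<lambda>_. 0"]) simp

setup_lifting type_definition_residues

instantiation residues :: comm_ring_1
begin

lift_definition zero_residues :: residues is "\<lambda>_. 0" by simp
lift_definition one_residues :: residues is "\<lambda>m. 1 mod int m" by simp
lift_definition plus_residues :: "residues \<Rightarrow> residues \<Rightarrow> residues" is "\<lambda>f g m. (f m + g m) mod int m" by simp
lift_definition minus_residues :: "residues \<Rightarrow> residues \<Rightarrow> residues" is "\<lambda>f g m. (f m - g m) mod int m" by simp
lift_definition uminus_residues :: "residues \<Rightarrow> residues" is "\<lambda>f m. (- f m) mod int m" by simp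
lift_definition times_residues :: "residues \<Rightarrow> residues \<Rightarrow> residues" is "\<lambda>f g m. (f m * g m) mod int m" by simp

instance
proof
  show "(0::residues) \<noteq> 1" by transfer (metis mod_by_0 of_nat_0 zero_neq_one)
qed (transfer, simp add: fun_eq_iff mod_simps algebra_simps)+

end

lift_definition residue_unit :: "nat \<Rightarrow> residues" is "\<lambda>p m. if m = p then 1 mod int m else 0" by simp

lemma Rep_of_nat: "Rep_residues (of_nat j) m = int j mod int m"
  by (induction j) (simp_all add: zero_residues.rep_eq plus_residues.rep_eq one_residues.rep_eq mod_simps)

text \<open>The field consists of the integer multiples of the idempotent \<open>e\<close>, which
  serves as its identity; the ambient ring only lends its operations.\<close>

locale prime_field =
  fixes e :: "'k::comm_ring_1" and p :: nat
  assumes p: "Factorial_Ring.prime p" "odd p" and e: "e * e = e" "e \<noteq> 0" and char: "of_nat p * e = 0"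

lemma residue_unit_prime_field:
  assumes "Factorial_Ring.prime p" "odd p"
  shows "prime_field (residue_unit p) p"
proof
  have p: "p > 1" using assms prime_gt_1_nat by blast
  show "residue_unit p * residue_unit p = residue_unit p" by transfer (auto simp: mod_simps)
  show "residue_unit p \<noteq> 0" using p by transfer (auto simp: fun_eq_iff)
  have "Rep_residues (of_nat p * residue_unit p) m = 0" for m
    by (simp add: times_residues.rep_eq Rep_of_nat residue_unit.rep_eq)
  then show "of_nat p * residue_unit p = 0"
    by (metis Rep_residues_inject ext zero_residues.rep_eq)
qed fact+

context prime_field
begin

definition K :: "'k set" where "K = (\<lambda>j. of_int j * e) ` UNIV"

lemma KI: "of_int j * e \<in> K" "of_nat n * e \<in> K"
  unfolding K_def by (auto intro: image_eqI[of _ _ "int n"])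

lemma K_0 [simp]: "0 \<in> K" using KI(1)[of 0] by simp
lemma K_e [simp]: "e \<in> K" using KI(1)[of 1] by simp

lemma K_add [simp]: 
  assumes "x \<in> K" "y \<in> K" shows "x + y \<in> K"
proof -
  obtain i j where "x = of_int i * e" "y = of_int j * e" using assms unfolding K_def by blast
  then have "x + y = of_int (i + j) * e" by (simp add: algebra_simps)
  then show ?thesis using KI(1)[of "i + j"] by simp
qed

lemma K_uminus [simp]: 
  assumes "x \<in> K" shows "- x \<in> K"
proof -
  obtain i where "x = of_int i * e" using assms unfolding K_def by blast
  then have "- x = of_int (- i) * e" by simp
  then show ?thesis using KI(1)[of "- i"] by simp
qed

lemma K_diff [simp]: "x \<in> K \<Longrightarrow> y \<in> K \<Longrightarrow> x - y \<in> K"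
  using K_add[of x "- y"] by simp

lemma K_mult [simp]: 
  assumes "x \<in> K" "y \<in> K" shows "x * y \<in> K"
proof -
  obtain i j where "x = of_int i * e" "y = of_int j * e" using assms unfolding K_def by blast
  then have "x * y = of_int (i * j) * (e * e)" by (simp add: algebra_simps)
  then show ?thesis using KI(1)[of "i * j"] e by simp
qed

lemma K_sum: "(\<And>i. i \<in> S \<Longrightarrow> f i \<in> K) \<Longrightarrow> sum f S \<in> K"
  by (induction S rule: infinite_finite_induct) auto

lemma K_prod: 
  assumes "finite S" "S \<noteq> {}" "\<And>i. i \<in> S \<Longrightarrow> f i \<in> K" shows "prod f S \<in> K"
  using assms by (induction S rule: finite_ne_induct) auto

lemma K_unit [simp]: 
  assumes "x \<in> K" shows "e * x = x" "x * e = x"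
proof -
  obtain i where "x = of_int i * e" using assms unfolding K_def by blast
  then have "e * x = of_int i * (e * e)" by (simp add: algebra_simps)
  then show "e * x = x" using e \<open>x = of_int i * e\<close> by simp
  then show "x * e = x" by (simp add: mult.commute)
qed

lemma int_zero: 
  assumes "int p dvd j" shows "of_int j * e = 0"
proof -
  obtain i where "j = int p * i" using assms by blast
  then have "of_int j * e = of_int i * (of_nat p * e)" by (simp add: algebra_simps)
  then show ?thesis using char by simp
qed

lemma int_inverse:
  assumes "\<not> int p dvd j" shows "\<exists>y \<in> K. (of_int j * e) * y = e"
proof -
  have "coprime j (int p)" using assms p prime_imp_coprime_int[of "int p" j] by (simp add: coprime_commute)
  then obtain u v where uv: "u * j + v * int p = 1" using bezout_int[of j "int p"] by (metis coprime_iff_gcd_eq_1)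
  have "e = of_int (u * j + v * int p) * e" using uv by simp
  also have "\<dots> = of_int (u * j) * e + of_int (v * int p) * e" by (simp only: of_int_add distrib_right)
  also have "of_int (v * int p) * e = 0" by (rule int_zero) simp
  finally have "e = of_int (u * j) * (e * e)" using e by simp
  then have "(of_int j * e) * (of_int u * e) = e" by (simp add: algebra_simps)
  then show ?thesis using KI by blast
qed

lemma K_inverse: 
  assumes "x \<in> K" "x \<noteq> 0" shows "\<exists>y \<in> K. x * y = e"
proof -
  obtain j where "x = of_int j * e" using assms unfolding K_def by blast
  then show ?thesis using int_inverse[of j] int_zero[of j] assms by auto
qed

definition iv :: "'k \<Rightarrow> 'k" where "iv x = (SOME y. y \<in> K \<and> x * y = e)"

lemma iv: "x \<in> K \<Longrightarrow> x \<noteq> 0 \<Longrightarrow> iv x \<in> K" "x \<in> K \<Longrightarrow> x \<noteq> 0 \<Longrightarrow> x * iv x = e"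
  unfolding iv_def using someI_ex[of "\<lambda>y. y \<in> K \<and> x * y = e"] K_inverse by blast+

lemma K_cancel:
  assumes "x \<in> K" "x \<noteq> 0" "y \<in> K" shows "x * (iv x * y) = y"
  using assms iv[OF assms(1,2)] by (simp add: mult.assoc[symmetric])

lemma K_no_zero_div:
  assumes "x \<in> K" "y \<in> K" shows "x * y = 0 \<longleftrightarrow> x = 0 \<or> y = 0"
proof
  assume xy: "x * y = 0"
  show "x = 0 \<or> y = 0"
  proof (rule disjCI)
    assume "y \<noteq> 0"
    have "x = (x * y) * iv y" using iv[OF assms(2) \<open>y \<noteq> 0\<close>] assms by (simp add: mult.assoc)
    then show "x = 0" using xy by simp
  qed
qed auto

lemma K_mult_left_cancel: "x \<in> K \<Longrightarrow> x \<noteq> 0 \<Longrightarrow> y \<in> K \<Longrightarrow> z \<in> K \<Longrightarrow> x * y = x * z \<longleftrightarrow> y = z"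
  using K_no_zero_div[of x "y - z"] by (auto simp: algebra_simps)

lemma two_e: "e + e \<noteq> 0"
proof
  assume "e + e = 0"
  have "\<not> int p dvd 2"
    using p primes_dvd_imp_eq[of p 2] by (metis even_numeral int_dvd_int_iff of_nat_numeral two_is_prime_nat dvd_refl)
  then obtain y where "(of_int 2 * e) * y = e" using int_inverse by blast
  moreover have "of_int 2 * e = e + e" by simp
  ultimately show False using \<open>e + e = 0\<close> e by simp
qed

lemma K_double: 
  assumes "x \<in> K" "x + x = 0" shows "x = 0"
proof -
  have "(e + e) * x = x + x" using assms(1) by (simp only: distrib_right K_unit)
  then have "(e + e) * x = 0" using assms(2) by simp
  then show ?thesis using K_no_zero_div[OF K_add[OF K_e K_e] assms(1)] two_e by blast
qed

lemma K_nat: 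
  assumes "x \<in> K" shows "\<exists>j < p. x = of_nat j * e"
proof -
  obtain i where i: "x = of_int i * e" using assms unfolding K_def by blast
  have p0: "p > 0" using p prime_gt_0_nat by blast
  have "of_int i * e = of_int (i mod int p) * e + of_int (int p * (i div int p)) * e"
    by (metis distrib_right mod_mult_div_eq of_int_add)
  also have "of_int (int p * (i div int p)) * e = 0" by (rule int_zero) simp
  finally have "x = of_nat (nat (i mod int p)) * e" using i p0 by simp
  moreover have "nat (i mod int p) < p" using p0 by (simp add: nat_less_iff)
  ultimately show ?thesis by blast
qed

lemma card_K: "card K = p"
proof -
  have p0: "p > 0" using p prime_gt_0_nat by blast
  have "K = (\<lambda>j. of_nat j * e) ` {..<p}" using K_nat KI by fastforce
  moreover have "inj_on (\<lambda>j. of_nat j * e) {..<p}"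
  proof (rule inj_onI)
    fix i j assume ij: "i \<in> {..<p}" "j \<in> {..<p}" "of_nat i * e = of_nat j * e"
    then have z: "of_int (int i - int j) * e = 0" by (simp add: algebra_simps)
    have "int p dvd int i - int j"
    proof (rule ccontr)
      assume "\<not> int p dvd int i - int j"
      then show False using int_inverse[of "int i - int j"] z e by auto
    qed
    then have "int i mod int p = int j mod int p" by (simp add: mod_eq_dvd_iff)
    then show "i = j" using ij by simp
  qed
  ultimately show ?thesis using card_image[of "\<lambda>j. of_nat j * e" "{..<p}"] by (metis card_lessThan)
qed

lemma finite_K: "finite K"
  using card_K p prime_gt_0_nat card_ge_0_finite by metis

definition sq :: "'k \<Rightarrow> bool" where "sq x \<longleftrightarrow> (\<exists>y \<in> K. y \<noteq> 0 \<and> x = y * y)"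

lemma sq_K: "sq x \<Longrightarrow> x \<in> K \<and> x \<noteq> 0"
  unfolding sq_def using K_no_zero_div by auto

lemma sq_mult: 
  assumes "sq x" "sq y" shows "sq (x * y)"
proof -
  obtain a b where ab: "a \<in> K" "a \<noteq> 0" "x = a * a" "b \<in> K" "b \<noteq> 0" "y = b * b"
    using assms unfolding sq_def by blast
  have "x * y = (a * b) * (a * b)" "a * b \<in> K" "a * b \<noteq> 0" using ab K_no_zero_div by (auto simp: algebra_simps)
  then show ?thesis unfolding sq_def by blast
qed

lemma sq_cancel: 
  assumes "x \<in> K" "sq y" "sq (x * y)" shows "sq x"
proof -
  obtain b where b: "b \<in> K" "b \<noteq> 0" "y = b * b" using assms unfolding sq_def by blast
  obtain c where c: "c \<in> K" "c \<noteq> 0" "x * y = c * c" using assms unfolding sq_def by blast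
  have ib: "iv b \<in> K" "b * iv b = e" using iv b by auto
  have "(c * iv b) * (c * iv b) = (x * y) * (iv b * iv b)" unfolding c(3) by (simp add: algebra_simps)
  also have "\<dots> = x * ((b * iv b) * (b * iv b))" unfolding b(3) by (simp add: algebra_simps)
  finally have 1: "x = (c * iv b) * (c * iv b)" using ib e assms by simp
  have "x \<noteq> 0" using c K_no_zero_div by auto
  then show ?thesis unfolding sq_def using 1 c ib by (metis K_mult mult_zero_left)
qed

text \<open>Squaring is two-to-one on the nonzero elements, so the squares have index two.\<close>

lemma nonsquare_exists: "\<exists>x \<in> K. x \<noteq> 0 \<and> \<not> sq x"
  and nonsquare_mult: "\<lbrakk>x \<in> K; x \<noteq> 0; \<not> sq x; y \<in> K; y \<noteq> 0; \<not> sq y\<rbrakk> \<Longrightarrow> sq (x * y)"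
proof -
  define S where "S = {x. sq x}"
  have SK: "S \<subseteq> K - {0}" unfolding S_def using sq_K by auto
  have finS: "finite S" using SK finite_K finite_subset by blast
  have Sim: "S = (\<lambda>y. y * y) ` (K - {0})" unfolding S_def sq_def by auto
  have fib: "card {y \<in> K - {0}. y * y = x} = 2" if x: "x \<in> S" for x
  proof -
    obtain b where b: "b \<in> K" "b \<noteq> 0" "x = b * b" using x unfolding S_def sq_def by blast
    have "{y \<in> K - {0}. y * y = x} = {b, - b}"
    proof -
      have "y = b \<or> y = - b" if "y \<in> K" "y * y = b * b" for y
      proof -
        have "(y - b) * (y + b) = 0" using that(2) by (simp add: algebra_simps)
        then show ?thesis using K_no_zero_div[of "y - b" "y + b"] that b by (auto simp: eq_neg_iff_add_eq_0)
      qed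
      then show ?thesis using b by auto
    qed
    moreover have "b \<noteq> - b" using K_double[OF b(1)] b(2) by (auto simp: eq_neg_iff_add_eq_0)
    ultimately show ?thesis by simp
  qed
  have "card (K - {0}) = (\<Sum>x\<in>K - {0}. 1)" by simp
  also have "\<dots> = (\<Sum>x\<in>S. \<Sum>y\<in>{y. y \<in> K - {0} \<and> y * y = x}. 1)"
    unfolding Sim by (rule sum.image_gen) (use finite_K in simp)
  also have "\<dots> = (\<Sum>x\<in>S. 2)" by (rule sum.cong) (use fib in auto)
  finally have c: "card (K - {0}) = 2 * card S" by simp
  have "e \<in> S" unfolding S_def sq_def using e by auto
  then have S0: "card S > 0" using finS card_gt_0_iff by blast
  have "S \<noteq> K - {0}" using c S0 by auto
  then show "\<exists>x \<in> K. x \<noteq> 0 \<and> \<not> sq x" using SK unfolding S_def by blast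
  show "sq (x * y)" if xy: "x \<in> K" "x \<noteq> 0" "\<not> sq x" "y \<in> K" "y \<noteq> 0" "\<not> sq y" for x y
  proof -
    \<comment> \<open>Multiplication by the nonsquare \<open>x\<close> carries the squares into the
      nonsquares. Both sets have the same size, so the nonsquare \<open>y\<close> is
      \<open>x\<close> times a square.\<close>
    have sub: "(\<lambda>s. x * s) ` S \<subseteq> K - {0} - S"
    proof
      fix z assume "z \<in> (\<lambda>s. x * s) ` S"
      then obtain s where s: "sq s" "z = x * s" unfolding S_def by blast
      then have "\<not> sq z" using sq_cancel[OF xy(1)] xy(3) by blast
      then show "z \<in> K - {0} - S" using s sq_K[OF s(1)] xy K_no_zero_div by (auto simp: S_def)
    qed
    have "inj_on (\<lambda>s. x * s) S" using K_mult_left_cancel[OF xy(1,2)] SK by (auto simp: inj_on_def)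
    then have "card ((\<lambda>s. x * s) ` S) = card S" by (rule card_image)
    moreover have "card (K - {0} - S) = card S" using c SK finS by (simp add: card_Diff_subset)
    ultimately have "(\<lambda>s. x * s) ` S = K - {0} - S" using sub finite_K by (intro card_subset_eq) auto
    then obtain s where s: "sq s" "y = x * s" using xy unfolding S_def by blast
    have "sq (x * x)" using xy unfolding sq_def by blast
    then have "sq ((x * x) * s)" using sq_mult s by blast
    then show ?thesis using s by (simp add: mult.assoc)
  qed
qed

lemma sq_mult_iff: "\<lbrakk>x \<in> K; x \<noteq> 0; y \<in> K; y \<noteq> 0\<rbrakk> \<Longrightarrow> sq (x * y) \<longleftrightarrow> (sq x \<longleftrightarrow> sq y)"
  using sq_mult nonsquare_mult sq_cancel[of x y] sq_cancel[of y x] by (auto simp: mult.commute)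

lemma sq_prod_iff:
  assumes "finite S" "S \<noteq> {}" "\<And>i. i \<in> S \<Longrightarrow> f i \<in> K \<and> f i \<noteq> 0"
  shows "prod f S \<noteq> 0 \<and> (sq (prod f S) \<longleftrightarrow> even (card {i \<in> S. \<not> sq (f i)}))"
  using assms
proof (induction S rule: finite_ne_induct)
  case (singleton i)
  have "{j. j = i \<and> \<not> sq (f j)} = (if sq (f i) then {} else {i})" by auto
  then show ?case using singleton by simp
next
  case (insert i S)
  have "{j \<in> insert i S. \<not> sq (f j)} = (if sq (f i) then {j \<in> S. \<not> sq (f j)} else insert i {j \<in> S. \<not> sq (f j)})" by auto
  then have "even (card {j \<in> insert i S. \<not> sq (f j)}) \<longleftrightarrow> (sq (f i) \<longleftrightarrow> even (card {j \<in> S. \<not> sq (f j)}))"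
    using insert by simp
  moreover have "prod f S \<in> K" using insert by (intro K_prod) auto
  ultimately show ?case using insert sq_mult_iff[of "f i" "prod f S"] K_no_zero_div by auto
qed

text \<open>The least natural number \<open>j\<close> for which \<open>j e\<close> is a nonsquare
  has a predecessor whose multiple of \<open>e\<close> is a square or zero, so \<open>j e\<close> is
  \<open>a a + e e\<close> for some \<open>a\<close>.\<close>

lemma nonsquare_sum: "\<exists>a \<in> K. \<exists>b \<in> K. a * a + b * b \<noteq> 0 \<and> \<not> sq (a * a + b * b)"
proof -
  define Q where "Q j \<longleftrightarrow> of_nat j * e \<noteq> 0 \<and> \<not> sq (of_nat j * e)" for j :: nat
  have "\<exists>j. Q j" using nonsquare_exists K_nat unfolding Q_def by blast
  then have L: "Q (LEAST j. Q j)" by (rule LeastI_ex)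
  define j where "j = (LEAST j. Q j)"
  have Qj: "Q j" using L unfolding j_def .
  then have "j \<noteq> 0" by (intro notI) (simp add: Q_def)
  then obtain i where i: "j = Suc i" using not0_implies_Suc by blast
  have "\<not> Q i" using not_less_Least[of i Q] i unfolding j_def by simp
  then obtain a where a: "a \<in> K" "of_nat i * e = a * a" unfolding Q_def sq_def by (metis K_0 mult_zero_left)
  have "of_nat j * e = a * a + e * e" using i a e by (simp add: distrib_right add.commute)
  then show ?thesis using Qj a(1) K_e unfolding Q_def by metis
qed

end

section \<open>The cross product group of a quadratic space\<close>

text \<open>The space is a subset \<open>M\<close> of a type, so that a line in it is again an
  instance and the structure theorem can be applied within a single member of a
  decomposition.\<close>

locale quad_space = prime_field e p for e :: "'k::comm_ring_1" and p :: nat +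
  fixes M :: "'v::ab_group_add set" and sc :: "'k \<Rightarrow> 'v \<Rightarrow> 'v" and dt :: "'v \<Rightarrow> 'v \<Rightarrow> 'k"
  assumes M_0 [simp]: "0 \<in> M" and M_add [simp]: "x \<in> M \<Longrightarrow> y \<in> M \<Longrightarrow> x + y \<in> M"
    and M_uminus [simp]: "x \<in> M \<Longrightarrow> - x \<in> M"
    and M_sc [simp]: "a \<in> K \<Longrightarrow> x \<in> M \<Longrightarrow> sc a x \<in> M"
    and finite_M: "finite M" and M_nontriv: "\<exists>x \<in> M. x \<noteq> 0"
    and sc_add_left: "sc (a + b) x = sc a x + sc b x"
    and sc_add_right: "sc a (x + y) = sc a x + sc a y"
    and sc_mult: "sc (a * b) x = sc a (sc b x)"
    and sc_e [simp]: "x \<in> M \<Longrightarrow> sc e x = x"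
    and dt_K [simp]: "x \<in> M \<Longrightarrow> y \<in> M \<Longrightarrow> dt x y \<in> K"
    and dt_add_left: "dt (x + y) z = dt x z + dt y z"
    and dt_sym: "dt x y = dt y x"
    and dt_sc_left: "dt (sc a x) y = a * dt x y"
    and nondeg: "x \<in> M \<Longrightarrow> (\<And>y. y \<in> M \<Longrightarrow> dt x y = 0) \<Longrightarrow> x = 0"
begin

lemma M_diff [simp]: "x \<in> M \<Longrightarrow> y \<in> M \<Longrightarrow> x - y \<in> M"
  using M_add[of x "- y"] by simp

lemma dt_add_right: "dt z (x + y) = dt z x + dt z y"
  using dt_add_left dt_sym by metis

lemma dt_sc_right: "dt x (sc a y) = a * dt x y"
  using dt_sc_left dt_sym by metis

lemma dt_0 [simp]: "dt 0 x = 0" "dt x 0 = 0"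
proof -
  show "dt 0 x = 0" using dt_add_left[of 0 0 x] by simp
  then show "dt x 0 = 0" using dt_sym[of x 0] by simp
qed

lemma dt_uminus_left: "dt (- x) y = - dt x y"
  using dt_add_left[of x "- x" y] by (simp add: add_eq_0_iff)

lemma dt_diff_left: "dt (x - y) z = dt x z - dt y z"
  using dt_add_left[of x "- y" z] dt_uminus_left by simp

lemma sc_0 [simp]: "sc 0 x = 0" "sc a 0 = 0"
  using sc_add_left[of 0 0 x] sc_add_right[of a 0 0] by auto

lemma dt_eqI: "x \<in> M \<Longrightarrow> y \<in> M \<Longrightarrow> (\<And>z. z \<in> M \<Longrightarrow> dt x z = dt y z) \<Longrightarrow> x = y"
  using nondeg[of "x - y"] by (simp add: dt_diff_left)

text \<open>The cross product of triples of vectors, with \<open>dt\<close> multiplying the entries.\<close>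

definition ct :: "'v \<times> 'v \<times> 'v \<Rightarrow> 'v \<times> 'v \<times> 'v \<Rightarrow> 'k \<times> 'k \<times> 'k" where
  "ct = (\<lambda>(a, b, c) (a', b', c'). (dt b c' - dt c b', dt c a' - dt a c', dt a b' - dt b a'))"

lemma ct_add_left: "ct (u + v) w = ct u w + ct v w"
  by (cases u, cases v, cases w) (simp add: ct_def dt_add_left)

lemma ct_add_right: "ct w (u + v) = ct w u + ct w v"
  by (cases u, cases v, cases w) (simp add: ct_def dt_add_right)

lemma ct_swap: "ct u v = - ct v u"
  by (cases u, cases v) (simp add: ct_def dt_sym)

lemma ct_self [simp]: "ct u u = 0"
  by (cases u) (simp add: ct_def dt_sym zero_prod_def)

lemma ct_0 [simp]: "ct 0 v = 0" "ct v 0 = 0"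
  using ct_add_left[of 0 0 v] ct_add_right[of v 0 0] by auto

lemma ct_uminus: "ct (- u) v = - ct u v" "ct u (- v) = - ct u v"
  using ct_add_left[of u "- u" v] ct_add_right[of u v "- v"] by (auto simp: add_eq_0_iff)

lemma ct_diff: "ct (u - v) w = ct u w - ct v w" "ct w (u - v) = ct w u - ct w v"
  using ct_add_left[of u "- v" w] ct_add_right[of w u "- v"] ct_uminus by auto

lemma ct_K: "u \<in> M \<times> M \<times> M \<Longrightarrow> v \<in> M \<times> M \<times> M \<Longrightarrow> ct u v \<in> K \<times> K \<times> K"
  by (auto simp: ct_def)

lemma triple_double: "t \<in> K \<times> K \<times> K \<Longrightarrow> t + t = 0 \<Longrightarrow> t = 0"
  using K_double by (auto simp: zero_prod_def)

lemma ct_nondeg: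
  assumes "u \<in> M \<times> M \<times> M" "\<And>v. v \<in> M \<times> M \<times> M \<Longrightarrow> ct u v = 0"
  shows "u = 0"
proof -
  obtain a b c where u: "u = (a, b, c)" "a \<in> M" "b \<in> M" "c \<in> M" using assms(1) by auto
  have "dt c y = 0 \<and> dt a y = 0 \<and> dt b y = 0" if "y \<in> M" for y
    using assms(2)[of "(0, y, 0)"] assms(2)[of "(y, 0, 0)"] that by (auto simp: u ct_def zero_prod_def)
  then have "a = 0" "b = 0" "c = 0" using nondeg u by auto
  then show ?thesis by (simp add: u zero_prod_def)
qed

definition subspace :: "'v set \<Rightarrow> bool" where
  "subspace L \<longleftrightarrow> L \<subseteq> M \<and> 0 \<in> L \<and> (\<forall>x \<in> L. \<forall>y \<in> L. x + y \<in> L) \<and> (\<forall>x \<in> L. - x \<in> L) \<and>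
     (\<forall>a \<in> K. \<forall>x \<in> L. sc a x \<in> L)"

definition line :: "'v \<Rightarrow> 'v set" where "line l = (\<lambda>a. sc a l) ` K"

end

text \<open>The group is known only through its coordinates \<open>vec\<close> and
  \<open>cen\<close>. Hence the theory covers the subgroup over a line, with inherited coordinates,
  as well as the copy on the natural numbers.\<close>

locale cross_model = quad_space e p M sc dt + group P
  for e :: "'k::comm_ring_1" and p :: nat and M :: "'v::ab_group_add set" and sc dt
    and P :: "('a, 'b) monoid_scheme" (structure) +
  fixes vec :: "'a \<Rightarrow> 'v \<times> 'v \<times> 'v" and cen :: "'a \<Rightarrow> 'k \<times> 'k \<times> 'k"
  assumes vec_M: "g \<in> carrier P \<Longrightarrow> vec g \<in> M \<times> M \<times> M"
    and cen_K: "g \<in> carrier P \<Longrightarrow> cen g \<in> K \<times> K \<times> K"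
    and coord_inj: "g \<in> carrier P \<Longrightarrow> h \<in> carrier P \<Longrightarrow> vec g = vec h \<Longrightarrow> cen g = cen h \<Longrightarrow> g = h"
    and coord_surj: "u \<in> M \<times> M \<times> M \<Longrightarrow> t \<in> K \<times> K \<times> K \<Longrightarrow> \<exists>g \<in> carrier P. vec g = u \<and> cen g = t"
    and vec_mult: "g \<in> carrier P \<Longrightarrow> h \<in> carrier P \<Longrightarrow> vec (g \<otimes> h) = vec g + vec h"
    and cen_mult: "g \<in> carrier P \<Longrightarrow> h \<in> carrier P \<Longrightarrow> cen (g \<otimes> h) = cen g + cen h + ct (vec g) (vec h)"
begin

lemma vec_one: "vec \<one> = 0"
  using vec_mult[of \<one> \<one>] by simp

lemma cen_one: "cen \<one> = 0"
  using cen_mult[of \<one> \<one>] by (simp add: vec_one)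

lemma vec_inv: "g \<in> carrier P \<Longrightarrow> vec (inv g) = - vec g"
  using vec_mult[of g "inv g"] vec_one by (simp add: eq_neg_iff_add_eq_0 add.commute)

lemma commute_iff:
  assumes "g \<in> carrier P" "h \<in> carrier P"
  shows "g \<otimes> h = h \<otimes> g \<longleftrightarrow> ct (vec g) (vec h) = 0"
proof
  assume "g \<otimes> h = h \<otimes> g"
  then have "ct (vec g) (vec h) = ct (vec h) (vec g)"
    using cen_mult[OF assms] cen_mult[OF assms(2,1)] by simp
  then have "ct (vec g) (vec h) + ct (vec g) (vec h) = 0"
    using ct_swap[of "vec g" "vec h"] by (simp add: add_eq_0_iff)
  then show "ct (vec g) (vec h) = 0" using triple_double ct_K vec_M assms by blast
next
  assume z: "ct (vec g) (vec h) = 0"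
  then have "ct (vec h) (vec g) = 0" using ct_swap[of "vec h" "vec g"] by simp
  then show "g \<otimes> h = h \<otimes> g" using assms z
    by (intro coord_inj) (simp_all add: vec_mult cen_mult)
qed

lemma central_iff:
  assumes g: "g \<in> carrier P"
  shows "(\<forall>h \<in> carrier P. g \<otimes> h = h \<otimes> g) \<longleftrightarrow> vec g = 0"
proof
  assume a: "\<forall>h \<in> carrier P. g \<otimes> h = h \<otimes> g"
  show "vec g = 0"
  proof (rule ct_nondeg)
    fix v assume "v \<in> M \<times> M \<times> M"
    then obtain h where "h \<in> carrier P" "vec h = v" using coord_surj[of v 0] by (auto simp: zero_prod_def)
    then show "ct (vec g) v = 0" using a commute_iff[OF g] by blast
  qed (use vec_M g in blast)
qed (use commute_iff[OF g] in simp)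

text \<open>The factor set \<open>ct\<close> is alternating, so the commutator of two elements has
  central part \<open>ct u v - ct v u\<close>, which is twice \<open>ct u v\<close>.\<close>

lemma commutator:
  assumes "g \<in> carrier P" "h \<in> carrier P" "k \<in> carrier P" "vec k = 0"
    "cen k = ct (vec g) (vec h) + ct (vec g) (vec h)"
  shows "g \<otimes> h = k \<otimes> (h \<otimes> g)" "k = (g \<otimes> h) \<otimes> inv (h \<otimes> g)"
proof -
  show *: "g \<otimes> h = k \<otimes> (h \<otimes> g)"
    by (rule coord_inj) (use assms ct_swap[of "vec h" "vec g"] in \<open>simp_all add: vec_mult cen_mult algebra_simps\<close>)
  show "k = (g \<otimes> h) \<otimes> inv (h \<otimes> g)" using assms unfolding * by (simp add: m_assoc)
qed

lemma half_K: "t \<in> K \<Longrightarrow> \<exists>u \<in> K. u + u = t"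
proof -
  assume t: "t \<in> K"
  have i: "iv (e + e) \<in> K" "(e + e) * iv (e + e) = e" using iv[OF K_add[OF K_e K_e] two_e] .
  have "iv (e + e) + iv (e + e) = e" using i(2) by (simp only: distrib_right K_unit(1)[OF i(1)])
  then have "iv (e + e) * t + iv (e + e) * t = t" using t by (simp only: distrib_right[symmetric] K_unit)
  then show ?thesis using i(1) t K_mult by blast
qed

text \<open>Commutators of multiples of \<open>x\<close> on one axis with \<open>y\<close> on
  another fill one central coordinate, as \<open>dt x y\<close> is invertible; \<open>g\<close> is a
  product of three such commutators.\<close>

lemma center_subset:
  assumes S: "subgroup S P" and xy: "x \<in> M" "y \<in> M" "dt x y \<noteq> 0"
    and el: "\<And>a. a \<in> K \<Longrightarrow> (sc a x, 0, 0) \<in> vec ` S" "\<And>a. a \<in> K \<Longrightarrow> (0, sc a x, 0) \<in> vec ` S"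
      "(0, y, 0) \<in> vec ` S" "(0, 0, y) \<in> vec ` S"
    and g: "g \<in> carrier P" "vec g = 0"
  shows "g \<in> S"
proof -
  have SP: "\<And>h. h \<in> S \<Longrightarrow> h \<in> carrier P" using subgroup.mem_carrier[OF S] .
  have step: "k \<in> S" if uv: "u \<in> vec ` S" "v \<in> vec ` S" and k: "k \<in> carrier P" "vec k = 0" "cen k = ct u v + ct u v" for k u v
  proof -
    obtain a b where ab: "a \<in> S" "b \<in> S" "u = vec a" "v = vec b" using uv by blast
    have "k = (a \<otimes> b) \<otimes> inv (b \<otimes> a)"
      by (rule commutator(2)) (use ab k SP in auto)
    then show ?thesis using ab S by (simp add: subgroup.m_closed subgroup.m_inv_closed)
  qed
  define dd where "dd = dt x y"
  have dd: "dd \<in> K" "dd \<noteq> 0" using xy by (auto simp: dd_def)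
  have half: "\<exists>a \<in> K. a * dd + a * dd = t" if t: "t \<in> K" for t
  proof -
    obtain u where u: "u \<in> K" "u + u = t" using half_K[OF t] by blast
    have "(iv dd * u) * dd = u" using K_cancel[OF dd u(1)] by (simp add: algebra_simps)
    then show ?thesis using u iv(1)[OF dd] by (intro bexI[of _ "iv dd * u"]) auto
  qed
  obtain r s t where rst: "cen g = (r, s, t)" "r \<in> K" "s \<in> K" "t \<in> K" using cen_K[OF g(1)] by auto
  obtain k1 where k1: "k1 \<in> carrier P" "vec k1 = 0" "cen k1 = (r, 0, 0)"
    using coord_surj[of 0 "(r, 0, 0)"] rst by (auto simp: zero_prod_def)
  obtain k2 where k2: "k2 \<in> carrier P" "vec k2 = 0" "cen k2 = (0, s, 0)"
    using coord_surj[of 0 "(0, s, 0)"] rst by (auto simp: zero_prod_def)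
  obtain k3 where k3: "k3 \<in> carrier P" "vec k3 = 0" "cen k3 = (0, 0, t)"
    using coord_surj[of 0 "(0, 0, t)"] rst by (auto simp: zero_prod_def)
  obtain a where a: "a \<in> K" "a * dd + a * dd = r" using half rst by blast
  \<comment> \<open>The second coordinate of the cross product takes the opposite sign for this
    order of axes, hence \<open>- s\<close>.\<close>
  obtain b where b: "b \<in> K" "b * dd + b * dd = - s" using half[of "- s"] rst by auto
  obtain c where c: "c \<in> K" "c * dd + c * dd = t" using half rst by blast
  have "k1 \<in> S" by (rule step[OF el(2)[OF a(1)] el(4)]) (use k1 a in \<open>auto simp: ct_def dt_sc_left dd_def\<close>)
  moreover have "k2 \<in> S" by (rule step[OF el(1)[OF b(1)] el(4)])
      (use k2 b in \<open>auto simp: ct_def dt_sc_left dd_def[symmetric] minus_equation_iff[of _ s]\<close>)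
  moreover have "k3 \<in> S" by (rule step[OF el(1)[OF c(1)] el(3)]) (use k3 c in \<open>auto simp: ct_def dt_sc_left dd_def\<close>)
  moreover have "g = k1 \<otimes> k2 \<otimes> k3"
    by (rule coord_inj) (use g k1 k2 k3 rst in \<open>auto simp: vec_mult cen_mult\<close>)
  ultimately show ?thesis using S by (simp add: subgroup.m_closed)
qed

definition Gr :: "'v set \<Rightarrow> 'a set" where "Gr L = {g \<in> carrier P. vec g \<in> L \<times> L \<times> L}"

lemma Gr_subgroup:
  assumes "subspace L" shows "subgroup (Gr L) P"
proof (rule subgroupI)
  have "\<one> \<in> Gr L" using assms by (auto simp: Gr_def vec_one subspace_def zero_prod_def)
  then show "Gr L \<noteq> {}" by blast
  have L: "x + y \<in> L" "- x \<in> L" if "x \<in> L" "y \<in> L" for x y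
    using assms that by (auto simp: subspace_def)
  show "inv g \<in> Gr L" if "g \<in> Gr L" for g
    using that L(2) by (auto simp: Gr_def vec_inv)
  show "g \<otimes> h \<in> Gr L" if "g \<in> Gr L" "h \<in> Gr L" for g h
    using that L(1) by (auto simp: Gr_def vec_mult)
qed (auto simp: Gr_def)

text \<open>Projecting onto \<open>H\<close> is self-adjoint for \<open>ct\<close>, which forces the projection to act as one and the same
  self-adjoint operator on the three components.\<close>

lemma factor_structure:
  assumes H: "subgroup H P" and C: "subgroup C P"
    and comm: "\<And>x y. x \<in> H \<Longrightarrow> y \<in> C \<Longrightarrow> x \<otimes> y = y \<otimes> x"
    and dec: "\<And>x. x \<in> carrier P \<Longrightarrow> \<exists>h \<in> H. \<exists>c \<in> C. x = h \<otimes> c"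
    and ne: "\<not> H \<subseteq> C"
  shows "\<exists>L. subspace L \<and> H = Gr L \<and> (\<exists>x \<in> L. x \<noteq> 0) \<and>
    (\<forall>x \<in> M. \<exists>y \<in> L. \<forall>l \<in> L. dt x l = dt y l)"
proof -
  define U where "U = vec ` H"
  define W where "W = vec ` C"
  note HP = subgroup.mem_carrier[OF H] and CP = subgroup.mem_carrier[OF C]
  have UM: "U \<subseteq> M \<times> M \<times> M" "W \<subseteq> M \<times> M \<times> M" unfolding U_def W_def using vec_M[OF HP] vec_M[OF CP] by blast+
  have add: "u + v \<in> vec ` S" if uv: "u \<in> vec ` S" "v \<in> vec ` S" and S: "subgroup S P" for u v S
  proof -
    obtain g h where gh: "g \<in> S" "h \<in> S" "u = vec g" "v = vec h" using uv by blast
    then have "u + v = vec (g \<otimes> h)" using subgroup.mem_carrier[OF S] vec_mult by simp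
    then show ?thesis using subgroup.m_closed[OF S gh(1,2)] by blast
  qed
  have neg: "- u \<in> vec ` S" if u: "u \<in> vec ` S" and S: "subgroup S P" for u S
  proof -
    obtain g where g: "g \<in> S" "u = vec g" using u by blast
    then have "- u = vec (inv g)" using subgroup.mem_carrier[OF S] vec_inv by simp
    then show ?thesis using subgroup.m_inv_closed[OF S g(1)] by blast
  qed
  have diff: "u - v \<in> vec ` S" if "u \<in> vec ` S" "v \<in> vec ` S" "subgroup S P" for u v S
    using add[OF that(1) neg[OF that(2,3)] that(3)] by simp
  have orth: "ct u w = 0" if "u \<in> U" "w \<in> W" for u w
    using that comm commute_iff HP CP unfolding U_def W_def by blast
  have UW: "\<exists>u \<in> U. v - u \<in> W" if v: "v \<in> M \<times> M \<times> M" for v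
  proof -
    obtain g where g: "g \<in> carrier P" "vec g = v" using coord_surj[of v 0] v by (auto simp: zero_prod_def)
    obtain h c where "h \<in> H" "c \<in> C" "g = h \<otimes> c" using dec g by blast
    then have "v = vec h + vec c" using g HP CP by (simp add: vec_mult)
    then have "v - vec h = vec c" by simp
    then have "v - vec h \<in> W" using \<open>c \<in> C\<close> unfolding W_def by simp
    then show ?thesis using \<open>h \<in> H\<close> unfolding U_def by blast
  qed
  \<comment> \<open>An element of both \<open>U\<close> and \<open>W\<close> is orthogonal to
    \<open>W\<close> and to \<open>U\<close>, which together make up the whole space.\<close>
  have disj: "u = 0" if u: "u \<in> U" "u \<in> W" for u
  proof (rule ct_nondeg)
    fix v assume "v \<in> M \<times> M \<times> M"
    then obtain u' where u': "u' \<in> U" "v - u' \<in> W" using UW by blast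
    have "ct u v = ct u u' + ct u (v - u')" by (simp add: ct_diff)
    moreover have "ct u' u = 0" "ct u (v - u') = 0" using orth u u' by auto
    ultimately show "ct u v = 0" using ct_swap[of u u'] by simp
  qed (use u UM in blast)
  define \<pi> where "\<pi> v = (SOME u. u \<in> U \<and> v - u \<in> W)" for v
  have pi: "\<pi> v \<in> U" "v - \<pi> v \<in> W" if "v \<in> M \<times> M \<times> M" for v
    using someI_ex[of "\<lambda>u. u \<in> U \<and> v - u \<in> W"] UW[OF that] unfolding \<pi>_def by blast+
  have adj: "ct (\<pi> v) w = ct v (\<pi> w)" if vw: "v \<in> M \<times> M \<times> M" "w \<in> M \<times> M \<times> M" for v w
  proof -
    have "ct (\<pi> v) (w - \<pi> w) = 0" using orth[OF pi(1)[OF vw(1)] pi(2)[OF vw(2)]] .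
    moreover have "ct (\<pi> w) (v - \<pi> v) = 0" using orth[OF pi(1)[OF vw(2)] pi(2)[OF vw(1)]] .
    then have "ct (v - \<pi> v) (\<pi> w) = 0" using ct_swap[of "v - \<pi> v" "\<pi> w"] by simp
    ultimately show ?thesis by (simp add: ct_diff)
  qed
  define A where "A x = fst (\<pi> (x, 0, 0))" for x
  define B where "B x = fst (snd (\<pi> (0, x, 0)))" for x
  define D where "D x = snd (snd (\<pi> (0, 0, x)))" for x
  have piM: "\<pi> v \<in> M \<times> M \<times> M" if "v \<in> M \<times> M \<times> M" for v using pi(1)[OF that] UM(1) by (rule subsetD[rotated])
  have "(\<forall>x \<in> M. \<pi> (x, 0, 0) = (A x, 0, 0) \<and> \<pi> (0, x, 0) = (0, A x, 0) \<and> \<pi> (0, 0, x) = (0, 0, A x) \<and> A x \<in> M) \<and>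
    (\<forall>x \<in> M. \<forall>y \<in> M. dt (A x) y = dt x (A y))"
  proof -
    \<comment> \<open>The adjointness relation for vectors on two different axes is compared
      coordinate by coordinate; a coordinate in which one side vanishes kills an off-axis component
      on the other.\<close>
    have eqs: "snd (snd (\<pi> (x, 0, 0))) = 0 \<and> fst (snd (\<pi> (x, 0, 0))) = 0 \<and>
        snd (snd (\<pi> (0, x, 0))) = 0 \<and> fst (\<pi> (0, x, 0)) = 0 \<and> fst (\<pi> (0, 0, x)) = 0 \<and>
        fst (snd (\<pi> (0, 0, x))) = 0" if x: "x \<in> M" for x
    proof -
      obtain h1 h2 h3 where h: "\<pi> (x, 0, 0) = (h1, h2, h3)" "h1 \<in> M" "h2 \<in> M" "h3 \<in> M"
        using piM[of "(x, 0, 0)"] x by auto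
      obtain k1 k2 k3 where k: "\<pi> (0, x, 0) = (k1, k2, k3)" "k1 \<in> M" "k2 \<in> M" "k3 \<in> M"
        using piM[of "(0, x, 0)"] x by auto
      obtain m1 m2 m3 where m: "\<pi> (0, 0, x) = (m1, m2, m3)" "m1 \<in> M" "m2 \<in> M" "m3 \<in> M"
        using piM[of "(0, 0, x)"] x by auto
      have a: "dt h3 y = 0" "dt h2 y = 0" "dt k3 y = 0" "dt k1 y = 0" "dt m1 y = 0" "dt m2 y = 0"
        if y: "y \<in> M" for y
        using adj[of "(x, 0, 0)" "(0, y, 0)"] adj[of "(x, 0, 0)" "(0, 0, y)"] adj[of "(y, 0, 0)" "(0, x, 0)"]
          adj[of "(0, x, 0)" "(0, 0, y)"] adj[of "(0, y, 0)" "(0, 0, x)"] adj[of "(y, 0, 0)" "(0, 0, x)"] x y h(1) k(1) m(1)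
        by (auto simp: ct_def dt_sym split: prod.splits)
      have "h3 = 0" "h2 = 0" "k3 = 0" "k1 = 0" "m1 = 0" "m2 = 0"
        using nondeg h k m a by blast+
      then show ?thesis using h k m by simp
    qed
    have sh: "\<pi> (x, 0, 0) = (A x, 0, 0)" "\<pi> (0, x, 0) = (0, B x, 0)" "\<pi> (0, 0, x) = (0, 0, D x)"
      "A x \<in> M" "B x \<in> M" "D x \<in> M" if "x \<in> M" for x
      using eqs[OF that] piM[of "(x, 0, 0)"] piM[of "(0, x, 0)"] piM[of "(0, 0, x)"] that
      unfolding A_def B_def D_def by (auto simp: prod_eq_iff)
    \<comment> \<open>The three axis operators are adjoint to one another. As \<open>A\<close> is
      adjoint to both \<open>B\<close> and \<open>D\<close>, these two agree; then \<open>A\<close>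
      and \<open>B\<close> are both adjoint to \<open>D\<close>, so all three are one self-adjoint
      operator.\<close>
    have ab: "dt (A x) y = dt x (B y)" "dt (A x) y = dt x (D y)" "dt (B x) y = dt x (D y)"
      if "x \<in> M" "y \<in> M" for x y
      using adj[of "(x, 0, 0)" "(0, y, 0)"] adj[of "(x, 0, 0)" "(0, 0, y)"] adj[of "(0, x, 0)" "(0, 0, y)"]
        that sh by (auto simp: ct_def)
    have BD: "B x = D x" if "x \<in> M" for x
      by (rule dt_eqI) (use ab sh that dt_sym in metis)+
    have AB: "A x = B x" if "x \<in> M" for x
      by (rule dt_eqI) (use ab sh that BD in metis)+
    show ?thesis using sh AB BD ab(1) by simp
  qed
  then have shape: "\<And>x. x \<in> M \<Longrightarrow> \<pi> (x, 0, 0) = (A x, 0, 0) \<and> \<pi> (0, x, 0) = (0, A x, 0) \<and>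
      \<pi> (0, 0, x) = (0, 0, A x) \<and> A x \<in> M"
    and saA: "\<And>x y. x \<in> M \<Longrightarrow> y \<in> M \<Longrightarrow> dt (A x) y = dt x (A y)" by auto
  have AM: "A x \<in> M" if "x \<in> M" for x using shape[OF that] by blast
  have in_U: "(A x, 0, 0) \<in> U" "(0, A x, 0) \<in> U" "(0, 0, A x) \<in> U"
    "(x - A x, 0, 0) \<in> W" "(0, x - A x, 0) \<in> W" "(0, 0, x - A x) \<in> W" if x: "x \<in> M" for x
    using pi[of "(x, 0, 0)"] pi[of "(0, x, 0)"] pi[of "(0, 0, x)"] shape[OF x] x by (auto simp: zero_prod_def)
  define L where "L = {x \<in> M. A x = x}"
  \<comment> \<open>If \<open>(a, b, c)\<close> is in \<open>U\<close>, subtracting its projection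
    leaves an element of both \<open>U\<close> and \<open>W\<close>, hence zero.\<close>
  have mem: "(a, b, c) \<in> U \<longleftrightarrow> a \<in> L \<and> b \<in> L \<and> c \<in> L" if M: "a \<in> M" "b \<in> M" "c \<in> M" for a b c
  proof
    assume u: "(a, b, c) \<in> U"
    have s: "(A a, A b, A c) \<in> U"
      using add[of _ H, OF add[of _ H] ] in_U(1)[OF M(1)] in_U(2)[OF M(2)] in_U(3)[OF M(3)] H
        add[OF add[OF in_U(1)[OF M(1), unfolded U_def] in_U(2)[OF M(2), unfolded U_def] H] in_U(3)[OF M(3), unfolded U_def] H]
      unfolding U_def by simp
    have "(a - A a, b - A b, c - A c) \<in> W"
      using add[OF add[OF in_U(4)[OF M(1), unfolded W_def] in_U(5)[OF M(2), unfolded W_def] C] in_U(6)[OF M(3), unfolded W_def] C]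
      unfolding W_def by simp
    moreover have "(a - A a, b - A b, c - A c) \<in> U"
      using diff[OF u[unfolded U_def] s[unfolded U_def] H] unfolding U_def by simp
    ultimately have "(a - A a, b - A b, c - A c) = 0" using disj by blast
    then show "a \<in> L \<and> b \<in> L \<and> c \<in> L" using M by (auto simp: L_def zero_prod_def)
  next
    assume "a \<in> L \<and> b \<in> L \<and> c \<in> L"
    then show "(a, b, c) \<in> U"
      using add[OF add[OF in_U(1)[OF M(1), unfolded U_def] in_U(2)[OF M(2), unfolded U_def] H] in_U(3)[OF M(3), unfolded U_def] H]
      unfolding U_def by (simp add: L_def)
  qed
  have LM: "L \<subseteq> M" by (auto simp: L_def)
  have AL: "A x \<in> L" if "x \<in> M" for x
    using mem[of "A x" 0 0] in_U(1)[OF that] AM[OF that] by simp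
  have L: "subspace L"
    unfolding subspace_def
  proof (intro conjI ballI)
    have A0: "A 0 = 0" by (rule dt_eqI) (use AM saA in auto)
    then show "0 \<in> L" by (simp add: L_def)
    fix x assume x: "x \<in> L"
    show "x + y \<in> L" if y: "y \<in> L" for y
      using add[of "(x, 0, 0)" H "(y, 0, 0)"] mem[of x 0 0] mem[of y 0 0] mem[of "x + y" 0 0] x y \<open>0 \<in> L\<close> LM H
      unfolding U_def by (auto simp: subset_iff)
    show "- x \<in> L" using neg[of "(x, 0, 0)" H] mem[of x 0 0] mem[of "- x" 0 0] x \<open>0 \<in> L\<close> LM H
      unfolding U_def by (auto simp: subset_iff)
    show "sc a x \<in> L" if a: "a \<in> K" for a
    proof -
      have xM: "x \<in> M" "A x = x" using x by (auto simp: L_def)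
      have "A (sc a x) = sc a x"
        by (rule dt_eqI) (use AM saA xM a in \<open>auto simp: dt_sc_left\<close>, metis saA xM)
      then show ?thesis using a xM by (simp add: L_def)
    qed
  qed (rule LM)
  have proj: "\<forall>x \<in> M. \<exists>y \<in> L. \<forall>l \<in> L. dt x l = dt y l"
  proof
    fix x assume x: "x \<in> M"
    have "dt x l = dt (A x) l" if "l \<in> L" for l using saA[OF x, of l] that by (auto simp: L_def)
    then show "\<exists>y \<in> L. \<forall>l \<in> L. dt x l = dt y l" using AL[OF x] by blast
  qed
  have vecH: "vec ` H = L \<times> L \<times> L"
    using mem UM unfolding U_def using LM by (auto; blast)
  \<comment> \<open>If \<open>L\<close> were zero, \<open>W\<close> would contain all three axes and
    \<open>H\<close> would have no vector part, so \<open>center_subset\<close> would put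
    \<open>H\<close> into \<open>C\<close>.\<close>
  have nt: "\<exists>x \<in> L. x \<noteq> 0"
  proof (rule ccontr)
    assume "\<not> (\<exists>x \<in> L. x \<noteq> 0)"
    then have "A x = 0" if "x \<in> M" for x using AL that by blast
    then have WW: "(x, 0, 0) \<in> W" "(0, x, 0) \<in> W" "(0, 0, x) \<in> W" if "x \<in> M" for x
      using in_U(4-6)[OF that] that by auto
    have H0: "vec h = 0" if "h \<in> H" for h
    proof -
      have "vec h \<in> L \<times> L \<times> L" using vecH that by blast
      then show ?thesis using \<open>\<not> (\<exists>x \<in> L. x \<noteq> 0)\<close> by (cases "vec h") (auto simp: zero_prod_def)
    qed
    obtain x where x: "x \<in> M" "x \<noteq> 0" using M_nontriv by blast
    then obtain y where y: "y \<in> M" "dt x y \<noteq> 0" using nondeg by blast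
    have "h \<in> C" if "h \<in> H" for h
      by (rule center_subset[OF C x(1) y]) (use WW x y H0 that HP in \<open>auto simp: W_def\<close>)
    then show False using ne by blast
  qed
  then obtain x where x: "x \<in> L" "x \<noteq> 0" by blast
  then obtain y where y: "y \<in> M" "dt x y \<noteq> 0" using nondeg LM by blast
  have xy: "dt x (A y) \<noteq> 0" using y saA[OF _ y(1), of x] x by (auto simp: L_def)
  have "g \<in> H" if g: "g \<in> carrier P" "vec g = 0" for g
    by (rule center_subset[OF H _ _ xy]) (use x y AL LM L g in \<open>auto simp: vecH subspace_def\<close>)
  note cenH = this
  have "H = Gr L"
  proof
    show "H \<subseteq> Gr L" using vecH HP by (auto simp: Gr_def)
    show "Gr L \<subseteq> H"
    proof
      fix g assume "g \<in> Gr L"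
      then have g: "g \<in> carrier P" "vec g \<in> vec ` H" using vecH by (auto simp: Gr_def)
      then obtain h where h: "h \<in> H" "vec g = vec h" by blast
      have "vec (inv h \<otimes> g) = 0" using h g HP by (simp add: vec_mult vec_inv)
      then have "inv h \<otimes> g \<in> H" using cenH g h HP by simp
      then have "h \<otimes> (inv h \<otimes> g) \<in> H" using subgroup.m_closed[OF H h(1)] by blast
      then show "g \<in> H" using h g HP by (simp add: m_assoc[symmetric])
    qed
  qed
  then show ?thesis using L proj nt by blast
qed

end

section \<open>Orthogonal frames and fully refined decompositions\<close>

context quad_space
begin

lemma subspaceD:
  assumes "subspace L"
  shows "L \<subseteq> M" "0 \<in> L" "x \<in> L \<Longrightarrow> y \<in> L \<Longrightarrow> x + y \<in> L" "x \<in> L \<Longrightarrow> - x \<in> L"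
    "a \<in> K \<Longrightarrow> x \<in> L \<Longrightarrow> sc a x \<in> L"
  using assms by (auto simp: subspace_def)

lemma sc_uminus: "sc (- a) x = - sc a x"
  using sc_add_left[of "- a" a x] by (simp add: eq_neg_iff_add_eq_0)

lemma line_subspace:
  assumes l: "l \<in> M" shows "subspace (line l)"
  unfolding subspace_def
proof (intro conjI ballI)
  show "line l \<subseteq> M" using l by (auto simp: line_def)
  show "0 \<in> line l" unfolding line_def by (rule image_eqI[of _ _ 0]) auto
  fix x assume "x \<in> line l"
  then obtain a where a: "a \<in> K" "x = sc a l" by (auto simp: line_def)
  then have "- x = sc (- a) l" by (simp add: sc_uminus)
  then show "- x \<in> line l" using a unfolding line_def by simp
  show "x + y \<in> line l" if y: "y \<in> line l" for y
  proof -
    obtain b where b: "b \<in> K" "y = sc b l" using y by (auto simp: line_def)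
    then have "x + y = sc (a + b) l" using a by (simp add: sc_add_left)
    then show ?thesis using a b unfolding line_def by simp
  qed
  show "sc b x \<in> line l" if "b \<in> K" for b
  proof -
    have "sc b x = sc (b * a) l" using a by (simp add: sc_mult)
    then show ?thesis using a that unfolding line_def by simp
  qed
qed

lemma line_self: "l \<in> M \<Longrightarrow> l \<in> line l"
  unfolding line_def by (rule image_eqI[of _ _ e]) auto

lemma line_quad_space:
  assumes l: "l \<in> M" "dt l l \<noteq> 0"
  shows "quad_space e p (line l) sc dt"
proof
  note L = line_subspace[OF l(1)]
  show "0 \<in> line l" "\<And>x y. x \<in> line l \<Longrightarrow> y \<in> line l \<Longrightarrow> x + y \<in> line l" "\<And>x. x \<in> line l \<Longrightarrow> - x \<in> line l"
    "\<And>a x. a \<in> K \<Longrightarrow> x \<in> line l \<Longrightarrow> sc a x \<in> line l"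
    using subspaceD[OF L] by auto
  show "finite (line l)" unfolding line_def using finite_K by simp
  show "\<exists>x \<in> line l. x \<noteq> 0" using line_self[OF l(1)] l(2) by (intro bexI[of _ l]) auto
  show "sc e x = x" if "x \<in> line l" for x using that subspaceD(1)[OF L] by auto
  show "dt x y \<in> K" if "x \<in> line l" "y \<in> line l" for x y
    using subsetD[OF subspaceD(1)[OF L] that(1)] subsetD[OF subspaceD(1)[OF L] that(2)] by simp
  show "x = 0" if x: "x \<in> line l" "\<And>y. y \<in> line l \<Longrightarrow> dt x y = 0" for x
  proof -
    obtain a where a: "a \<in> K" "x = sc a l" using x(1) by (auto simp: line_def)
    have "a * dt l l = 0" using x(2)[OF line_self[OF l(1)]] a by (simp add: dt_sc_left)
    then have "a = 0" using K_no_zero_div[OF a(1) dt_K[OF l(1) l(1)]] l(2) by blast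
    then show ?thesis using a by simp
  qed
qed (rule sc_add_left sc_add_right sc_mult dt_add_left dt_sym dt_sc_left)+

text \<open>An orthogonal basis. Completeness is expressed by a trivial orthogonal complement, which
  is what commuting with all members yields; spanning follows in
  \<open>frame_expand\<close>.\<close>

definition frame :: "'v set \<Rightarrow> bool" where
  "frame F \<longleftrightarrow> F \<subseteq> M \<and> (\<forall>l \<in> F. dt l l \<noteq> 0) \<and> (\<forall>l \<in> F. \<forall>l' \<in> F. l \<noteq> l' \<longrightarrow> dt l l' = 0) \<and>
     (\<forall>x \<in> M. (\<forall>l \<in> F. dt x l = 0) \<longrightarrow> x = 0)"

lemma M_sum: "(\<And>i. i \<in> S \<Longrightarrow> f i \<in> M) \<Longrightarrow> sum f S \<in> M"
  by (induction S rule: infinite_finite_induct) auto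

lemma dt_sum_left: "dt (sum f S) y = (\<Sum>i\<in>S. dt (f i) y)"
  by (induction S rule: infinite_finite_induct) (auto simp: dt_add_left)

lemma dt_sum_right: "dt y (sum f S) = (\<Sum>i\<in>S. dt y (f i))"
  by (induction S rule: infinite_finite_induct) (auto simp: dt_add_right)

lemma frame_finite: "frame F \<Longrightarrow> finite F"
  unfolding frame_def using finite_M finite_subset by blast

lemma frame_coeff:
  assumes F: "finite F" "F \<subseteq> M" "\<And>l l'. l \<in> F \<Longrightarrow> l' \<in> F \<Longrightarrow> l \<noteq> l' \<Longrightarrow> dt l l' = 0" and l: "l \<in> F"
  shows "dt (\<Sum>l\<in>F. sc (f l) l) l = f l * dt l l"
proof -
  have "dt (\<Sum>l\<in>F. sc (f l) l) l = (\<Sum>l'\<in>F. f l' * dt l' l)" by (simp add: dt_sum_left dt_sc_left)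
  also have "\<dots> = (\<Sum>l'\<in>F. if l' = l then f l * dt l l else 0)"
    by (rule sum.cong) (use F l in auto)
  finally show ?thesis using F l by simp
qed

lemma frame_expand:
  assumes F: "frame F" and x: "x \<in> M"
  shows "x = (\<Sum>l\<in>F. sc (dt x l * iv (dt l l)) l)"
proof -
  note F' = F[unfolded frame_def]
  have c: "dt x l * iv (dt l l) \<in> K" "iv (dt l l) * dt l l = e" if "l \<in> F" for l
    using F' that x iv[of "dt l l"] by (auto simp: subset_iff mult.commute)
  define y where "y = (\<Sum>l\<in>F. sc (dt x l * iv (dt l l)) l)"
  have y: "y \<in> M" unfolding y_def by (rule M_sum) (use c F' in auto)
  have "dt (x - y) l = 0" if l: "l \<in> F" for l
  proof -
    have "dt y l = dt x l * iv (dt l l) * dt l l" unfolding y_def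
      by (rule frame_coeff) (use F' l frame_finite[OF F] in auto)
    also have "\<dots> = dt x l" using c(2)[OF l] F' x l by (simp add: mult.assoc subset_iff)
    finally show ?thesis by (simp add: dt_diff_left)
  qed
  moreover have "x - y \<in> M" using x y by simp
  ultimately have "x - y = 0" using F' by blast
  then show ?thesis unfolding y_def by simp
qed

end

context cross_model
begin

lemma vec_lift: "u \<in> M \<times> M \<times> M \<Longrightarrow> \<exists>g \<in> carrier P. vec g = u"
  using coord_surj[of u 0] by (auto simp: zero_prod_def)

lemma Gr_inj:
  assumes "subspace L" "subspace L'" "Gr L \<subseteq> Gr L'" shows "L \<subseteq> L'"
proof
  fix x assume x: "x \<in> L"
  then have "(x, 0, 0) \<in> M \<times> M \<times> M" using subspaceD(1)[OF assms(1)] by auto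
  then obtain g where "g \<in> carrier P" "vec g = (x, 0, 0)" using vec_lift by blast
  then have "g \<in> Gr L" using x subspaceD(2)[OF assms(1)] by (simp add: Gr_def)
  then show "x \<in> L'" using assms(3) \<open>vec g = (x, 0, 0)\<close> by (auto simp: Gr_def)
qed

lemma Gr_M: "Gr M = carrier P"
  using vec_M by (auto simp: Gr_def)

lemma decomp_member:
  assumes "central_decomp P Hs" "H \<in> Hs"
  shows "\<exists>L. subspace L \<and> H = Gr L \<and> (\<exists>x \<in> L. x \<noteq> 0) \<and>
    (\<forall>x \<in> M. \<exists>y \<in> L. \<forall>l \<in> L. dt x l = dt y l)"
  using central_decomp_cofactor[OF assms] by (intro factor_structure[of H "cofactor Hs H"]) auto

text \<open>The projection property makes \<open>L\<close> nondegenerate, and as 2 is invertible it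
  contains some \<open>l\<close> of nonzero norm. Then \<open>L\<close> is the orthogonal sum of
  \<open>line l\<close> and the complement of \<open>l\<close>, which splits \<open>H\<close> into
  commuting factors; indecomposability leaves only the line.\<close>

lemma indecomposable_member:
  assumes cd: "central_decomp P Hs" and H: "H \<in> Hs" and ind: "centrally_indecomposable (P\<lparr>carrier := H\<rparr>)"
  shows "\<exists>l \<in> M. dt l l \<noteq> 0 \<and> H = Gr (line l)"
proof -
  obtain L where L: "subspace L" "H = Gr L" "\<exists>x \<in> L. x \<noteq> 0"
    "\<forall>x \<in> M. \<exists>y \<in> L. \<forall>l \<in> L. dt x l = dt y l" using decomp_member[OF cd H] by blast
  note Ls = subspaceD[OF L(1)]
  have "\<exists>l \<in> L. dt l l \<noteq> 0"
  proof (rule ccontr)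
    assume "\<not> (\<exists>l \<in> L. dt l l \<noteq> 0)"
    then have z: "dt l l = 0" if "l \<in> L" for l using that by blast
    have zz: "dt x y = 0" if "x \<in> L" "y \<in> L" for x y
    proof -
      have "dt (x + y) (x + y) = 0" using z Ls(3) that by blast
      then have "dt x y + dt x y = 0" using z that by (simp add: dt_add_left dt_add_right dt_sym)
      moreover have "dt x y \<in> K" using subsetD[OF Ls(1)] that by simp
      ultimately show ?thesis using K_double by blast
    qed
    obtain x where x: "x \<in> L" "x \<noteq> 0" using L(3) by blast
    have "x = 0"
    proof (rule nondeg)
      fix y assume "y \<in> M"
      then obtain y' where y': "y' \<in> L" "\<forall>l \<in> L. dt y l = dt y' l" using L(4) by blast
      then have "dt x y = dt x y'" using x dt_sym by metis
      then show "dt x y = 0" using zz x y' by simp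
    qed (use x Ls in auto)
    then show False using x by simp
  qed
  then obtain l where l: "l \<in> L" "dt l l \<noteq> 0" by blast
  then have lM: "l \<in> M" using Ls(1) by blast
  define L2 where "L2 = {x \<in> L. dt x l = 0}"
  have L2: "subspace L2" using Ls
    by (auto simp: subspace_def L2_def dt_add_left dt_uminus_left dt_sc_left)
  have line_L: "line l \<subseteq> L" using Ls(5) l by (auto simp: line_def)
  interpret S: group "P\<lparr>carrier := H\<rparr>" using subgroup_imp_group[OF Gr_subgroup[OF L(1)]] L(2) by simp
  have sub: "subgroup (Gr L') (P\<lparr>carrier := H\<rparr>)" if "subspace L'" "L' \<subseteq> L" for L'
    by (rule subgroup_incl[OF Gr_subgroup[OF that(1)]]) (use that Gr_subgroup L in \<open>auto simp: Gr_def\<close>)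
  have cK: "dt x l * iv (dt l l) \<in> K" if "x \<in> L" for x using that l lM Ls(1) iv(1)[of "dt l l"] by auto
  have split: "\<exists>u \<in> line l. \<exists>w \<in> L2. x = u + w" if x: "x \<in> L" for x
  proof -
    define u where "u = sc (dt x l * iv (dt l l)) l"
    have u: "u \<in> line l" unfolding u_def line_def using cK[OF x] by blast
    have "dt u l = dt x l * (iv (dt l l) * dt l l)" unfolding u_def by (simp add: dt_sc_left mult.assoc)
    also have "\<dots> = dt x l" using iv(2)[of "dt l l"] l lM x Ls(1) by (simp add: mult.commute subset_iff)
    finally have "dt (x - u) l = 0" by (simp add: dt_diff_left)
    moreover have "x - u \<in> L" using Ls(3)[OF x Ls(4)] u line_L by (metis diff_conv_add_uminus subsetD)
    ultimately have "x - u \<in> L2" by (simp add: L2_def)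
    moreover have "x = u + (x - u)" by simp
    ultimately show ?thesis using u by blast
  qed
  have "Gr (line l) = carrier (P\<lparr>carrier := H\<rparr>) \<or> Gr L2 = carrier (P\<lparr>carrier := H\<rparr>)"
  proof (rule S.indecomposable_two_factors[OF ind])
    show "subgroup (Gr (line l)) (P\<lparr>carrier := H\<rparr>)" using sub line_subspace[OF lM] line_L by blast
    show "subgroup (Gr L2) (P\<lparr>carrier := H\<rparr>)" using sub L2 by (auto simp: L2_def)
    have o: "dt u w = 0" if "u \<in> line l" "w \<in> L2" for u w
      using that dt_sym[of l w] by (auto simp: line_def L2_def dt_sc_left)
    then have o': "dt w u = 0" if "u \<in> line l" "w \<in> L2" for u w using that dt_sym by metis
    show "x \<otimes>\<^bsub>P\<lparr>carrier := H\<rparr>\<^esub> y = y \<otimes>\<^bsub>P\<lparr>carrier := H\<rparr>\<^esub> x" if "x \<in> Gr (line l)" "y \<in> Gr L2" for x y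
    proof -
      have "ct (vec x) (vec y) = 0" using that o by (auto simp: Gr_def ct_def zero_prod_def)
      then show ?thesis using commute_iff that by (simp add: Gr_def)
    qed
    fix x assume "x \<in> carrier (P\<lparr>carrier := H\<rparr>)"
    then have x: "x \<in> Gr L" using L(2) by simp
    then have xc: "x \<in> carrier P" by (simp add: Gr_def)
    obtain a b c where abc: "vec x = (a, b, c)" "a \<in> L" "b \<in> L" "c \<in> L" using x by (auto simp: Gr_def)
    obtain a1 a2 where a: "a1 \<in> line l" "a2 \<in> L2" "a = a1 + a2" using split abc by blast
    obtain b1 b2 where b: "b1 \<in> line l" "b2 \<in> L2" "b = b1 + b2" using split abc by blast
    obtain c1 c2 where c: "c1 \<in> line l" "c2 \<in> L2" "c = c1 + c2" using split abc by blast
    have "(a1, b1, c1) \<in> M \<times> M \<times> M" using a b c line_L Ls(1) by blast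
    then obtain g where g: "g \<in> carrier P" "vec g = (a1, b1, c1)" using vec_lift by blast
    have "vec (inv g \<otimes> x) = (a2, b2, c2)" using g xc abc a b c by (simp add: vec_mult vec_inv)
    then have "inv g \<otimes> x \<in> Gr L2" using g xc a b c by (simp add: Gr_def)
    moreover have "g \<in> Gr (line l)" using g a b c by (simp add: Gr_def)
    moreover have "x = g \<otimes> (inv g \<otimes> x)" using g xc by (simp add: m_assoc[symmetric])
    ultimately show "\<exists>a \<in> Gr (line l). \<exists>b \<in> Gr L2. x = a \<otimes>\<^bsub>P\<lparr>carrier := H\<rparr>\<^esub> b" by auto
  qed
  moreover have "Gr L2 \<noteq> H"
  proof
    assume "Gr L2 = H"
    then have "L \<subseteq> L2" using Gr_inj[OF L(1) L2] L(2) by simp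
    then show False using l by (auto simp: L2_def)
  qed
  ultimately show ?thesis using l lM by auto
qed

text \<open>The subgroup over a line is itself a cross product group, over a space of dimension one.
  Every member of a decomposition of it belongs to a nonzero subspace of the line, that is, to the
  line.\<close>

lemma line_indecomposable:
  assumes l: "l \<in> M" "dt l l \<noteq> 0"
  shows "centrally_indecomposable (P\<lparr>carrier := Gr (line l)\<rparr>)"
proof -
  let ?H = "Gr (line l)"
  note Ls = subspaceD[OF line_subspace[OF l(1)]]
  have HP: "subgroup ?H P" by (rule Gr_subgroup[OF line_subspace[OF l(1)]])
  interpret Q: quad_space e p "line l" sc dt by (rule line_quad_space[OF l])
  interpret G: group "P\<lparr>carrier := ?H\<rparr>" by (rule subgroup_imp_group[OF HP])
  have sQ: "Q.ct = ct" by (simp add: Q.ct_def ct_def fun_eq_iff)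
  interpret S: cross_model e p "line l" sc dt "P\<lparr>carrier := ?H\<rparr>" vec cen
  proof
    show "\<exists>g \<in> carrier (P\<lparr>carrier := ?H\<rparr>). vec g = u \<and> cen g = t"
      if u: "u \<in> line l \<times> line l \<times> line l" "t \<in> K \<times> K \<times> K" for u t
    proof -
      have "u \<in> M \<times> M \<times> M" using u(1) Ls(1) by blast
      from coord_surj[OF this u(2)] obtain g where "g \<in> carrier P" "vec g = u" "cen g = t" by blast
      then show ?thesis using u(1) by (auto simp: Gr_def)
    qed
    fix g assume g: "g \<in> carrier (P\<lparr>carrier := ?H\<rparr>)"
    then have gP: "g \<in> carrier P" by (simp add: Gr_def)
    show "vec g \<in> line l \<times> line l \<times> line l" using g by (simp add: Gr_def)
    show "cen g \<in> K \<times> K \<times> K" using cen_K[OF gP] .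
    fix h assume h: "h \<in> carrier (P\<lparr>carrier := ?H\<rparr>)"
    then have hP: "h \<in> carrier P" by (simp add: Gr_def)
    show "g = h" if "vec g = vec h" "cen g = cen h" using coord_inj[OF gP hP that] .
    show "vec (g \<otimes>\<^bsub>P\<lparr>carrier := ?H\<rparr>\<^esub> h) = vec g + vec h" using vec_mult[OF gP hP] by simp
    show "cen (g \<otimes>\<^bsub>P\<lparr>carrier := ?H\<rparr>\<^esub> h) = cen g + cen h + Q.ct (vec g) (vec h)"
      using cen_mult[OF gP hP] sQ by simp
  qed
  have ne: "?H \<noteq> {\<one>}"
  proof
    assume "?H = {\<one>}"
    then have "Gr (line l) \<subseteq> Gr {0}" by (simp add: Gr_def vec_one zero_prod_def)
    moreover have "subspace {0}" by (simp add: subspace_def)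
    ultimately have "line l \<subseteq> {0}" using Gr_inj line_subspace[OF l(1)] by blast
    then show False using line_self[OF l(1)] l(2) by auto
  qed
  \<comment> \<open>Excludes the empty family in both directions: as a decomposition, and as a
    smaller generating subset.\<close>
  have em: "generate (P\<lparr>carrier := ?H\<rparr>) {} \<noteq> ?H" using G.generate_empty ne by simp
  show ?thesis
    unfolding centrally_indecomposable_def
  proof (intro allI iffI)
    fix Js assume cd: "central_decomp (P\<lparr>carrier := ?H\<rparr>) Js"
    have "J = ?H" if J: "J \<in> Js" for J
    proof -
      obtain L where L: "Q.subspace L" "J = S.Gr L" "\<exists>x \<in> L. x \<noteq> 0" using S.decomp_member[OF cd J] by blast
      obtain x where x: "x \<in> L" "x \<noteq> 0" using L by blast
      then obtain a where a: "a \<in> K" "x = sc a l" using Q.subspaceD(1)[OF L(1)] by (auto simp: line_def)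
      have a0: "a \<noteq> 0" using a x by auto
      have "line l \<subseteq> L"
      proof
        fix y assume "y \<in> line l"
        then obtain b where b: "b \<in> K" "y = sc b l" by (auto simp: line_def)
        have "y = sc (b * iv a) x" using a b iv(2)[OF a(1) a0]
          by (simp add: sc_mult[symmetric] mult.assoc) (metis K_unit(2) mult.commute)
        then show "y \<in> L" using Q.subspaceD(5)[OF L(1) _ x(1)] iv(1)[OF a(1) a0] b by simp
      qed
      then have "L = line l" using Q.subspaceD(1)[OF L(1)] by blast
      then show ?thesis using L(2) S.Gr_M by simp
    qed
    moreover have "Js \<noteq> {}"
    proof
      assume "Js = {}"
      then show False using cd em by (simp add: central_decomp_def)
    qed
    ultimately show "Js = {carrier (P\<lparr>carrier := ?H\<rparr>)}" by auto
  next
    fix Js assume Js: "Js = {carrier (P\<lparr>carrier := ?H\<rparr>)}"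
    have "generate (P\<lparr>carrier := ?H\<rparr>) ?H = ?H"
      using G.generate_subgroup_incl[of ?H ?H] G.subgroup_self generate.incl[of _ ?H "P\<lparr>carrier := ?H\<rparr>"] by auto
    moreover have "generate (P\<lparr>carrier := ?H\<rparr>) (\<Union> Ks) \<noteq> ?H" if "Ks \<subset> Js" for Ks
    proof -
      have "\<Union> Ks = {}" using that Js by auto
      then show ?thesis using em by metis
    qed
    ultimately show "central_decomp (P\<lparr>carrier := ?H\<rparr>) Js"
      using Js G.subgroup_self unfolding central_decomp_def by simp
  qed
qed

abbreviation Grl :: "'v \<Rightarrow> 'a set" where "Grl l \<equiv> Gr (line l)"

lemma Grl_inj:
  assumes F: "frame F" shows "inj_on Grl F"
proof (rule inj_onI, rule ccontr)
  fix l l' assume h: "l \<in> F" "l' \<in> F" "Grl l = Grl l'" "l \<noteq> l'"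
  note F' = F[unfolded frame_def]
  have M: "l \<in> M" "l' \<in> M" using F' h by auto
  have "line l \<subseteq> line l'" using Gr_inj line_subspace M h(3) by simp
  then obtain a where "l = sc a l'" using line_self[OF M(1)] by (auto simp: line_def)
  then have "dt l l = a * dt l' l" using dt_sc_left by metis
  then show False using F' h by auto
qed

text \<open>Each member contributes a spanning vector of its line. Members commute, so these vectors
  are orthogonal; a vector orthogonal to all of them gives an element that commutes with a
  generating set, so it is central and has vector part zero.\<close>

lemma fully_refined_frame:
  assumes fr: "fully_refined P Hs"
  shows "\<exists>F. frame F \<and> Hs = Grl ` F"
proof -
  have cd: "central_decomp P Hs" and ind: "\<And>H. H \<in> Hs \<Longrightarrow> centrally_indecomposable (P\<lparr>carrier := H\<rparr>)"
    using fr by (auto simp: fully_refined_def)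
  note cd' = cd[unfolded central_decomp_def]
  define f where "f H = (SOME l. l \<in> M \<and> dt l l \<noteq> 0 \<and> H = Grl l)" for H
  have f: "f H \<in> M" "dt (f H) (f H) \<noteq> 0" "H = Grl (f H)" if "H \<in> Hs" for H
    using someI_ex[of "\<lambda>l. l \<in> M \<and> dt l l \<noteq> 0 \<and> H = Grl l"] indecomposable_member[OF cd that ind[OF that]]
    unfolding f_def by blast+
  have "frame (f ` Hs)"
    unfolding frame_def
  proof (intro conjI ballI impI)
    show "f ` Hs \<subseteq> M" using f by auto
    show "dt l l \<noteq> 0" if "l \<in> f ` Hs" for l using that f by auto
    show "dt l l' = 0" if h: "l \<in> f ` Hs" "l' \<in> f ` Hs" "l \<noteq> l'" for l l'
    proof -
      obtain H H' where H: "H \<in> Hs" "H' \<in> Hs" "l = f H" "l' = f H'" "H \<noteq> H'" using h by auto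
      \<comment> \<open>Two different axes are used because the cross product of vectors on one axis
        is zero.\<close>
      have "(l, 0, 0) \<in> M \<times> M \<times> M" "(0, l', 0) \<in> M \<times> M \<times> M" using f H by auto
      then obtain g g' where g: "g \<in> carrier P" "vec g = (l, 0, 0)" "g' \<in> carrier P" "vec g' = (0, l', 0)"
        using vec_lift by meson
      have "g \<in> H" "g' \<in> H'"
        using g f(1,3)[OF H(1)] f(1,3)[OF H(2)] H(3,4) line_self subspaceD(2)[OF line_subspace] by (auto simp: Gr_def)
      then have "g \<otimes> g' = g' \<otimes> g" using cd' H by simp
      then have "ct (vec g) (vec g') = 0" using commute_iff g by blast
      then show ?thesis using g by (simp add: ct_def zero_prod_def)
    qed
    show "x = 0" if x: "x \<in> M" "\<forall>l \<in> f ` Hs. dt x l = 0" for x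
    proof -
      obtain g where g: "g \<in> carrier P" "vec g = (x, 0, 0)" using vec_lift[of "(x, 0, 0)"] x by auto
      have subs: "subgroup H P" if "H \<in> Hs" for H using cd' that by simp
      have sc: "\<Union> Hs \<subseteq> carrier P" using subgroup.subset[OF subs] by blast
      have gen: "generate P (\<Union> Hs) = carrier P" using cd' by simp
      have "g \<otimes> h = h \<otimes> g" if hh: "h \<in> \<Union> Hs" for h
      proof -
        obtain H where H: "H \<in> Hs" "h \<in> H" using hh by blast
        then have h: "h \<in> Grl (f H)" using f by blast
        have "dt x y = 0" if "y \<in> line (f H)" for y
          using that x H by (auto simp: line_def dt_sc_right)
        then have "ct (vec g) (vec h) = 0" using h g by (auto simp: Gr_def ct_def zero_prod_def)
        then show ?thesis using commute_iff g h by (simp add: Gr_def)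
      qed
      then have "\<forall>h \<in> carrier P. g \<otimes> h = h \<otimes> g"
        using commutes_generate[OF sc g(1)] gen by blast
      then have "vec g = 0" using central_iff[OF g(1)] by blast
      then show ?thesis using g by (simp add: zero_prod_def)
    qed
  qed
  moreover have "Hs = Grl ` f ` Hs" using f(3) by (auto simp: image_iff)
  ultimately show ?thesis by blast
qed

text \<open>Expansion along the frame reaches every vector part, and the central elements lie in
  each member, so the members generate. If a family without the member of \<open>l\<close>
  generated, an element over \<open>(l, 0, 0)\<close> would commute with everything and so be
  central.\<close>

lemma frame_fully_refined:
  assumes F: "frame F" shows "fully_refined P (Grl ` F)"
proof -
  note F' = F[unfolded frame_def]
  have sub: "subgroup (Grl l) P" if "l \<in> F" for l using F' that Gr_subgroup line_subspace by blast
  have orth: "dt x y = 0" if "l \<in> F" "l' \<in> F" "l \<noteq> l'" "x \<in> line l" "y \<in> line l'" for l l' x y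
    using that F' by (auto simp: line_def dt_sc_left dt_sc_right)
  have comm: "x \<otimes> y = y \<otimes> x" if "l \<in> F" "l' \<in> F" "l \<noteq> l'" "x \<in> Grl l" "y \<in> Grl l'" for l l' x y
  proof -
    have "ct (vec x) (vec y) = 0" using orth[OF that(1-3)] that by (auto simp: Gr_def ct_def zero_prod_def)
    then show ?thesis using commute_iff that by (simp add: Gr_def)
  qed
  have sc: "\<Union> (Grl ` F) \<subseteq> carrier P" by (auto simp: Gr_def)
  define N where "N = generate P (\<Union> (Grl ` F))"
  have N: "subgroup N P" unfolding N_def by (rule generate_is_subgroup[OF sc])
  have GN: "Grl l \<subseteq> N" if "l \<in> F" for l unfolding N_def using that by (intro subsetI generate.incl) blast
  have "F \<noteq> {}" using F' M_nontriv by blast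
  then obtain l0 where l0: "l0 \<in> F" by blast
  have z: "g \<in> N" if "g \<in> carrier P" "vec g = 0" for g
  proof -
    have "l0 \<in> M" using F' l0 by blast
    then have "g \<in> Grl l0" using that subspaceD(2)[OF line_subspace, of l0] by (auto simp: Gr_def zero_prod_def)
    then show ?thesis using GN[OF l0] by blast
  qed
  have coord: "\<exists>g \<in> N. vec g = (sc a l, sc b l, sc c l)" if l: "l \<in> F" and K: "a \<in> K" "b \<in> K" "c \<in> K" for l a b c
  proof -
    have "(sc a l, sc b l, sc c l) \<in> M \<times> M \<times> M" using F' l K by auto
    then obtain g where g: "g \<in> carrier P" "vec g = (sc a l, sc b l, sc c l)" using vec_lift by blast
    then have "g \<in> Grl l" using K by (auto simp: Gr_def line_def)
    then show ?thesis using GN[OF l] g by blast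
  qed
  have span: "\<exists>g \<in> N. vec g = (\<Sum>l\<in>S. (sc (f l) l, sc (f' l) l, sc (f'' l) l))"
    if S: "finite S" "S \<subseteq> F" and fK: "\<And>l. l \<in> F \<Longrightarrow> f l \<in> K \<and> f' l \<in> K \<and> f'' l \<in> K" for S f f' f''
    using S
  proof (induction S)
    case empty
    show ?case using subgroup.one_closed[OF N] by (intro bexI[of _ \<one>]) (simp_all add: vec_one)
  next
    case (insert l S)
    then obtain g where g: "g \<in> N" "vec g = (\<Sum>l\<in>S. (sc (f l) l, sc (f' l) l, sc (f'' l) l))" by auto
    obtain h where h: "h \<in> N" "vec h = (sc (f l) l, sc (f' l) l, sc (f'' l) l)"
      using coord[of l "f l" "f' l" "f'' l"] fK[of l] insert by auto
    have "vec (h \<otimes> g) = vec h + vec g" using g h vec_mult subgroup.mem_carrier[OF N] by blast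
    then show ?case using insert g h subgroup.m_closed[OF N h(1) g(1)] by (intro bexI[of _ "h \<otimes> g"]) auto
  qed
  have "carrier P \<subseteq> N"
  proof
    fix g assume g: "g \<in> carrier P"
    obtain a b c where abc: "vec g = (a, b, c)" "a \<in> M" "b \<in> M" "c \<in> M" using vec_M[OF g] by auto
    have k: "dt x l * iv (dt l l) \<in> K" if "x \<in> M" "l \<in> F" for x l
      using F' that iv(1)[of "dt l l"] by auto
    have "vec g = (\<Sum>l\<in>F. (sc (dt a l * iv (dt l l)) l, sc (dt b l * iv (dt l l)) l, sc (dt c l * iv (dt l l)) l))"
      using frame_expand[OF F abc(2)] frame_expand[OF F abc(3)] frame_expand[OF F abc(4)] abc(1)
      by (simp add: prod_eq_iff fst_sum snd_sum)
    then obtain h where h: "h \<in> N" "vec h = vec g"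
      using span[OF frame_finite[OF F] subset_refl, of "\<lambda>l. dt a l * iv (dt l l)" "\<lambda>l. dt b l * iv (dt l l)"
          "\<lambda>l. dt c l * iv (dt l l)"] k abc by auto
    have hc: "h \<in> carrier P" using subgroup.mem_carrier[OF N h(1)] .
    have "vec (inv h \<otimes> g) = 0" using g hc h by (simp add: vec_mult vec_inv)
    then have "inv h \<otimes> g \<in> N" using z g hc by simp
    then have "h \<otimes> (inv h \<otimes> g) \<in> N" using subgroup.m_closed[OF N h(1)] by blast
    then show "g \<in> N" using g hc by (simp add: m_assoc[symmetric])
  qed
  then have gen: "generate P (\<Union> (Grl ` F)) = carrier P" using subgroup.subset[OF N] unfolding N_def by blast
  have min: "generate P (\<Union> Ks) \<noteq> carrier P" if Ks: "Ks \<subset> Grl ` F" for Ks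
  proof
    assume g: "generate P (\<Union> Ks) = carrier P"
    obtain l where l: "l \<in> F" "Grl l \<notin> Ks" using Ks by blast
    have sK: "\<Union> Ks \<subseteq> carrier P" using Ks sc by blast
    obtain x where x: "x \<in> carrier P" "vec x = (l, 0, 0)" using vec_lift[of "(l, 0, 0)"] l F' by auto
    have xl: "x \<in> Grl l" using x line_self subspaceD(2)[OF line_subspace] l F' by (auto simp: Gr_def)
    have "x \<otimes> s = s \<otimes> x" if s: "s \<in> \<Union> Ks" for s
    proof -
      obtain l' where l': "l' \<in> F" "Grl l' \<in> Ks" "s \<in> Grl l'" using s Ks by blast
      then show ?thesis using comm[OF l(1) l'(1) _ xl l'(3)] l by blast
    qed
    then have "\<forall>c \<in> carrier P. x \<otimes> c = c \<otimes> x" using commutes_generate[OF sK x(1)] g by blast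
    then have "vec x = 0" using central_iff[OF x(1)] by blast
    then show False using x l F' by (auto simp: zero_prod_def)
  qed
  have "central_decomp P (Grl ` F)"
    unfolding central_decomp_def
  proof (intro conjI ballI impI allI)
    show "subgroup H P" if "H \<in> Grl ` F" for H using that sub by blast
    show "x \<otimes> y = y \<otimes> x" if "H \<in> Grl ` F" "H' \<in> Grl ` F" "H \<noteq> H'" "x \<in> H" "y \<in> H'" for H H' x y
      using that comm by blast
  qed (use gen min in auto)
  then show ?thesis unfolding fully_refined_def using line_indecomposable F' by blast
qed

end

section \<open>Automorphisms and orthogonal bases\<close>

context prime_field
begin

lemma sq_ratio:
  assumes x: "x \<in> K" "x \<noteq> 0" and y: "y \<in> K" "y \<noteq> 0" and "sq x \<longleftrightarrow> sq y"
  shows "\<exists>b \<in> K. b \<noteq> 0 \<and> x = b * b * y"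
proof -
  have "sq (x * y)" using sq_mult_iff[OF x y] assms(5) by simp
  then obtain c where c: "c \<in> K" "c \<noteq> 0" "x * y = c * c" unfolding sq_def by blast
  have i: "iv y \<in> K" "y * iv y = e" using iv[OF y] .
  have "(c * iv y) * (c * iv y) * y = (c * c) * (y * iv y) * iv y" by (simp add: algebra_simps)
  also have "\<dots> = x * (y * iv y)" unfolding c(3)[symmetric] i(2) using i x y K_unit(2)[of "x * y"] by (simp add: mult.assoc)
  also have "\<dots> = x" using i x by simp
  finally have "x = (c * iv y) * (c * iv y) * y" ..
  moreover have "c * iv y \<noteq> 0" using calculation x(2) by auto
  ultimately show ?thesis using c(1) i(1) K_mult by blast
qed

text \<open>The 3 by 3 determinant, as the triple product of \<open>a\<close> with the cross product
  of \<open>b\<close> and \<open>c\<close>.\<close>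

definition det3 :: "'k \<times> 'k \<times> 'k \<Rightarrow> 'k \<times> 'k \<times> 'k \<Rightarrow> 'k \<times> 'k \<times> 'k \<Rightarrow> 'k" where
  "det3 = (\<lambda>(a1, a2, a3) (b1, b2, b3) (c1, c2, c3).
     a1 * (b2 * c3 - b3 * c2) + a2 * (b3 * c1 - b1 * c3) + a3 * (b1 * c2 - b2 * c1))"

end

context quad_space
begin

text \<open>Rescaling a vector by a nonzero scalar multiplies its norm by a square, so for a frame
  this number depends only on the lines.\<close>

definition nsq :: "'v set \<Rightarrow> nat" where "nsq F = card {l \<in> F. \<not> sq (dt l l)}"

lemma gram:
  assumes "finite F" "\<And>l l'. l \<in> F \<Longrightarrow> l' \<in> F \<Longrightarrow> l \<noteq> l' \<Longrightarrow> dt (\<tau> l) (\<tau> l') = 0"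
    "\<And>l. l \<in> F \<Longrightarrow> dt (\<tau> l) (\<tau> l) = dt l l"
  shows "dt (\<Sum>l\<in>F. sc (f l) (\<tau> l)) (\<Sum>l\<in>F. sc (g l) (\<tau> l)) = (\<Sum>l\<in>F. f l * (g l * dt l l))"
proof -
  have "dt (\<Sum>l\<in>F. sc (f l) (\<tau> l)) (\<Sum>l\<in>F. sc (g l) (\<tau> l)) =
      (\<Sum>l\<in>F. \<Sum>l'\<in>F. f l * (g l' * dt (\<tau> l) (\<tau> l')))"
    by (simp only: dt_sum_left dt_sc_left) (simp add: dt_sum_right dt_sc_right sum_distrib_left)
  also have "\<dots> = (\<Sum>l\<in>F. \<Sum>l'\<in>F. if l' = l then f l * (g l * dt l l) else 0)"
    by (intro sum.cong) (use assms in auto)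
  also have "\<dots> = (\<Sum>l\<in>F. f l * (g l * dt l l))" using assms(1) by simp
  finally show ?thesis .
qed

lemma sc_sum: "sc a (sum f S) = (\<Sum>i\<in>S. sc a (f i))"
  by (induction S rule: infinite_finite_induct) (auto simp: sc_add_right)

end

context cross_model
begin

lemma finite_carrier: "finite (carrier P)"
proof (rule inj_on_finite)
  show "inj_on (\<lambda>g. (vec g, cen g)) (carrier P)" using coord_inj by (auto intro: inj_onI)
  show "(\<lambda>g. (vec g, cen g)) ` carrier P \<subseteq> (M \<times> M \<times> M) \<times> (K \<times> K \<times> K)"
    by (intro image_subsetI SigmaI vec_M cen_K)
  show "finite ((M \<times> M \<times> M) \<times> (K \<times> K \<times> K))" using finite_M finite_K by simp
qed

text \<open>Sending an orthogonal basis to orthogonal vectors of the same norms extends linearly to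
  an isometry. Applied on each axis it preserves \<open>ct\<close>, so keeping the central part
  fixed gives an automorphism.\<close>

lemma isometry_auto:
  assumes F: "frame F" and tM: "\<And>l. l \<in> F \<Longrightarrow> \<tau> l \<in> M"
    and orth: "\<And>l l'. l \<in> F \<Longrightarrow> l' \<in> F \<Longrightarrow> l \<noteq> l' \<Longrightarrow> dt (\<tau> l) (\<tau> l') = 0"
    and nrm: "\<And>l. l \<in> F \<Longrightarrow> dt (\<tau> l) (\<tau> l) = dt l l"
  shows "\<exists>\<alpha> \<in> auto P. \<forall>l \<in> F. \<alpha> ` Grl l = Grl (\<tau> l)"
proof -
  note F' = F[unfolded frame_def]
  have FM: "l \<in> M" if "l \<in> F" for l using F' that by blast
  have fin: "finite F" by (rule frame_finite[OF F])
  define c where "c x l = dt x l * iv (dt l l)" for x l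
  define T where "T x = (\<Sum>l\<in>F. sc (c x l) (\<tau> l))" for x
  have ivK: "iv (dt l l) \<in> K" "dt l l * iv (dt l l) = e" if "l \<in> F" for l
    using iv[of "dt l l"] F' that FM[OF that] by auto
  have cK: "c x l \<in> K" if "x \<in> M" "l \<in> F" for x l unfolding c_def using that ivK FM by simp
  have TM: "T x \<in> M" if "x \<in> M" for x unfolding T_def by (rule M_sum) (use cK tM that in simp)
  have Tadd: "T (x + y) = T x + T y" for x y
    unfolding T_def c_def by (simp add: dt_add_left distrib_right sc_add_left sum.distrib)
  have Tsc: "T (sc a x) = sc a (T x)" for a x
    unfolding T_def c_def by (simp add: sc_sum sc_mult[symmetric] dt_sc_left mult.assoc)
  have Tiso: "dt (T x) (T y) = dt x y" if "x \<in> M" "y \<in> M" for x y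
  proof -
    have "dt (T x) (T y) = (\<Sum>l\<in>F. c x l * (c y l * dt l l))"
      unfolding T_def by (rule gram[OF fin orth nrm])
    also have "\<dots> = dt (\<Sum>l\<in>F. sc (c x l) l) (\<Sum>l\<in>F. sc (c y l) l)"
      by (rule gram[OF fin, of "\<lambda>l. l", symmetric]) (use F' in auto)
    also have "\<dots> = dt x y" using frame_expand[OF F that(1)] frame_expand[OF F that(2)] by (simp add: c_def)
    finally show ?thesis .
  qed
  have Tl: "T l = \<tau> l" if l: "l \<in> F" for l
  proof -
    have "T l = (\<Sum>l'\<in>F. if l' = l then \<tau> l else 0)" unfolding T_def
      by (rule sum.cong) (use F' l ivK tM in \<open>auto simp: c_def\<close>)
    then show ?thesis using fin l by simp
  qed
  have T0: "T 0 = 0" using Tadd[of 0 0] by simp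
  have Tinj: "x = y" if xy: "x \<in> M" "y \<in> M" "T x = T y" for x y
  proof (rule dt_eqI[OF xy(1,2)])
    show "dt x z = dt y z" if "z \<in> M" for z using Tiso xy that by metis
  qed
  define T3 where "T3 = (\<lambda>(a, b, c). (T a, T b, T c))"
  have T3M: "T3 u \<in> M \<times> M \<times> M" if "u \<in> M \<times> M \<times> M" for u using that TM by (auto simp: T3_def)
  have T3add: "T3 (u + v) = T3 u + T3 v" for u v by (cases u, cases v) (simp add: T3_def Tadd)
  have T3ct: "ct (T3 u) (T3 v) = ct u v" if "u \<in> M \<times> M \<times> M" "v \<in> M \<times> M \<times> M" for u v
    using that by (auto simp: T3_def ct_def Tiso)
  have T3inj: "u = v" if "u \<in> M \<times> M \<times> M" "v \<in> M \<times> M \<times> M" "T3 u = T3 v" for u v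
    using that Tinj by (auto simp: T3_def)
  \<comment> \<open>Restricted to the carrier because members of \<open>auto\<close> are
    extensional.\<close>
  define \<alpha> where "\<alpha> = (\<lambda>g \<in> carrier P. SOME h. h \<in> carrier P \<and> vec h = T3 (vec g) \<and> cen h = cen g)"
  have al: "\<alpha> g \<in> carrier P \<and> vec (\<alpha> g) = T3 (vec g) \<and> cen (\<alpha> g) = cen g" if g: "g \<in> carrier P" for g
  proof -
    have "\<exists>h. h \<in> carrier P \<and> vec h = T3 (vec g) \<and> cen h = cen g"
      using coord_surj[OF T3M[OF vec_M[OF g]] cen_K[OF g]] by blast
    from someI_ex[OF this] show ?thesis using g by (simp add: \<alpha>_def)
  qed
  have "\<alpha> (g \<otimes> h) = \<alpha> g \<otimes> \<alpha> h" if "g \<in> carrier P" "h \<in> carrier P" for g h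
    by (rule coord_inj) (use that al T3ct vec_M in \<open>simp_all add: vec_mult cen_mult T3add\<close>)
  then have hom: "\<alpha> \<in> hom P P" using al by (auto simp: hom_def)
  have inj: "inj_on \<alpha> (carrier P)"
  proof (rule inj_onI)
    fix g h assume gh: "g \<in> carrier P" "h \<in> carrier P" "\<alpha> g = \<alpha> h"
    then have "T3 (vec g) = T3 (vec h)" "cen g = cen h" using al by metis+
    then show "g = h" using coord_inj[OF gh(1,2)] T3inj[OF vec_M[OF gh(1)] vec_M[OF gh(2)]] by blast
  qed
  have "\<alpha> ` carrier P \<subseteq> carrier P" using al by blast
  then have "\<alpha> ` carrier P = carrier P" using endo_inj_surj[OF finite_carrier _ inj] by blast
  then have aut: "\<alpha> \<in> auto P" using hom inj by (auto simp: auto_def Bij_def bij_betw_def \<alpha>_def)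
  have "\<alpha> ` Grl l = Grl (\<tau> l)" if l: "l \<in> F" for l
  proof
    have Tline: "T x \<in> line (\<tau> l)" if "x \<in> line l" for x
      using that Tsc Tl[OF l] by (auto simp: line_def)
    show "\<alpha> ` Grl l \<subseteq> Grl (\<tau> l)" using al Tline by (auto simp: Gr_def T3_def split: prod.splits)
    show "Grl (\<tau> l) \<subseteq> \<alpha> ` Grl l"
    proof
      fix h assume h: "h \<in> Grl (\<tau> l)"
      then obtain a b d where abd: "vec h = (sc a (\<tau> l), sc b (\<tau> l), sc d (\<tau> l))" "a \<in> K" "b \<in> K" "d \<in> K"
        by (auto simp: Gr_def line_def)
      have hP: "h \<in> carrier P" using h by (simp add: Gr_def)
      have "(sc a l, sc b l, sc d l) \<in> M \<times> M \<times> M" using abd FM[OF l] by simp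
      from coord_surj[OF this cen_K[OF hP]] obtain g where
        g: "g \<in> carrier P" "vec g = (sc a l, sc b l, sc d l)" "cen g = cen h" by blast
      have "h = \<alpha> g" by (rule coord_inj) (use hP al[OF g(1)] g abd Tl[OF l] in \<open>simp_all add: T3_def Tsc\<close>)
      moreover have "g \<in> Grl l" using g abd by (auto simp: Gr_def line_def)
      ultimately show "h \<in> \<alpha> ` Grl l" by blast
    qed
  qed
  then show ?thesis using aut by blast
qed

lemma line_sc:
  assumes "b \<in> K" "b \<noteq> 0" shows "line (sc b l) = line l"
proof -
  have "sc a (sc b l) = sc (a * b) l" for a by (simp add: sc_mult)
  then have 1: "line (sc b l) \<subseteq> line l" using assms by (auto simp: line_def)
  have "sc a l = sc (a * iv b) (sc b l)" if "a \<in> K" for a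
    using iv(2)[OF assms] that by (simp add: sc_mult[symmetric] mult.assoc mult.commute[of "iv b"])
  then have "line l \<subseteq> line (sc b l)" using iv(1)[OF assms] by (auto simp: line_def)
  then show ?thesis using 1 by blast
qed

text \<open>Vectors are matched so that norms agree up to squares, which the equal counts of
  nonsquare norms permit; rescaling then makes the norms equal without changing the lines.\<close>

lemma frames_conjugate:
  assumes F: "frame F" and F': "frame F'" and card: "card F = card F'" and nsq: "nsq F = nsq F'"
  shows "\<exists>\<alpha> \<in> auto P. act_decomp \<alpha> (Grl ` F) = Grl ` F'"
proof -
  note Fd = F[unfolded frame_def] and Fd' = F'[unfolded frame_def]
  have fin: "finite F" "finite F'" using frame_finite F F' by auto
  define N where "N = {l \<in> F. \<not> sq (dt l l)}"
  define N' where "N' = {l \<in> F'. \<not> sq (dt l l)}"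
  have cN: "card N = card N'" using nsq by (simp add: nsq_def N_def N'_def)
  have sub: "N \<subseteq> F" "N' \<subseteq> F'" by (auto simp: N_def N'_def)
  have "card (F - N) = card (F' - N')"
    using cN card sub fin by (simp add: card_Diff_subset finite_subset)
  then obtain f where f: "bij_betw f (F - N) (F' - N')"
    using finite_same_card_bij[of "F - N" "F' - N'"] fin by auto
  obtain g where g: "bij_betw g N N'" using finite_same_card_bij[of N N'] fin sub cN finite_subset by metis
  define \<sigma> where "\<sigma> l = (if l \<in> N then g l else f l)" for l
  have "bij_betw \<sigma> N N' \<longleftrightarrow> bij_betw g N N'" by (rule bij_betw_cong) (simp add: \<sigma>_def)
  then have "bij_betw \<sigma> N N'" using g by simp
  moreover have "bij_betw \<sigma> (F - N) (F' - N') \<longleftrightarrow> bij_betw f (F - N) (F' - N')"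
    by (rule bij_betw_cong) (simp add: \<sigma>_def)
  then have "bij_betw \<sigma> (F - N) (F' - N')" using f by simp
  ultimately have "bij_betw \<sigma> (N \<union> (F - N)) (N' \<union> (F' - N'))" by (rule bij_betw_combine) auto
  then have bij: "bij_betw \<sigma> F F'" using sub by (simp add: Un_absorb1)
  have sqs: "sq (dt (\<sigma> l) (\<sigma> l)) \<longleftrightarrow> sq (dt l l)" if l: "l \<in> F" for l
    using bij_betwE[OF f] bij_betwE[OF g] l by (auto simp: \<sigma>_def N_def N'_def)
  have sF: "\<sigma> l \<in> F'" if "l \<in> F" for l using bij_betwE[OF bij] that by blast
  have ex: "\<exists>b \<in> K. b \<noteq> 0 \<and> dt l l = b * b * dt (\<sigma> l) (\<sigma> l)" if l: "l \<in> F" for l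
  proof (rule sq_ratio)
    have "l \<in> M" "\<sigma> l \<in> M" using Fd Fd' l sF[OF l] by auto
    then show "dt l l \<in> K" "dt (\<sigma> l) (\<sigma> l) \<in> K" by auto
    show "dt l l \<noteq> 0" "dt (\<sigma> l) (\<sigma> l) \<noteq> 0" using Fd Fd' l sF[OF l] by auto
  qed (use sqs l in simp)
  define b where "b l = (SOME b. b \<in> K \<and> b \<noteq> 0 \<and> dt l l = b * b * dt (\<sigma> l) (\<sigma> l))" for l
  have b: "b l \<in> K" "b l \<noteq> 0" "dt l l = b l * b l * dt (\<sigma> l) (\<sigma> l)" if "l \<in> F" for l
    using someI_ex[of "\<lambda>b. b \<in> K \<and> b \<noteq> 0 \<and> dt l l = b * b * dt (\<sigma> l) (\<sigma> l)"] ex[OF that] unfolding b_def by blast+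
  have inj: "inj_on \<sigma> F" using bij by (simp add: bij_betw_def)
  have "\<exists>\<alpha> \<in> auto P. \<forall>l \<in> F. \<alpha> ` Grl l = Grl (sc (b l) (\<sigma> l))"
  proof (rule isometry_auto[OF F])
    show "sc (b l) (\<sigma> l) \<in> M" if "l \<in> F" for l using b(1)[OF that] sF[OF that] Fd' by auto
    show "dt (sc (b l) (\<sigma> l)) (sc (b l') (\<sigma> l')) = 0" if "l \<in> F" "l' \<in> F" "l \<noteq> l'" for l l'
    proof -
      have "\<sigma> l \<noteq> \<sigma> l'" using inj that by (auto simp: inj_on_def)
      then have "dt (\<sigma> l) (\<sigma> l') = 0" using Fd' sF that by blast
      then show ?thesis by (simp add: dt_sc_left dt_sc_right)
    qed
    show "dt (sc (b l) (\<sigma> l)) (sc (b l) (\<sigma> l)) = dt l l" if "l \<in> F" for l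
      using b(3)[OF that] by (simp add: dt_sc_left dt_sc_right mult.assoc)
  qed
  then obtain \<alpha> where a: "\<alpha> \<in> auto P" "\<forall>l \<in> F. \<alpha> ` Grl l = Grl (\<sigma> l)" using line_sc b by auto
  have "act_decomp \<alpha> (Grl ` F) = (\<lambda>l. Grl (\<sigma> l)) ` F" using a(2) by (auto simp: act_decomp_def image_image)
  also have "\<dots> = Grl ` F'" using bij by (auto simp: bij_betw_def image_image[symmetric])
  finally show ?thesis using a(1) by blast
qed

definition tsc :: "'k \<Rightarrow> 'k \<times> 'k \<times> 'k \<Rightarrow> 'k \<times> 'k \<times> 'k" where "tsc a = (\<lambda>(r, s, t). (a * r, a * s, a * t))"
definition vsc :: "'k \<Rightarrow> 'v \<times> 'v \<times> 'v \<Rightarrow> 'v \<times> 'v \<times> 'v" where "vsc a = (\<lambda>(x, y, z). (sc a x, sc a y, sc a z))"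

text \<open>Every scalar is a natural multiple of \<open>e\<close>, so additivity implies linearity
  over the prime field. This lets the maps induced by an automorphism be treated as
  matrices.\<close>

lemma additive_tsc:
  assumes "\<And>t t'. t \<in> K \<times> K \<times> K \<Longrightarrow> t' \<in> K \<times> K \<times> K \<Longrightarrow> f (t + t') = f t + f t'"
    and "\<And>t. t \<in> K \<times> K \<times> K \<Longrightarrow> f t \<in> K \<times> K \<times> K" and a: "a \<in> K" and t: "t \<in> K \<times> K \<times> K"
  shows "f (tsc a t) = tsc a (f t)"
proof -
  obtain j where j: "a = of_nat j * e" using K_nat[OF a] by blast
  have cl: "tsc (of_nat j * e) t \<in> K \<times> K \<times> K" for j using t KI by (auto simp: tsc_def)
  have z: "f 0 = 0" using assms(1)[of 0 0] by (simp add: zero_prod_def)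
  have st: "tsc (of_nat (Suc j) * e) u = u + tsc (of_nat j * e) u" if "u \<in> K \<times> K \<times> K" for u j
    using that by (auto simp: tsc_def distrib_right)
  have "f (tsc (of_nat j * e) t) = tsc (of_nat j * e) (f t)"
  proof (induction j)
    case 0
    have "tsc (of_nat 0 * e) u = 0" for u by (cases u) (simp add: tsc_def zero_prod_def)
    then show ?case using z by simp
  next
    case (Suc j)
    show ?case unfolding st[OF t] st[OF assms(2)[OF t]] using assms(1)[OF t cl] Suc by simp
  qed
  then show ?thesis using j by simp
qed

lemma additive_vsc:
  assumes "\<And>u v. u \<in> M \<times> M \<times> M \<Longrightarrow> v \<in> M \<times> M \<times> M \<Longrightarrow> f (u + v) = f u + f v"
    and "\<And>u. u \<in> M \<times> M \<times> M \<Longrightarrow> f u \<in> M \<times> M \<times> M" and a: "a \<in> K" and u: "u \<in> M \<times> M \<times> M"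
  shows "f (vsc a u) = vsc a (f u)"
proof -
  obtain j where j: "a = of_nat j * e" using K_nat[OF a] by blast
  have cl: "vsc (of_nat j * e) u \<in> M \<times> M \<times> M" for j using u KI by (auto simp: vsc_def)
  have z: "f 0 = 0" using assms(1)[of 0 0] by (simp add: zero_prod_def)
  have st: "vsc (of_nat (Suc j) * e) w = w + vsc (of_nat j * e) w" if "w \<in> M \<times> M \<times> M" for w j
    using that by (auto simp: vsc_def distrib_right sc_add_left)
  have "f (vsc (of_nat j * e) u) = vsc (of_nat j * e) (f u)"
  proof (induction j)
    case 0
    have "vsc (of_nat 0 * e) w = 0" for w by (cases w) (simp add: vsc_def zero_prod_def)
    then show ?case using z by simp
  next
    case (Suc j)
    show ?case unfolding st[OF u] st[OF assms(2)[OF u]] using assms(1)[OF u cl] Suc by simp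
  qed
  then show ?thesis using j by simp
qed

definition lift :: "'v \<times> 'v \<times> 'v \<Rightarrow> 'k \<times> 'k \<times> 'k \<Rightarrow> 'a" where
  "lift u t = (SOME g. g \<in> carrier P \<and> vec g = u \<and> cen g = t)"

lemma lift:
  assumes "u \<in> M \<times> M \<times> M" "t \<in> K \<times> K \<times> K"
  shows "lift u t \<in> carrier P" "vec (lift u t) = u" "cen (lift u t) = t"
  using someI_ex[of "\<lambda>g. g \<in> carrier P \<and> vec g = u \<and> cen g = t"] coord_surj[OF assms] unfolding lift_def by blast+

lemma M0: "0 \<in> M \<times> M \<times> M" and K0: "0 \<in> K \<times> K \<times> K"
  by (simp_all add: zero_prod_def)

lemma autoD:
  assumes "\<alpha> \<in> auto P"
  shows "g \<in> carrier P \<Longrightarrow> \<alpha> g \<in> carrier P"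
    "g \<in> carrier P \<Longrightarrow> h \<in> carrier P \<Longrightarrow> \<alpha> (g \<otimes> h) = \<alpha> g \<otimes> \<alpha> h"
    "inj_on \<alpha> (carrier P)" "\<alpha> ` carrier P = carrier P"
  using assms by (auto simp: auto_def Bij_def bij_betw_def hom_def)

lemma auto_center:
  assumes a: "\<alpha> \<in> auto P" and g: "g \<in> carrier P"
  shows "vec (\<alpha> g) = 0 \<longleftrightarrow> vec g = 0"
proof -
  have "(\<forall>h \<in> carrier P. \<alpha> g \<otimes> h = h \<otimes> \<alpha> g) \<longleftrightarrow> (\<forall>h \<in> \<alpha> ` carrier P. \<alpha> g \<otimes> h = h \<otimes> \<alpha> g)"
    using autoD(4)[OF a] by simp
  also have "\<dots> \<longleftrightarrow> (\<forall>h \<in> carrier P. \<alpha> (g \<otimes> h) = \<alpha> (h \<otimes> g))"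
    using autoD(2)[OF a] g by simp
  also have "\<dots> \<longleftrightarrow> (\<forall>h \<in> carrier P. g \<otimes> h = h \<otimes> g)"
    using autoD(3)[OF a] g by (auto simp: inj_on_def)
  finally show ?thesis using central_iff[OF g] central_iff[OF autoD(1)[OF a g]] by simp
qed

text \<open>The automorphism induces \<open>\<theta>\<close> on the centre and \<open>\<phi>\<close> on the central quotient. On each line the matrix of
  \<open>\<theta>\<close> is the ratio of the two norms times a cofactor matrix, so that its determinant, which does not
  depend on the line, is that ratio up to squares.\<close>

lemma auto_square_class:
  assumes au: "\<alpha> \<in> auto P"
  shows "\<exists>\<epsilon>. \<forall>l \<in> M. \<forall>l' \<in> M. dt l l \<noteq> 0 \<longrightarrow> dt l' l' \<noteq> 0 \<longrightarrow> \<alpha> ` Grl l = Grl l' \<longrightarrow>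
    (sq (dt l l) \<longleftrightarrow> sq (dt l' l')) = \<epsilon>"
proof -
  note A = autoD[OF au]
  define \<theta> where "\<theta> t = cen (\<alpha> (lift 0 t))" for t
  define \<phi> where "\<phi> u = vec (\<alpha> (lift u 0))" for u
  have theta: "cen (\<alpha> g) = \<theta> (cen g)" if g: "g \<in> carrier P" "vec g = 0" for g
  proof -
    have "g = lift 0 (cen g)" by (rule coord_inj) (use g lift[OF M0 cen_K[OF g(1)]] in auto)
    then show ?thesis unfolding \<theta>_def by simp
  qed
  have phi: "vec (\<alpha> g) = \<phi> (vec g)" if g: "g \<in> carrier P" for g
  proof -
    note L = lift[OF vec_M[OF g] K0]
    have z: "vec (inv (lift (vec g) 0) \<otimes> g) = 0" using L g by (simp add: vec_mult vec_inv)
    have eq: "g = lift (vec g) 0 \<otimes> (inv (lift (vec g) 0) \<otimes> g)" using L g by (simp add: m_assoc[symmetric])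
    have "vec (\<alpha> g) = vec (\<alpha> (lift (vec g) 0)) + vec (\<alpha> (inv (lift (vec g) 0) \<otimes> g))"
      using A(1,2) L(1) g eq vec_mult by (metis inv_closed m_closed)
    then show ?thesis using auto_center[OF au, of "inv (lift (vec g) 0) \<otimes> g"] z L(1) g by (simp add: \<phi>_def)
  qed
  have thK: "\<theta> t \<in> K \<times> K \<times> K" if "t \<in> K \<times> K \<times> K" for t
    unfolding \<theta>_def using lift(1)[OF M0 that] A(1) cen_K by blast
  have phM: "\<phi> u \<in> M \<times> M \<times> M" if "u \<in> M \<times> M \<times> M" for u
    unfolding \<phi>_def using lift(1)[OF that K0] A(1) vec_M by blast
  have thadd: "\<theta> (t + t') = \<theta> t + \<theta> t'" if t: "t \<in> K \<times> K \<times> K" "t' \<in> K \<times> K \<times> K" for t t'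
  proof -
    note L = lift[OF M0 t(1)] lift[OF M0 t(2)]
    have "cen (\<alpha> (lift 0 t \<otimes> lift 0 t')) = \<theta> (t + t')"
      using theta[of "lift 0 t \<otimes> lift 0 t'"] L by (simp add: vec_mult cen_mult)
    moreover have "vec (\<alpha> (lift 0 t)) = 0" using auto_center[OF au L(1)] L(2) by simp
    ultimately show ?thesis using A(1,2) L by (simp add: cen_mult \<theta>_def)
  qed
  have phadd: "\<phi> (u + v) = \<phi> u + \<phi> v" if u: "u \<in> M \<times> M \<times> M" "v \<in> M \<times> M \<times> M" for u v
  proof -
    note L = lift[OF u(1) K0] lift[OF u(2) K0]
    have "vec (\<alpha> (lift u 0 \<otimes> lift v 0)) = \<phi> (u + v)"
      using phi[of "lift u 0 \<otimes> lift v 0"] L by (simp add: vec_mult)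
    then show ?thesis using A(1,2) L by (simp add: vec_mult \<phi>_def)
  qed
  \<comment> \<open>The automorphism respects commutators, whose central parts are twice
    \<open>ct\<close>; the factor 2 is then cancelled.\<close>
  have thct: "\<theta> (ct u v) = ct (\<phi> u) (\<phi> v)" if u: "u \<in> M \<times> M \<times> M" "v \<in> M \<times> M \<times> M" for u v
  proof -
    note L = lift[OF u(1) K0] lift[OF u(2) K0]
    have cK: "ct u v \<in> K \<times> K \<times> K" by (rule ct_K[OF u])
    have K3: "t + t' \<in> K \<times> K \<times> K" if "t \<in> K \<times> K \<times> K" "t' \<in> K \<times> K \<times> K" for t t' using that by auto
    have cK2: "ct u v + ct u v \<in> K \<times> K \<times> K" by (rule K3[OF cK cK])
    note k = lift[OF M0 cK2]
    let ?g = "lift u 0" and ?h = "lift v 0" and ?k = "lift 0 (ct u v + ct u v)"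
    have "?g \<otimes> ?h = ?k \<otimes> (?h \<otimes> ?g)" by (rule commutator(1)) (use L k in auto)
    then have "\<alpha> ?g \<otimes> \<alpha> ?h = \<alpha> ?k \<otimes> (\<alpha> ?h \<otimes> \<alpha> ?g)" using A(2) L(1,4) k(1) by (metis m_closed)
    then have "cen (\<alpha> ?g \<otimes> \<alpha> ?h) = cen (\<alpha> ?k \<otimes> (\<alpha> ?h \<otimes> \<alpha> ?g))" by simp
    moreover have "vec (\<alpha> ?k) = 0" using auto_center[OF au k(1)] k(2) by simp
    ultimately have "ct (\<phi> u) (\<phi> v) = cen (\<alpha> ?k) + ct (\<phi> v) (\<phi> u)"
      using A(1) L k by (simp add: cen_mult vec_mult \<phi>_def)
    also have "cen (\<alpha> ?k) = \<theta> (ct u v) + \<theta> (ct u v)" using theta[OF k(1,2)] k(3) thadd[OF cK cK] by simp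
    finally have "(\<theta> (ct u v) - ct (\<phi> u) (\<phi> v)) + (\<theta> (ct u v) - ct (\<phi> u) (\<phi> v)) = 0"
      using ct_swap[of "\<phi> v" "\<phi> u"] by (simp add: algebra_simps)
    moreover have "\<theta> (ct u v) - ct (\<phi> u) (\<phi> v) \<in> K \<times> K \<times> K"
      using thK[OF cK] ct_K[OF phM[OF u(1)] phM[OF u(2)]]
      by (cases "\<theta> (ct u v)", cases "ct (\<phi> u) (\<phi> v)") simp
    ultimately have "\<theta> (ct u v) - ct (\<phi> u) (\<phi> v) = 0" by (rule triple_double[rotated])
    then show ?thesis by simp
  qed
  have thsc: "\<theta> (tsc c t) = tsc c (\<theta> t)" if "c \<in> K" "t \<in> K \<times> K \<times> K" for c t
    by (rule additive_tsc[OF _ _ that]) (erule thadd thK; assumption?)+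
  have phsc: "\<phi> (vsc c u) = vsc c (\<phi> u)" if "c \<in> K" "u \<in> M \<times> M \<times> M" for c u
    by (rule additive_vsc[OF _ _ that]) (erule phadd phM; assumption?)+
  have E: "(e, 0, 0) \<in> K \<times> K \<times> K" "(0, e, 0) \<in> K \<times> K \<times> K" "(0, 0, e) \<in> K \<times> K \<times> K" by auto
  define D where "D = det3 (\<theta> (e, 0, 0)) (\<theta> (0, e, 0)) (\<theta> (0, 0, e))"
  have "(sq (dt l l) \<longleftrightarrow> sq (dt l' l')) = sq D"
    if l: "l \<in> M" "l' \<in> M" "dt l l \<noteq> 0" "dt l' l' \<noteq> 0" "\<alpha> ` Grl l = Grl l'" for l l'
  proof -
    define r where "r = dt l l"
    define r' where "r' = dt l' l'"
    have r: "r \<in> K" "r \<noteq> 0" "r' \<in> K" "r' \<noteq> 0" using l by (auto simp: r_def r'_def)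
    have lM: "(l, 0, 0) \<in> M \<times> M \<times> M" "(0, l, 0) \<in> M \<times> M \<times> M" "(0, 0, l) \<in> M \<times> M \<times> M" using l by auto
    have im: "\<exists>b1 \<in> K. \<exists>b2 \<in> K. \<exists>b3 \<in> K. \<phi> u = (sc b1 l', sc b2 l', sc b3 l')"
      if u: "u \<in> line l \<times> line l \<times> line l" for u
    proof -
      have uM: "u \<in> M \<times> M \<times> M" using u subspaceD(1)[OF line_subspace[OF l(1)]] by blast
      have "lift u 0 \<in> Grl l" using lift[OF uM K0] u by (simp add: Gr_def)
      then have "\<alpha> (lift u 0) \<in> Grl l'" using l(5) by blast
      then show ?thesis unfolding \<phi>_def by (auto simp: Gr_def line_def)
    qed
    have ll: "l \<in> line l" "0 \<in> line l" using line_self[OF l(1)] subspaceD(2)[OF line_subspace[OF l(1)]] by auto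
    obtain a1 a2 a3 where a: "a1 \<in> K" "a2 \<in> K" "a3 \<in> K" "\<phi> (l, 0, 0) = (sc a1 l', sc a2 l', sc a3 l')"
      using im[of "(l, 0, 0)"] ll by auto
    obtain b1 b2 b3 where b: "b1 \<in> K" "b2 \<in> K" "b3 \<in> K" "\<phi> (0, l, 0) = (sc b1 l', sc b2 l', sc b3 l')"
      using im[of "(0, l, 0)"] ll by auto
    obtain c1 c2 c3 where c: "c1 \<in> K" "c2 \<in> K" "c3 \<in> K" "\<phi> (0, 0, l) = (sc c1 l', sc c2 l', sc c3 l')"
      using im[of "(0, 0, l)"] ll by auto
    have ctl: "ct (0, l, 0) (0, 0, l) = tsc r (e, 0, 0)" "ct (0, 0, l) (l, 0, 0) = tsc r (0, e, 0)"
      "ct (l, 0, 0) (0, l, 0) = tsc r (0, 0, e)" using r(1) by (auto simp: ct_def tsc_def r_def)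
    have ctf: "ct (sc x1 l', sc x2 l', sc x3 l') (sc y1 l', sc y2 l', sc y3 l') =
        (r' * (x2 * y3 - x3 * y2), r' * (x3 * y1 - x1 * y3), r' * (x1 * y2 - x2 * y1))" for x1 x2 x3 y1 y2 y3
      by (simp add: ct_def dt_sc_left dt_sc_right r'_def algebra_simps)
    \<comment> \<open>The rows of \<open>r\<close> times \<open>\<theta>\<close> are
      \<open>r'\<close> times the cross products of the coefficient rows of \<open>\<phi>\<close>: a
      cofactor matrix.\<close>
    have T1: "tsc r (\<theta> (e, 0, 0)) = (r' * (b2 * c3 - b3 * c2), r' * (b3 * c1 - b1 * c3), r' * (b1 * c2 - b2 * c1))"
      using thct[OF lM(2,3)] thsc[OF r(1) E(1)] ctl(1) b(4) c(4) ctf by simp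
    have T2: "tsc r (\<theta> (0, e, 0)) = (r' * (c2 * a3 - c3 * a2), r' * (c3 * a1 - c1 * a3), r' * (c1 * a2 - c2 * a1))"
      using thct[OF lM(3,1)] thsc[OF r(1) E(2)] ctl(2) a(4) c(4) ctf by simp
    have T3: "tsc r (\<theta> (0, 0, e)) = (r' * (a2 * b3 - a3 * b2), r' * (a3 * b1 - a1 * b3), r' * (a1 * b2 - a2 * b1))"
      using thct[OF lM(1,2)] thsc[OF r(1) E(3)] ctl(3) a(4) b(4) ctf by simp
    define d where "d = det3 (a1, a2, a3) (b1, b2, b3) (c1, c2, c3)"
    have dK: "d \<in> K" using a b c by (simp add: d_def det3_def)
    have det_tsc: "det3 (tsc r x) (tsc r y) (tsc r z) = (r * r) * (r * det3 x y z)" for x y z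
      by (cases x, cases y, cases z) (simp add: det3_def tsc_def algebra_simps)
    have "(r * r) * (r * D) = det3 (tsc r (\<theta> (e, 0, 0))) (tsc r (\<theta> (0, e, 0))) (tsc r (\<theta> (0, 0, e)))"
      unfolding D_def det_tsc ..
    \<comment> \<open>The cofactor matrix of a 3 by 3 matrix of determinant \<open>d\<close> has
      determinant \<open>d * d\<close>.\<close>
    also have "\<dots> = (r' * r') * (r' * (d * d))"
      unfolding T1 T2 T3 d_def by (simp add: det3_def algebra_simps)
    finally have id: "(r * r) * (r * D) = (r' * r') * (r' * (d * d))" .
    \<comment> \<open>If \<open>d\<close> vanished, each column of cofactors would give a linear
      relation between the rows \<open>a\<close>, \<open>b\<close>, \<open>c\<close>. Such relations
      are trivial because the automorphism is injective modulo the centre. So the first row of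
      cofactors is zero and \<open>\<theta>\<close> would kill \<open>(e, 0, 0)\<close>.\<close>
    have d0: "d \<noteq> 0"
    proof
      assume d0: "d = 0"
      have kill: "u = 0" if u: "u \<in> K" "v \<in> K" "w \<in> K"
        and 0: "u * a1 + v * b1 + w * c1 = 0" "u * a2 + v * b2 + w * c2 = 0" "u * a3 + v * b3 + w * c3 = 0" for u v w
      proof -
        have m: "vsc u (l, 0, 0) \<in> M \<times> M \<times> M" "vsc v (0, l, 0) \<in> M \<times> M \<times> M" "vsc w (0, 0, l) \<in> M \<times> M \<times> M"
          using u l by (auto simp: vsc_def)
        have m2: "vsc u (l, 0, 0) + vsc v (0, l, 0) \<in> M \<times> M \<times> M" using u l by (auto simp: vsc_def)
        have eq: "(sc u l, sc v l, sc w l) = vsc u (l, 0, 0) + vsc v (0, l, 0) + vsc w (0, 0, l)"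
          by (simp add: vsc_def)
        have "\<phi> (sc u l, sc v l, sc w l) = vsc u (\<phi> (l, 0, 0)) + vsc v (\<phi> (0, l, 0)) + vsc w (\<phi> (0, 0, l))"
          unfolding eq phadd[OF m2 m(3)] phadd[OF m(1,2)] using phsc u lM by simp
        also have "\<dots> = 0" unfolding a(4) b(4) c(4) using 0
          by (simp add: vsc_def sc_mult[symmetric] sc_add_left[symmetric] zero_prod_def)
        finally have z: "\<phi> (sc u l, sc v l, sc w l) = 0" .
        have sM: "(sc u l, sc v l, sc w l) \<in> M \<times> M \<times> M" using u l by auto
        have "(sc u l, sc v l, sc w l) = 0"
          using auto_center[OF au lift(1)[OF sM K0]] z lift(2)[OF sM K0] unfolding \<phi>_def by simp
        then have "dt (sc u l) l = 0" by (simp add: zero_prod_def)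
        then show "u = 0" using K_no_zero_div[OF u(1) r(1)] r(2) by (simp add: dt_sc_left r_def)
      qed
      have "b2 * c3 - b3 * c2 = 0"
      proof (rule kill[of _ "c2 * a3 - c3 * a2" "a2 * b3 - a3 * b2"])
        show "(b2 * c3 - b3 * c2) * a1 + (c2 * a3 - c3 * a2) * b1 + (a2 * b3 - a3 * b2) * c1 = 0"
          unfolding d0[symmetric] d_def det3_def by (simp add: algebra_simps)
        show "(b2 * c3 - b3 * c2) * a2 + (c2 * a3 - c3 * a2) * b2 + (a2 * b3 - a3 * b2) * c2 = 0"
          by (simp add: algebra_simps)
        show "(b2 * c3 - b3 * c2) * a3 + (c2 * a3 - c3 * a2) * b3 + (a2 * b3 - a3 * b2) * c3 = 0"
          by (simp add: algebra_simps)
      qed (use a b c in simp_all)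
      moreover have "b3 * c1 - b1 * c3 = 0"
      proof (rule kill[of _ "c3 * a1 - c1 * a3" "a3 * b1 - a1 * b3"])
        show "(b3 * c1 - b1 * c3) * a1 + (c3 * a1 - c1 * a3) * b1 + (a3 * b1 - a1 * b3) * c1 = 0"
          by (simp add: algebra_simps)
        show "(b3 * c1 - b1 * c3) * a2 + (c3 * a1 - c1 * a3) * b2 + (a3 * b1 - a1 * b3) * c2 = 0"
          unfolding d0[symmetric] d_def det3_def by (simp add: algebra_simps)
        show "(b3 * c1 - b1 * c3) * a3 + (c3 * a1 - c1 * a3) * b3 + (a3 * b1 - a1 * b3) * c3 = 0"
          by (simp add: algebra_simps)
      qed (use a b c in simp_all)
      moreover have "b1 * c2 - b2 * c1 = 0"
      proof (rule kill[of _ "c1 * a2 - c2 * a1" "a1 * b2 - a2 * b1"])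
        show "(b1 * c2 - b2 * c1) * a1 + (c1 * a2 - c2 * a1) * b1 + (a1 * b2 - a2 * b1) * c1 = 0"
          by (simp add: algebra_simps)
        show "(b1 * c2 - b2 * c1) * a2 + (c1 * a2 - c2 * a1) * b2 + (a1 * b2 - a2 * b1) * c2 = 0"
          by (simp add: algebra_simps)
        show "(b1 * c2 - b2 * c1) * a3 + (c1 * a2 - c2 * a1) * b3 + (a1 * b2 - a2 * b1) * c3 = 0"
          unfolding d0[symmetric] d_def det3_def by (simp add: algebra_simps)
      qed (use a b c in simp_all)
      ultimately have "tsc r (\<theta> (e, 0, 0)) = 0" using T1 by (simp add: zero_prod_def)
      then have th0: "\<theta> (e, 0, 0) = 0"
        using thK[OF E(1)] r K_no_zero_div by (auto simp: tsc_def zero_prod_def)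
      note k = lift[OF M0 E(1)]
      have "\<alpha> (lift 0 (e, 0, 0)) = \<one>"
        by (rule coord_inj)
          (use k A(1) auto_center[OF au k(1)] th0 theta[OF k(1,2)] in \<open>auto simp: vec_one cen_one\<close>)
      moreover have "\<alpha> \<one> = \<one>" using A(1,2)[of \<one>] by (metis one_closed r_one r_cancel_one')
      ultimately have "lift 0 (e, 0, 0) = \<one>" using A(3) k(1) by (auto simp: inj_on_def)
      then show False using k(3) cen_one e(2) by (simp add: zero_prod_def)
    qed
    have DK: "D \<in> K" unfolding D_def using thK[OF E(1)] thK[OF E(2)] thK[OF E(3)] by (auto simp: det3_def)
    have nz: "r * r \<noteq> 0" "r' * r' \<noteq> 0" "d * d \<noteq> 0" using K_no_zero_div r d0 dK by auto
    have sqq: "sq (x * x)" if "x \<in> K" "x \<noteq> 0" for x using that unfolding sq_def by blast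
    have "(r' * r') * (r' * (d * d)) \<noteq> 0" using K_no_zero_div nz r dK by auto
    then have D0: "D \<noteq> 0" using id by auto
    have rD: "r * D \<in> K" "r * D \<noteq> 0" "r' * (d * d) \<in> K" "r' * (d * d) \<noteq> 0"
      using K_no_zero_div r DK D0 dK d0 by auto
    \<comment> \<open>Up to squares the identity reads \<open>r * D = r'\<close>.\<close>
    have "sq ((r * r) * (r * D)) \<longleftrightarrow> (sq r \<longleftrightarrow> sq D)"
      using sq_mult_iff[OF _ nz(1) rD(1,2)] sq_mult_iff[OF r(1,2) DK D0] sqq r by auto
    moreover have "sq ((r' * r') * (r' * (d * d))) \<longleftrightarrow> sq r'"
      using sq_mult_iff[OF _ nz(2) rD(3,4)] sq_mult_iff[OF r(3,4) _ nz(3)] sqq r dK d0 by auto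
    ultimately have "(sq r \<longleftrightarrow> sq D) \<longleftrightarrow> sq r'" by (simp only: id)
    then show ?thesis unfolding r_def r'_def by blast
  qed
  note main = this
  show ?thesis by (intro exI[of _ "sq D"] ballI impI main)
qed

text \<open>By \<open>auto_square_class\<close> the induced bijection of the lines either keeps all
  square classes or exchanges all of them; in the second case the nonsquare norms of
  \<open>F'\<close> come from the square norms of \<open>F\<close>.\<close>

lemma auto_nsq:
  assumes F: "frame F" and F': "frame F'" and a: "\<alpha> \<in> auto P" and im: "act_decomp \<alpha> (Grl ` F) = Grl ` F'"
  shows "nsq F' = nsq F \<or> nsq F' + nsq F = card F"
proof -
  note Fd = F[unfolded frame_def] and Fd' = F'[unfolded frame_def]
  have inj: "inj_on (\<lambda>l. \<alpha> ` Grl l) F"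
  proof (rule inj_onI)
    fix l l' assume h: "l \<in> F" "l' \<in> F" "\<alpha> ` Grl l = \<alpha> ` Grl l'"
    have "Grl l \<subseteq> carrier P" "Grl l' \<subseteq> carrier P" by (auto simp: Gr_def)
    then have "Grl l = Grl l'" using inj_on_image_eq_iff[OF autoD(3)[OF a]] h(3) by blast
    then show "l = l'" using Grl_inj[OF F] h by (auto simp: inj_on_def)
  qed
  have im': "(\<lambda>l. \<alpha> ` Grl l) ` F = Grl ` F'" using im by (auto simp: act_decomp_def image_image)
  define \<sigma> where "\<sigma> = (\<lambda>l. inv_into F' Grl (\<alpha> ` Grl l))"
  have s: "\<sigma> l \<in> F'" "Grl (\<sigma> l) = \<alpha> ` Grl l" if "l \<in> F" for l
  proof -
    have "\<alpha> ` Grl l \<in> Grl ` F'" using im' that by blast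
    from inv_into_into[OF this] f_inv_into_f[OF this]
    show "\<sigma> l \<in> F'" "Grl (\<sigma> l) = \<alpha> ` Grl l" by (simp_all only: \<sigma>_def)
  qed
  have sinj: "inj_on \<sigma> F"
  proof (rule inj_onI)
    fix l l' assume "l \<in> F" "l' \<in> F" "\<sigma> l = \<sigma> l'"
    then show "l = l'" using inj_onD[OF inj, of l l'] s(2)[of l] s(2)[of l'] by simp
  qed
  have sim: "\<sigma> ` F = F'"
  proof
    show "\<sigma> ` F \<subseteq> F'" using s by blast
    show "F' \<subseteq> \<sigma> ` F"
    proof
      fix l' assume l': "l' \<in> F'"
      then have "Grl l' \<in> (\<lambda>l. \<alpha> ` Grl l) ` F" unfolding im' by (rule imageI)
      then obtain l where l: "Grl l' = \<alpha> ` Grl l" "l \<in> F" by (rule imageE)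
      have "l' = \<sigma> l" by (rule inj_onD[OF Grl_inj[OF F'] _ l' s(1)[OF l(2)]]) (use l s(2)[OF l(2)] in simp)
      then show "l' \<in> \<sigma> ` F" using l by blast
    qed
  qed
  obtain \<epsilon> where E: "\<forall>l \<in> M. \<forall>l' \<in> M. dt l l \<noteq> 0 \<longrightarrow> dt l' l' \<noteq> 0 \<longrightarrow> \<alpha> ` Grl l = Grl l' \<longrightarrow>
      (sq (dt l l) \<longleftrightarrow> sq (dt l' l')) = \<epsilon>"
    using auto_square_class[OF a] by (elim exE)
  have eps: "(sq (dt l l) \<longleftrightarrow> sq (dt (\<sigma> l) (\<sigma> l))) = \<epsilon>" if "l \<in> F" for l
  proof (rule E[rule_format])
    show "l \<in> M" "\<sigma> l \<in> M" "dt l l \<noteq> 0" "dt (\<sigma> l) (\<sigma> l) \<noteq> 0" using Fd Fd' that s(1)[OF that] by auto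
    show "\<alpha> ` Grl l = Grl (\<sigma> l)" using s(2)[OF that] ..
  qed
  have c: "card (\<sigma> ` S) = card S" if "S \<subseteq> F" for S using card_image[OF inj_on_subset[OF sinj that]] .
  have fin: "finite F" by (rule frame_finite[OF F])
  show ?thesis
  proof (cases \<epsilon>)
    case True
    then have "{l \<in> F'. \<not> sq (dt l l)} = \<sigma> ` {l \<in> F. \<not> sq (dt l l)}" unfolding sim[symmetric] using eps by auto
    then show ?thesis unfolding nsq_def using c[of "{l \<in> F. \<not> sq (dt l l)}"] by simp
  next
    case False
    then have "{l \<in> F'. \<not> sq (dt l l)} = \<sigma> ` {l \<in> F. sq (dt l l)}" unfolding sim[symmetric] using eps by auto
    then have "nsq F' = card {l \<in> F. sq (dt l l)}" unfolding nsq_def using c[of "{l \<in> F. sq (dt l l)}"] by simp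
    moreover have "card {l \<in> F. sq (dt l l)} + nsq F = card ({l \<in> F. sq (dt l l)} \<union> {l \<in> F. \<not> sq (dt l l)})"
      unfolding nsq_def using fin by (intro card_Un_disjoint[symmetric]) auto
    moreover have "{l \<in> F. sq (dt l l)} \<union> {l \<in> F. \<not> sq (dt l l)} = F" by blast
    ultimately show ?thesis by simp
  qed
qed

end

section \<open>Orthogonal bases of the standard form\<close>

context quad_space
begin

definition orth :: "'v set \<Rightarrow> bool" where
  "orth F \<longleftrightarrow> F \<subseteq> M \<and> (\<forall>l \<in> F. dt l l \<noteq> 0) \<and> (\<forall>l \<in> F. \<forall>l' \<in> F. l \<noteq> l' \<longrightarrow> dt l l' = 0)"

lemma orth_inj:
  assumes "orth F" shows "inj_on (\<lambda>f. \<Sum>l\<in>F. sc (f l) l) (F \<rightarrow>\<^sub>E K)"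
proof (rule inj_onI)
  note F = assms[unfolded orth_def]
  have fin: "finite F" using F finite_M finite_subset by blast
  fix f g assume fg: "f \<in> F \<rightarrow>\<^sub>E K" "g \<in> F \<rightarrow>\<^sub>E K" "(\<Sum>l\<in>F. sc (f l) l) = (\<Sum>l\<in>F. sc (g l) l)"
  have "f l = g l" if l: "l \<in> F" for l
  proof -
    have c: "dt (\<Sum>l\<in>F. sc (h l) l) l = h l * dt l l" for h
      by (rule frame_coeff[OF fin _ _ l]) (use F in auto)
    have "dt l l * f l = dt l l * g l" using c[of f] c[of g] fg(3) by (simp add: mult.commute)
    moreover have "dt l l \<in> K" "dt l l \<noteq> 0" "f l \<in> K" "g l \<in> K" using F l fg by auto
    ultimately show ?thesis using K_mult_left_cancel by blast
  qed
  then show "f = g" using fg by (intro PiE_ext) auto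
qed

lemma frame_card:
  assumes F: "frame F" shows "card M = p ^ card F"
proof -
  have o: "orth F" using F by (simp add: frame_def orth_def)
  have fin: "finite F" by (rule frame_finite[OF F])
  have "(\<lambda>f. \<Sum>l\<in>F. sc (f l) l) ` (F \<rightarrow>\<^sub>E K) = M"
  proof
    show "(\<lambda>f. \<Sum>l\<in>F. sc (f l) l) ` (F \<rightarrow>\<^sub>E K) \<subseteq> M"
      using F by (auto simp: frame_def subset_iff PiE_iff intro!: M_sum)
    show "M \<subseteq> (\<lambda>f. \<Sum>l\<in>F. sc (f l) l) ` (F \<rightarrow>\<^sub>E K)"
    proof
      fix x assume x: "x \<in> M"
      define f where "f = (\<lambda>l \<in> F. dt x l * iv (dt l l))"
      have "f \<in> F \<rightarrow>\<^sub>E K" using F x iv by (auto simp: f_def frame_def subset_iff)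
      moreover have "(\<Sum>l\<in>F. sc (f l) l) = (\<Sum>l\<in>F. sc (dt x l * iv (dt l l)) l)"
        by (rule sum.cong) (auto simp: f_def)
      then have "x = (\<Sum>l\<in>F. sc (f l) l)" using frame_expand[OF F x] by simp
      ultimately show "x \<in> (\<lambda>f. \<Sum>l\<in>F. sc (f l) l) ` (F \<rightarrow>\<^sub>E K)" by blast
    qed
  qed
  then have "card M = card (F \<rightarrow>\<^sub>E K)" using card_image[OF orth_inj[OF o]] by simp
  then show ?thesis using fin by (simp add: card_PiE card_K)
qed

text \<open>Linear combinations of such vectors are determined by their coefficients, so there are
  \<open>p ^ card F\<close> of them and by counting they fill \<open>M\<close>. A vector orthogonal
  to \<open>F\<close> is then orthogonal to \<open>M\<close>.\<close>

lemma orth_frame: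
  assumes o: "orth F" and c: "card M = p ^ card F" shows "frame F"
proof -
  note F = o[unfolded orth_def]
  have fin: "finite F" using F finite_M finite_subset by blast
  have sub: "(\<lambda>f. \<Sum>l\<in>F. sc (f l) l) ` (F \<rightarrow>\<^sub>E K) \<subseteq> M" using F by (auto simp: subset_iff PiE_iff intro!: M_sum)
  have "card ((\<lambda>f. \<Sum>l\<in>F. sc (f l) l) ` (F \<rightarrow>\<^sub>E K)) = card M"
    using card_image[OF orth_inj[OF o]] fin c by (simp add: card_PiE card_K)
  then have im: "(\<lambda>f. \<Sum>l\<in>F. sc (f l) l) ` (F \<rightarrow>\<^sub>E K) = M"
    using card_subset_eq[OF finite_M sub] by blast
  have "x = 0" if x: "x \<in> M" "\<forall>l \<in> F. dt x l = 0" for x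
  proof (rule nondeg[OF x(1)])
    fix y assume "y \<in> M"
    then have "y \<in> (\<lambda>f. \<Sum>l\<in>F. sc (f l) l) ` (F \<rightarrow>\<^sub>E K)" using im by simp
    then obtain f where "y = (\<Sum>l\<in>F. sc (f l) l)" by (rule imageE)
    then show "dt x y = 0" using x(2) by (simp add: dt_sum_right dt_sc_right)
  qed
  then show ?thesis using F unfolding frame_def by blast
qed

text \<open>After scaling to norm \<open>e\<close>, the two vectors are replaced by
  \<open>a u1 + b v1\<close> and \<open>a v1 - b u1\<close>, which are orthogonal and both have the
  nonsquare norm \<open>a * a + b * b\<close>.\<close>

lemma nsq_step:
  assumes F: "frame F" and uv: "u \<in> F" "v \<in> F" "u \<noteq> v" "sq (dt u u)" "sq (dt v v)"
  shows "\<exists>F'. frame F' \<and> nsq F' = nsq F + 2"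
proof -
  note Fd = F[unfolded frame_def]
  have fin: "finite F" by (rule frame_finite[OF F])
  obtain a b where ab: "a \<in> K" "b \<in> K" "a * a + b * b \<noteq> 0" "\<not> sq (a * a + b * b)" using nonsquare_sum by blast
  have norm: "\<exists>w. w \<in> M \<and> dt w w = e \<and> (\<forall>x. dt x u = 0 \<longrightarrow> dt x w = 0)" if u: "u \<in> F" "sq (dt u u)" for u
  proof -
    obtain y where y: "y \<in> K" "y \<noteq> 0" "dt u u = y * y" using u(2) unfolding sq_def by blast
    have i: "iv y \<in> K" "y * iv y = e" using iv[OF y(1,2)] .
    have "dt (sc (iv y) u) (sc (iv y) u) = (y * iv y) * (y * iv y)"
      by (simp add: dt_sc_left dt_sc_right y(3) algebra_simps)
    then have "dt (sc (iv y) u) (sc (iv y) u) = e" using i e by simp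
    moreover have "sc (iv y) u \<in> M" using i u Fd by auto
    ultimately show ?thesis by (intro exI[of _ "sc (iv y) u"]) (simp add: dt_sc_right)
  qed
  obtain u1 where u1: "u1 \<in> M" "dt u1 u1 = e" "\<And>x. dt x u = 0 \<Longrightarrow> dt x u1 = 0" using norm[OF uv(1,4)] by blast
  obtain v1 where v1: "v1 \<in> M" "dt v1 v1 = e" "\<And>x. dt x v = 0 \<Longrightarrow> dt x v1 = 0" using norm[OF uv(2,5)] by blast
  have "dt v u = 0" using Fd uv by auto
  then have "dt v u1 = 0" using u1(3) by blast
  then have "dt u1 v = 0" by (simp add: dt_sym)
  then have uv1: "dt u1 v1 = 0" "dt v1 u1 = 0" using v1(3) dt_sym by metis+
  define u' where "u' = sc a u1 + sc b v1"
  define v' where "v' = sc (- b) u1 + sc a v1"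
  have M': "u' \<in> M" "v' \<in> M" using ab u1 v1 by (auto simp: u'_def v'_def)
  have q: "dt u' u' = a * a + b * b" "dt v' v' = a * a + b * b" "dt u' v' = 0"
    using ab u1(2) v1(2) uv1 by (simp_all add: u'_def v'_def dt_add_left dt_add_right dt_sc_left dt_sc_right algebra_simps)
  define R where "R = F - {u, v}"
  have R0: "dt l u' = 0" "dt l v' = 0" if l: "l \<in> R" for l
  proof -
    have "dt l u = 0" "dt l v = 0" using Fd uv l by (auto simp: R_def)
    then have "dt l u1 = 0" "dt l v1 = 0" using u1(3) v1(3) by auto
    then show "dt l u' = 0" "dt l v' = 0" by (simp_all add: u'_def v'_def dt_add_right dt_sc_right)
  qed
  have RR: "dt l l' = 0" if "l \<in> R" "l' \<in> R" "l \<noteq> l'" for l l' using Fd that unfolding R_def by blast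
  have nin: "u' \<notin> R" "v' \<notin> R" "u' \<noteq> v'" using R0 q ab by auto
  define F' where "F' = insert u' (insert v' R)"
  have RF: "R \<subseteq> F" "finite R" "card F = card R + 2"
  proof -
    show "R \<subseteq> F" "finite R" using fin by (auto simp: R_def)
    have "card R = card F - card {u, v}" unfolding R_def by (rule card_Diff_subset) (use uv in auto)
    moreover have "card {u, v} \<le> card F" by (rule card_mono) (use fin uv in auto)
    ultimately show "card F = card R + 2" using uv by simp
  qed
  have "card F' = card F" using nin RF by (simp add: F'_def)
  moreover have "orth F'"
    unfolding orth_def
  proof (intro conjI ballI impI)
    show "F' \<subseteq> M" using M' RF Fd by (auto simp: F'_def)
    show "dt l l \<noteq> 0" if "l \<in> F'" for l using that q ab RF Fd by (auto simp: F'_def)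
    show "dt l l' = 0" if "l \<in> F'" "l' \<in> F'" "l \<noteq> l'" for l l'
      using that q(3) dt_sym[of v' u'] R0 dt_sym[of u' l'] dt_sym[of v' l'] RR by (auto simp: F'_def)
  qed
  ultimately have "frame F'" using orth_frame frame_card[OF F] by simp
  moreover have "{l \<in> F'. \<not> sq (dt l l)} = insert u' (insert v' {l \<in> F. \<not> sq (dt l l)})"
    using q ab uv by (auto simp: F'_def R_def)
  moreover have "u' \<notin> {l \<in> F. \<not> sq (dt l l)}" "v' \<notin> {l \<in> F. \<not> sq (dt l l)}" using nin uv by (auto simp: R_def)
  ultimately show ?thesis using fin nin(3) by (intro exI[of _ F']) (simp add: nsq_def)
qed

lemma frames_exist:
  assumes F: "frame F" "nsq F = 0" and j: "2 * j \<le> card F"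
  shows "\<exists>F'. frame F' \<and> nsq F' = 2 * j"
  using j
proof (induction j)
  case 0
  then show ?case using F by auto
next
  case (Suc j)
  then obtain F' where F': "frame F'" "nsq F' = 2 * j" by auto
  have p1: "p > 1" using p prime_gt_1_nat by blast
  have "p ^ card F' = p ^ card F" using frame_card F F' by metis
  then have card: "card F' = card F" using p1 by (simp add: power_inject_exp)
  have fin: "finite F'" by (rule frame_finite[OF F'(1)])
  have "card ({l \<in> F'. sq (dt l l)} \<union> {l \<in> F'. \<not> sq (dt l l)}) = card {l \<in> F'. sq (dt l l)} + nsq F'"
    unfolding nsq_def by (rule card_Un_disjoint) (use fin in auto)
  moreover have "{l \<in> F'. sq (dt l l)} \<union> {l \<in> F'. \<not> sq (dt l l)} = F'" by blast
  \<comment> \<open>As \<open>2 * j + 2\<close> does not exceed the size of the frame, two members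
    of square norm are left.\<close>
  ultimately have "card {l \<in> F'. sq (dt l l)} \<ge> 2" using card F'(2) Suc by simp
  then obtain T where T: "T \<subseteq> {l \<in> F'. sq (dt l l)}" "card T = 2" by (meson obtain_subset_with_card_n)
  then obtain u v where "T = {u, v}" "u \<noteq> v" by (meson card_2_iff)
  then obtain F'' where "frame F''" "nsq F'' = nsq F' + 2" using nsq_step[OF F'(1), of u v] T(1) by blast
  then show ?case using F'(2) by auto
qed

end

section \<open>The standard form on n coordinates\<close>

context prime_field
begin

definition vecs :: "nat \<Rightarrow> (nat \<Rightarrow> 'k) set" where "vecs n = {x. (\<forall>i < n. x i \<in> K) \<and> (\<forall>i \<ge> n. x i = 0)}"
definition smult :: "'k \<Rightarrow> (nat \<Rightarrow> 'k) \<Rightarrow> nat \<Rightarrow> 'k" where "smult a x = (\<lambda>i. a * x i)"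
definition dot :: "nat \<Rightarrow> (nat \<Rightarrow> 'k) \<Rightarrow> (nat \<Rightarrow> 'k) \<Rightarrow> 'k" where "dot n x y = (\<Sum>i<n. x i * y i)"
definition delta :: "nat \<Rightarrow> nat \<Rightarrow> 'k" where "delta i = (\<lambda>j. if j = i then e else 0)"

lemma dot_delta: "x \<in> vecs n \<Longrightarrow> i < n \<Longrightarrow> dot n x (delta i) = x i"
  by (simp add: dot_def delta_def vecs_def if_distrib cong: if_cong)

lemma delta_vecs: "i < n \<Longrightarrow> delta i \<in> vecs n"
  by (auto simp: delta_def vecs_def)

lemma vecs_quad_space:
  assumes "n > 0" shows "quad_space e p (vecs n) smult (dot n)"
proof
  show "finite (vecs n)"
  proof (rule inj_on_finite)
    show "inj_on (\<lambda>x. restrict x {..<n}) (vecs n)"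
    proof (rule inj_onI)
      fix x y assume h: "x \<in> vecs n" "y \<in> vecs n" "restrict x {..<n} = restrict y {..<n}"
      show "x = y"
      proof
        fix i show "x i = y i"
          using fun_cong[OF h(3), of i] h(1,2) by (cases "i < n") (auto simp: vecs_def)
      qed
    qed
    show "(\<lambda>x. restrict x {..<n}) ` vecs n \<subseteq> {..<n} \<rightarrow>\<^sub>E K"
      by (intro image_subsetI) (simp add: restrict_PiE_iff vecs_def del: restrict_apply)
    show "finite ({..<n} \<rightarrow>\<^sub>E K)" using finite_K by (simp add: finite_PiE)
  qed
  have "delta 0 0 \<noteq> (0 :: nat \<Rightarrow> 'k) 0" using e by (simp add: delta_def)
  then have "delta 0 \<noteq> 0" by metis
  then show "\<exists>x \<in> vecs n. x \<noteq> 0" using delta_vecs[OF assms] by blast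
  show "x = 0" if x: "x \<in> vecs n" "\<And>y. y \<in> vecs n \<Longrightarrow> dot n x y = 0" for x
  proof
    fix i show "x i = (0 :: nat \<Rightarrow> 'k) i"
      using x dot_delta[OF x(1), of i] delta_vecs[of i n] by (cases "i < n") (auto simp: vecs_def)
  qed
  show "smult e x = x" if "x \<in> vecs n" for x
  proof
    fix i show "smult e x i = x i" using that by (cases "i < n") (auto simp: vecs_def smult_def)
  qed
  show "dot n x y \<in> K" if "x \<in> vecs n" "y \<in> vecs n" for x y
    using that by (auto simp: dot_def vecs_def intro!: K_sum)
qed (auto simp: vecs_def smult_def dot_def fun_eq_iff distrib_left distrib_right sum.distrib mult.assoc
    sum_distrib_left intro: sum.cong mult.commute)

lemma vecs_frame:
  assumes n: "n > 0"
  shows "quad_space.frame (vecs n) (dot n) (delta ` {..<n})" "quad_space.nsq e (dot n) (delta ` {..<n}) = 0"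
    "card (delta ` {..<n}) = n"
proof -
  interpret Q: quad_space e p "vecs n" smult "dot n" by (rule vecs_quad_space[OF n])
  have dd: "dot n (delta i) (delta j) = (if i = j then e else 0)" if "i < n" "j < n" for i j
    using dot_delta[OF delta_vecs[OF that(1)] that(2)] by (auto simp: delta_def)
  show "Q.frame (delta ` {..<n})"
    unfolding Q.frame_def
  proof (intro conjI ballI impI)
    show "delta ` {..<n} \<subseteq> vecs n" using delta_vecs by auto
    show "dot n l l \<noteq> 0" if "l \<in> delta ` {..<n}" for l using that dd e by auto
    show "dot n l l' = 0" if "l \<in> delta ` {..<n}" "l' \<in> delta ` {..<n}" "l \<noteq> l'" for l l' using that dd by auto
    show "x = 0" if x: "x \<in> vecs n" "\<forall>l \<in> delta ` {..<n}. dot n x l = 0" for x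
    proof
      fix i show "x i = (0 :: nat \<Rightarrow> 'k) i"
        using x dot_delta[OF x(1), of i] by (cases "i < n") (auto simp: vecs_def)
    qed
  qed
  have "sq e" unfolding sq_def using e by (intro bexI[of _ e]) auto
  then have "{l \<in> delta ` {..<n}. \<not> sq (dot n l l)} = {}" using dd by auto
  then show "Q.nsq (delta ` {..<n}) = 0" unfolding Q.nsq_def by (simp only: card.empty)
  have "inj_on delta {..<n}"
  proof (rule inj_onI)
    fix i j assume "delta i = delta j"
    then have "delta i i = delta j i" by simp
    then show "i = j" using e by (simp add: delta_def split: if_splits)
  qed
  then show "card (delta ` {..<n}) = n" using card_image by fastforce
qed

text \<open>The product of the norms of an orthogonal basis is the square of a determinant.\<close>

lemma vecs_frame_parity:
  assumes n: "n > 0" and F: "quad_space.frame (vecs n) (dot n) F"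
  shows "card F = n" "even (quad_space.nsq e (dot n) F)"
proof -
  interpret Q: quad_space e p "vecs n" smult "dot n" by (rule vecs_quad_space[OF n])
  note Fd = F[unfolded Q.frame_def]
  have p1: "p > 1" using p prime_gt_1_nat by blast
  have "p ^ card F = p ^ card (delta ` {..<n})" using Q.frame_card F vecs_frame(1)[OF n] by metis
  then show cF: "card F = n" using p1 vecs_frame(3)[OF n] by (simp add: power_inject_exp)
  have fin: "finite F" by (rule Q.frame_finite[OF F])
  obtain l where l: "bij_betw l {0..<n} F" using ex_bij_betw_nat_finite[OF fin] cF by auto
  have lF: "l i \<in> F" if "i < n" for i using bij_betwE[OF l] that by auto
  have lK: "l i j \<in> K" if "i < n" "j < n" for i j using lF[OF that(1)] Fd that(2) by (auto simp: vecs_def)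
  define A where "A = mat n n (\<lambda>(i, j). l i j)"
  have A: "A \<in> carrier_mat n n" by (simp add: A_def)
  have ent: "(A * transpose_mat A) $$ (i, j) = (if i = j then dot n (l i) (l i) else 0)" if ij: "i < n" "j < n" for i j
  proof -
    have "(A * transpose_mat A) $$ (i, j) = (\<Sum>k = 0..<n. l i k * l j k)"
      using ij by (simp add: A_def scalar_prod_def)
    also have "\<dots> = dot n (l i) (l j)" by (simp add: dot_def lessThan_atLeast0)
    also have "\<dots> = (if i = j then dot n (l i) (l i) else 0)"
    proof (cases "i = j")
      case False
      then have "l i \<noteq> l j" using l ij by (auto simp: bij_betw_def inj_on_def)
      then show ?thesis using False Fd lF[OF ij(1)] lF[OF ij(2)] by auto
    qed simp
    finally show ?thesis .
  qed
  have At: "transpose_mat A \<in> carrier_mat n n" using A by simp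
  have AT: "A * transpose_mat A \<in> carrier_mat n n" using A by simp
  have "upper_triangular (A * transpose_mat A)" using ent AT by (auto simp: upper_triangular_def)
  then have "det (A * transpose_mat A) = prod_list (diag_mat (A * transpose_mat A))"
    by (rule det_upper_triangular[OF _ AT])
  also have "\<dots> = (\<Prod>i = 0..<n. (A * transpose_mat A) $$ (i, i))"
    unfolding prod_list_diag_prod carrier_matD(1)[OF AT] ..
  also have "\<dots> = (\<Prod>i = 0..<n. dot n (l i) (l i))" by (rule prod.cong) (use ent in auto)
  also have "\<dots> = (\<Prod>x\<in>F. dot n x x)" using prod.reindex_bij_betw[OF l] .
  finally have det: "det A * det A = (\<Prod>x\<in>F. dot n x x)"
    using det_mult[OF A At] det_transpose[OF A] by simp
  \<comment> \<open>The determinant is formed in the ambient ring, whose 1 need not lie in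
    \<open>K\<close>. Each of its terms is a nonempty product of entries in \<open>K\<close> with a
    sign, and \<open>K\<close> is closed under negation.\<close>
  have detK: "det A \<in> K"
  proof -
    have "(\<Prod>i = 0..<n. A $$ (i, \<pi> i)) \<in> K" if "\<pi> permutes {0..<n}" for \<pi>
    proof (rule K_prod)
      show "A $$ (i, \<pi> i) \<in> K" if "i \<in> {0..<n}" for i
        using permutes_in_image[OF \<open>\<pi> permutes {0..<n}\<close>, of i] that lK by (simp add: A_def)
    qed (use n in auto)
    then have "signof \<pi> * (\<Prod>i = 0..<n. A $$ (i, \<pi> i)) \<in> K" if "\<pi> permutes {0..<n}" for \<pi>
      using that by (cases "sign \<pi> = 1") (auto simp: sign_def)
    then show ?thesis unfolding det_def'[OF A] by (intro K_sum) auto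
  qed
  have fF: "dot n x x \<in> K \<and> dot n x x \<noteq> 0" if "x \<in> F" for x using Fd that by auto
  have ne: "F \<noteq> {}" using cF n by auto
  have "(\<Prod>x\<in>F. dot n x x) \<noteq> 0" "sq (\<Prod>x\<in>F. dot n x x) \<longleftrightarrow> even (card {x \<in> F. \<not> sq (dot n x x)})"
    using sq_prod_iff[OF fin ne, of "\<lambda>x. dot n x x"] fF by auto
  moreover have "sq (\<Prod>x\<in>F. dot n x x)" unfolding sq_def using detK det calculation(1)
    by (intro bexI[of _ "det A"]) auto
  ultimately show "even (Q.nsq F)" unfolding Q.nsq_def by blast
qed

end

section \<open>Counting orbits\<close>

text \<open>Outside \<open>C\<close> the composite is \<open>undefined\<close>, hence the
  containment condition.\<close>

lemma act_decomp_compose: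
  assumes "\<And>H. H \<in> Hs \<Longrightarrow> H \<subseteq> C"
  shows "act_decomp (compose C \<alpha> \<beta>) Hs = act_decomp \<alpha> (act_decomp \<beta> Hs)"
proof -
  have "compose C \<alpha> \<beta> ` H = \<alpha> ` \<beta> ` H" if "H \<in> Hs" for H
  proof -
    have "compose C \<alpha> \<beta> x = \<alpha> (\<beta> x)" if "x \<in> H" for x
      using assms[OF \<open>H \<in> Hs\<close>] that by (auto simp: compose_def)
    then show ?thesis by (auto simp: image_image)
  qed
  then show ?thesis unfolding act_decomp_def by (simp add: image_image cong: image_cong)
qed

context group
begin

definition orbit_of :: "'a set set \<Rightarrow> 'a set set set" where
  "orbit_of Hs = {act_decomp \<alpha> Hs | \<alpha>. \<alpha> \<in> auto G}"

lemma auto_compose: "\<alpha> \<in> auto G \<Longrightarrow> \<beta> \<in> auto G \<Longrightarrow> compose (carrier G) \<alpha> \<beta> \<in> auto G"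
  unfolding auto_def using compose_Bij by (auto simp: hom_def compose_def Pi_iff)

lemma orbit_of_subset:
  assumes "\<And>H. H \<in> Hs \<Longrightarrow> H \<subseteq> carrier G" "\<beta> \<in> auto G"
  shows "orbit_of (act_decomp \<beta> Hs) \<subseteq> orbit_of Hs"
proof
  fix Z assume "Z \<in> orbit_of (act_decomp \<beta> Hs)"
  then obtain \<alpha> where a: "\<alpha> \<in> auto G" "Z = act_decomp \<alpha> (act_decomp \<beta> Hs)" unfolding orbit_of_def by blast
  have "Z = act_decomp (compose (carrier G) \<alpha> \<beta>) Hs"
    unfolding a(2) by (rule act_decomp_compose[symmetric]) (rule assms(1))
  then show "Z \<in> orbit_of Hs" using auto_compose[OF a(1) assms(2)] unfolding orbit_of_def by blast
qed

lemma orbit_of_self: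
  assumes "\<And>H. H \<in> Hs \<Longrightarrow> H \<subseteq> carrier G"
  shows "Hs \<in> orbit_of Hs"
proof -
  have "(\<lambda>x \<in> carrier G. x) ` H = H" if "H \<in> Hs" for H using assms[OF that] by (auto simp: image_iff)
  then have "act_decomp (\<lambda>x \<in> carrier G. x) Hs = Hs" by (simp add: act_decomp_def cong: image_cong)
  then show ?thesis unfolding orbit_of_def using id_in_auto by (metis (mono_tags, lifting) mem_Collect_eq)
qed

lemma orbit_of_act:
  assumes Hs: "\<And>H. H \<in> Hs \<Longrightarrow> H \<subseteq> carrier G" and b: "\<beta> \<in> auto G"
  shows "orbit_of (act_decomp \<beta> Hs) = orbit_of Hs"
proof
  show "orbit_of (act_decomp \<beta> Hs) \<subseteq> orbit_of Hs" by (rule orbit_of_subset[OF assms])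
  define \<gamma> where "\<gamma> = restrict (inv_into (carrier G) \<beta>) (carrier G)"
  have bb: "\<beta> \<in> Bij (carrier G)" "\<beta> \<in> hom G G" using b by (auto simp: auto_def)
  have g: "\<gamma> \<in> auto G" unfolding \<gamma>_def auto_def
    using restrict_inv_into_Bij[OF bb(1)] restrict_inv_into_hom[OF bb(2,1)] by blast
  have "compose (carrier G) \<gamma> \<beta> = (\<lambda>x \<in> carrier G. x)"
    unfolding \<gamma>_def by (rule Bij_compose_restrict_eq[OF bb(1)])
  then have "act_decomp \<gamma> (act_decomp \<beta> Hs) = act_decomp (\<lambda>x \<in> carrier G. x) Hs"
    using act_decomp_compose[OF Hs] by metis
  also have "\<dots> = Hs"
  proof -
    have "(\<lambda>x \<in> carrier G. x) ` H = H" if "H \<in> Hs" for H using Hs[OF that] by (auto simp: image_iff)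
    then show ?thesis by (simp add: act_decomp_def cong: image_cong)
  qed
  finally have *: "act_decomp \<gamma> (act_decomp \<beta> Hs) = Hs" .
  have "orbit_of (act_decomp \<gamma> (act_decomp \<beta> Hs)) \<subseteq> orbit_of (act_decomp \<beta> Hs)"
  proof (rule orbit_of_subset[OF _ g])
    fix H assume "H \<in> act_decomp \<beta> Hs"
    then show "H \<subseteq> carrier G" using Hs Bij_imp_funcset[OF bb(1)] by (fastforce simp: act_decomp_def Pi_iff)
  qed
  then show "orbit_of Hs \<subseteq> orbit_of (act_decomp \<beta> Hs)" unfolding * .
qed

end

context cross_model
begin

lemma vec_pow: "g \<in> carrier P \<Longrightarrow> vec (g [^] (k::nat)) = vsc (of_nat k * e) (vec g)"
proof (induction k)
  case 0
  then show ?case by (cases "vec g") (simp add: vec_one vsc_def zero_prod_def)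
next
  case (Suc k)
  then show ?case using vec_M[of g] by (cases "vec g") (auto simp: vec_mult vsc_def distrib_right sc_add_left)
qed

lemma cen_pow: "g \<in> carrier P \<Longrightarrow> cen (g [^] (k::nat)) = tsc (of_nat k * e) (cen g)"
proof (induction k)
  case 0
  then show ?case by (cases "cen g") (simp add: cen_one tsc_def zero_prod_def)
next
  case (Suc k)
  have "ct (vec (g [^] k)) (vec g) = 0"
    using vec_pow[OF Suc.prems, of k]
    by (cases "vec g") (simp add: vsc_def ct_def dt_sc_left dt_sc_right dt_sym zero_prod_def)
  then show ?case using Suc cen_K[of g] by (cases "cen g") (auto simp: cen_mult tsc_def distrib_right)
qed

text \<open>Commutators have vanishing vector part and are therefore central, while an element over
  \<open>(x, 0, 0)\<close> with \<open>x\<close> nonzero is not central, so the class is exactly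
  2.\<close>

lemma class2:
  assumes M: "card M = p ^ n"
  shows "class2_exp_p_group p P"
  unfolding class2_exp_p_group_def
proof (intro conjI ballI)
  show "group P" by (rule group_axioms)
  show "finite (carrier P)" by (rule finite_carrier)
  have "bij_betw (\<lambda>g. (vec g, cen g)) (carrier P) ((M \<times> M \<times> M) \<times> (K \<times> K \<times> K))"
    unfolding bij_betw_def
  proof
    show "inj_on (\<lambda>g. (vec g, cen g)) (carrier P)" using coord_inj by (auto intro: inj_onI)
    show "(\<lambda>g. (vec g, cen g)) ` carrier P = (M \<times> M \<times> M) \<times> (K \<times> K \<times> K)"
    proof
      show "(\<lambda>g. (vec g, cen g)) ` carrier P \<subseteq> (M \<times> M \<times> M) \<times> (K \<times> K \<times> K)"
        by (intro image_subsetI SigmaI vec_M cen_K)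
      show "(M \<times> M \<times> M) \<times> (K \<times> K \<times> K) \<subseteq> (\<lambda>g. (vec g, cen g)) ` carrier P"
      proof
        fix z assume z: "z \<in> (M \<times> M \<times> M) \<times> (K \<times> K \<times> K)"
        then have "fst z \<in> M \<times> M \<times> M" "snd z \<in> K \<times> K \<times> K" by auto
        from coord_surj[OF this] obtain g where "g \<in> carrier P" "vec g = fst z" "cen g = snd z" by blast
        then show "z \<in> (\<lambda>g. (vec g, cen g)) ` carrier P" by (intro image_eqI[of _ _ g]) simp_all
      qed
    qed
  qed
  then have "Coset.order P = card ((M \<times> M \<times> M) \<times> (K \<times> K \<times> K))" unfolding Coset.order_def by (rule bij_betw_same_card)
  also have "\<dots> = p ^ (3 * n + 3)"
    by (simp add: card_cartesian_product M card_K power_add power_mult[symmetric] power3_eq_cube mult.commute[of 3] power_mult)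
  finally show "\<exists>n. Coset.order P = p ^ n" by blast
  have cent: "g \<in> group_center P" if "g \<in> carrier P" "vec g = 0" for g
    using central_iff[OF that(1)] that by (simp add: group_center_def)
  have z: "subgroup (Gr {0}) P" by (rule Gr_subgroup) (simp add: subspace_def)
  have "derived P (carrier P) \<subseteq> Gr {0}"
    unfolding derived_def
  proof (rule generate_subgroup_incl[OF _ z])
    show "derived_set P (carrier P) \<subseteq> Gr {0}"
      by (auto simp: Gr_def vec_mult vec_inv zero_prod_def)
  qed
  then show "derived P (carrier P) \<subseteq> group_center P"
    using cent by (auto simp: Gr_def zero_prod_def)
  show "derived P (carrier P) \<noteq> {\<one>}"
  proof
    assume d: "derived P (carrier P) = {\<one>}"
    obtain x where x: "x \<in> M" "x \<noteq> 0" using M_nontriv by blast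
    obtain g where g: "g \<in> carrier P" "vec g = (x, 0, 0)" using vec_lift[of "(x, 0, 0)"] x by auto
    have "g \<otimes> h = h \<otimes> g" if h: "h \<in> carrier P" for h
    proof -
      have "g \<otimes> h \<otimes> inv g \<otimes> inv h \<in> derived P (carrier P)"
        unfolding derived_def by (rule generate.incl) (use g h in blast)
      then have "g \<otimes> h \<otimes> inv (h \<otimes> g) = \<one>" using d g h by (simp add: inv_mult_group m_assoc)
      then show ?thesis using g h by (metis inv_closed inv_equality inv_inv m_closed)
    qed
    then have "vec g = 0" using central_iff[OF g(1)] by blast
    then show False using g x by (simp add: zero_prod_def)
  qed
  show "g [^] p = \<one>" if g: "g \<in> carrier P" for g
  proof (rule coord_inj)
    show "vec (g [^] p) = vec \<one>" unfolding vec_pow[OF g] char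
      by (cases "vec g") (simp add: vec_one vsc_def zero_prod_def)
    show "cen (g [^] p) = cen \<one>" unfolding cen_pow[OF g] char
      by (cases "cen g") (simp add: cen_one tsc_def zero_prod_def)
  qed (use g in auto)
qed

text \<open>An even number not exceeding \<open>2 * N - 1\<close> is \<open>2 * j\<close> with
  \<open>j < N\<close>, so the frames \<open>Fr j\<close> represent all orbits. No two are
  conjugate: an exchange of square classes would make \<open>2 * (j + i)\<close> equal to an odd
  number.\<close>

lemma card_orbits:
  assumes N: "N > 0" and frames: "\<And>F. frame F \<Longrightarrow> card F = 2 * N - 1 \<and> even (nsq F)"
    and ex: "\<And>j. j < N \<Longrightarrow> \<exists>F. frame F \<and> nsq F = 2 * j"
  shows "card (fr_orbits P) = N"
proof -
  define Fr where "Fr j = (SOME F. frame F \<and> nsq F = 2 * j)" for j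
  have Fr: "frame (Fr j)" "nsq (Fr j) = 2 * j" if "j < N" for j
    using someI_ex[OF ex[OF that]] unfolding Fr_def by blast+
  have sub: "\<And>F H. H \<in> Grl ` F \<Longrightarrow> H \<subseteq> carrier P" by (auto simp: Gr_def)
  have "fr_orbits P = (\<lambda>j. orbit_of (Grl ` Fr j)) ` {..<N}"
  proof
    show "fr_orbits P \<subseteq> (\<lambda>j. orbit_of (Grl ` Fr j)) ` {..<N}"
    proof
      fix Z assume "Z \<in> fr_orbits P"
      then obtain Hs where Hs: "fully_refined P Hs" "Z = orbit_of Hs"
        unfolding fr_orbits_def orbit_of_def by blast
      obtain F where F: "frame F" "Hs = Grl ` F" using fully_refined_frame[OF Hs(1)] by blast
      have "nsq F \<le> card F" unfolding nsq_def by (rule card_mono) (use frame_finite[OF F(1)] in auto)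
      then obtain j where j: "nsq F = 2 * j" "j < N" using frames[OF F(1)] N by (auto elim!: evenE)
      obtain \<alpha> where a: "\<alpha> \<in> auto P" "act_decomp \<alpha> (Grl ` Fr j) = Grl ` F"
        using frames_conjugate[OF Fr(1)[OF j(2)] F(1)] frames[OF Fr(1)[OF j(2)]] frames[OF F(1)] Fr(2)[OF j(2)] j(1)
        by auto
      have "orbit_of (act_decomp \<alpha> (Grl ` Fr j)) = orbit_of (Grl ` Fr j)" by (rule orbit_of_act[OF sub a(1)])
      then have "Z = orbit_of (Grl ` Fr j)" using Hs(2) F(2) a(2) by simp
      then show "Z \<in> (\<lambda>j. orbit_of (Grl ` Fr j)) ` {..<N}" using j(2) by blast
    qed
    show "(\<lambda>j. orbit_of (Grl ` Fr j)) ` {..<N} \<subseteq> fr_orbits P"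
    proof
      fix Z assume "Z \<in> (\<lambda>j. orbit_of (Grl ` Fr j)) ` {..<N}"
      then obtain j where j: "j < N" "Z = orbit_of (Grl ` Fr j)" by auto
      then show "Z \<in> fr_orbits P" unfolding fr_orbits_def orbit_of_def
        using frame_fully_refined[OF Fr(1)[OF j(1)]] by auto
    qed
  qed
  moreover have "inj_on (\<lambda>j. orbit_of (Grl ` Fr j)) {..<N}"
  proof (rule inj_onI)
    fix i j assume ij: "i \<in> {..<N}" "j \<in> {..<N}" "orbit_of (Grl ` Fr i) = orbit_of (Grl ` Fr j)"
    have "Grl ` Fr j \<in> orbit_of (Grl ` Fr i)" unfolding ij(3) by (rule orbit_of_self[OF sub])
    then obtain \<alpha> where a: "\<alpha> \<in> auto P" "act_decomp \<alpha> (Grl ` Fr i) = Grl ` Fr j" unfolding orbit_of_def by auto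
    have F: "frame (Fr i)" "frame (Fr j)" "nsq (Fr i) = 2 * i" "nsq (Fr j) = 2 * j" using Fr ij by auto
    from auto_nsq[OF F(1,2) a] show "i = j"
    proof
      assume "nsq (Fr j) + nsq (Fr i) = card (Fr i)"
      then have "2 * (j + i) = 2 * N - 1" using F frames[OF F(1)] by simp
      then have "even (2 * N - 1)" by (metis dvd_triv_left)
      then show ?thesis using N by simp
    qed (use F in simp)
  qed
  ultimately show ?thesis by (simp add: card_image)
qed

end

section \<open>The cross product group on the natural numbers\<close>

context quad_space
begin

text \<open>The group \<open>(u, t) (v, s) = (u + v, t + s + ct u v)\<close>, transported along the coding \<open>f\<close>.\<close>

definition coded_group :: "(('v \<times> 'v \<times> 'v) \<times> ('k \<times> 'k \<times> 'k) \<Rightarrow> nat) \<Rightarrow> nat monoid" where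
  "coded_group f = (let C = (M \<times> M \<times> M) \<times> (K \<times> K \<times> K); g = inv_into C f in
     \<lparr>carrier = f ` C,
      monoid.mult = (\<lambda>x y. f (fst (g x) + fst (g y), snd (g x) + snd (g y) + ct (fst (g x)) (fst (g y)))),
      one = f 0\<rparr>)"

lemma coded_cross_model:
  assumes inj: "inj_on f ((M \<times> M \<times> M) \<times> (K \<times> K \<times> K))"
  defines "g \<equiv> inv_into ((M \<times> M \<times> M) \<times> (K \<times> K \<times> K)) f"
  shows "cross_model e p M sc dt (coded_group f) (\<lambda>x. fst (g x)) (\<lambda>x. snd (g x))"
proof -
  define C where "C = (M \<times> M \<times> M) \<times> (K \<times> K \<times> K)"
  define m where "m u v = (fst u + fst v, snd u + snd v + ct (fst u) (fst v))"
    for u v :: "('v \<times> 'v \<times> 'v) \<times> ('k \<times> 'k \<times> 'k)"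
  have car: "carrier (coded_group f) = f ` C" "\<one>\<^bsub>coded_group f\<^esub> = f 0"
    "\<And>x y. x \<otimes>\<^bsub>coded_group f\<^esub> y = f (m (g x) (g y))"
    by (simp_all add: coded_group_def C_def g_def m_def Let_def)
  have g: "g (f c) = c" if "c \<in> C" for c using inv_into_f_f[OF inj] that by (simp add: g_def C_def)
  have mC: "m u v \<in> C" if uv: "u \<in> C" "v \<in> C" for u v
  proof -
    have 1: "fst u \<in> M \<times> M \<times> M" "fst v \<in> M \<times> M \<times> M" "snd u \<in> K \<times> K \<times> K" "snd v \<in> K \<times> K \<times> K"
      using uv by (auto simp: C_def)
    have "x + y \<in> K \<times> K \<times> K" if "x \<in> K \<times> K \<times> K" "y \<in> K \<times> K \<times> K" for x y using that by auto
    moreover have "x + y \<in> M \<times> M \<times> M" if "x \<in> M \<times> M \<times> M" "y \<in> M \<times> M \<times> M" for x y using that by auto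
    ultimately show ?thesis using 1 ct_K[OF 1(1,2)] unfolding m_def C_def by (metis SigmaI)
  qed
  have C0: "0 \<in> C" by (simp add: C_def zero_prod_def)
  have assoc: "m (m u v) w = m u (m v w)" for u v w
    by (simp add: m_def ct_add_left ct_add_right ac_simps)
  have unit: "m 0 u = u" for u by (simp add: m_def)
  have invC: "(- fst u, - snd u) \<in> C" if "u \<in> C" for u using that by (auto simp: C_def)
  have inv: "m (- fst u, - snd u) u = 0" for u by (simp add: m_def ct_uminus zero_prod_def)
  have "group (coded_group f)"
  proof (rule groupI; (unfold car)?)
    fix x assume "x \<in> f ` C"
    then obtain u where u: "u \<in> C" "x = f u" by blast
    show "f (m (g (f 0)) (g x)) = x" using u g C0 unit by simp
    show "\<exists>y \<in> f ` C. f (m (g y) (g x)) = f 0"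
      using u g invC[OF u(1)] inv by (intro bexI[of _ "f (- fst u, - snd u)"]) auto
    fix y assume "y \<in> f ` C"
    then obtain v where v: "v \<in> C" "y = f v" by blast
    show "f (m (g x) (g y)) \<in> f ` C" using u v g mC by simp
    fix z assume "z \<in> f ` C"
    then obtain w where w: "w \<in> C" "z = f w" by blast
    show "f (m (g (f (m (g x) (g y)))) (g z)) = f (m (g x) (g (f (m (g y) (g z)))))"
      using u v w g mC assoc by simp
  qed (use C0 in blast)
  then interpret group "coded_group f" .
  show ?thesis
  proof
    fix x assume x: "x \<in> carrier (coded_group f)"
    then obtain u where u: "u \<in> C" "x = f u" using car by blast
    show "fst (g x) \<in> M \<times> M \<times> M" "snd (g x) \<in> K \<times> K \<times> K" using u g by (auto simp: C_def)
    fix y assume y: "y \<in> carrier (coded_group f)"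
    then obtain v where v: "v \<in> C" "y = f v" using car by blast
    show "x = y" if "fst (g x) = fst (g y)" "snd (g x) = snd (g y)"
    proof -
      have "u = v" by (rule prod_eqI) (use that u v g in simp_all)
      then show ?thesis using u v by simp
    qed
    show "fst (g (x \<otimes>\<^bsub>coded_group f\<^esub> y)) = fst (g x) + fst (g y)"
      using u v g mC by (simp add: car) (simp add: m_def)
    show "snd (g (x \<otimes>\<^bsub>coded_group f\<^esub> y)) = snd (g x) + snd (g y) + ct (fst (g x)) (fst (g y))"
      using u v g mC by (simp add: car) (simp add: m_def)
  next
    fix u t assume "u \<in> M \<times> M \<times> M" "t \<in> K \<times> K \<times> K"
    then have "(u, t) \<in> C" by (simp add: C_def)
    then show "\<exists>x \<in> carrier (coded_group f). fst (g x) = u \<and> snd (g x) = t"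
      using g car by (intro bexI[of _ "f (u, t)"]) auto
  qed
qed

end

theorem orbit_number_attained:
  assumes p: "Factorial_Ring.prime p" "odd p" and N: "N > 0"
  shows "\<exists>P :: nat monoid. class2_exp_p_group p P \<and> card (fr_orbits P) = N"
proof -
  \<comment> \<open>Exactly \<open>N\<close> even numbers lie between 0 and
    \<open>2 * N - 1\<close>, and the dimension is odd.\<close>
  define n where "n = 2 * N - 1"
  have n: "n > 0" using N by (simp add: n_def)
  interpret prime_field "residue_unit p" p by (rule residue_unit_prime_field[OF p])
  interpret Q: quad_space "residue_unit p" p "vecs n" smult "dot n" by (rule vecs_quad_space[OF n])
  let ?C = "(vecs n \<times> vecs n \<times> vecs n) \<times> (K \<times> K \<times> K)"
  have "finite ?C" using Q.finite_M finite_K by simp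
  from finite_imp_inj_to_nat_seg[OF this] obtain f :: "_ \<Rightarrow> nat" where f: "inj_on f ?C"
    by (elim exE conjE)
  interpret C: cross_model "residue_unit p" p "vecs n" smult "dot n" "Q.coded_group f"
    "\<lambda>x. fst (inv_into ?C f x)" "\<lambda>x. snd (inv_into ?C f x)"
    by (rule Q.coded_cross_model[OF f])
  note D = vecs_frame[OF n]
  have "card (vecs n) = p ^ n" using Q.frame_card[OF D(1)] D(3) by simp
  then have "class2_exp_p_group p (Q.coded_group f)" by (rule C.class2)
  moreover have "card (fr_orbits (Q.coded_group f)) = N"
  proof (rule C.card_orbits[OF N])
    show "card F = 2 * N - 1 \<and> even (Q.nsq F)" if "Q.frame F" for F
      using vecs_frame_parity[OF n that] by (simp add: n_def)
    show "\<exists>F. Q.frame F \<and> Q.nsq F = 2 * j" if "j < N" for j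
      by (rule Q.frames_exist[OF D(1,2)]) (use that D(3) in \<open>simp add: n_def\<close>)
  qed
  ultimately show ?thesis by blast
qed

theorem theorem1p1:
  fixes p :: nat
  assumes "Factorial_Ring.prime p" and "odd p"
  shows "(\<forall>(P :: ('a, 'b) monoid_scheme) Hs Ks.
            class2_exp_p_group p P \<and> fully_refined P Hs \<and> fully_refined P Ks \<longrightarrow>
              card Hs = card Ks \<and>
              image_mset card (mset_set Hs) = image_mset card (mset_set Ks) \<and>
              image_mset (\<lambda>H. card (group_center (P\<lparr>carrier := H\<rparr>))) (mset_set Hs) =
              image_mset (\<lambda>K. card (group_center (P\<lparr>carrier := K\<rparr>))) (mset_set Ks))
       \<and> (\<forall>N :: nat. N > 0 \<longrightarrow>
            (\<exists>P :: nat monoid. class2_exp_p_group p P \<and> card (fr_orbits P) = N))"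
proof (intro conjI allI impI)
  fix P :: "('a, 'b) monoid_scheme" and Hs Ks
  assume "class2_exp_p_group p P \<and> fully_refined P Hs \<and> fully_refined P Ks"
  then have h: "class2_exp_p_group p P" "fully_refined P Hs" "fully_refined P Ks" by simp_all
  show "card Hs = card Ks" "image_mset card (mset_set Hs) = image_mset card (mset_set Ks)"
    "image_mset (\<lambda>H. card (group_center (P\<lparr>carrier := H\<rparr>))) (mset_set Hs) =
     image_mset (\<lambda>K. card (group_center (P\<lparr>carrier := K\<rparr>))) (mset_set Ks)"
    by (rule fully_refined_same_cards[OF assms h])+
next
  fix N :: nat
  assume "N > 0"
  then show "\<exists>P :: nat monoid. class2_exp_p_group p P \<and> card (fr_orbits P) = N"
    by (rule orbit_number_attained[OF assms])
qed

end
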